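(* The operator $$\begin{bmatrix} A_s & C\\ C' & -(A_s+\gamma_T'\gamma_T)\end{bmatrix}\colon Y\times X\to Y'\times X'$$ is self-adjoint, bounded and boundedly invertible. Moreover, for $g\in Y'$ and $u_0\in H$, the unique solution $(\lambda,u)\in Y\times X$ of $$\begin{bmatrix} A_s & C\\ C' & -(A_s+\gamma_T'\gamma_T)\end{bmatrix}\begin{bmatrix}\lambda\\ u\end{bmatrix}=\begin{bmatrix} g\\ -(g+\gamma_0'u_0)\end{bmatrix}$$ satisfies $\lambda=u$, and $u$ is the solution in $X$ of the parabolic problem $Bu=g$ in $Y'$, $\gamma_0u=u_0$ in $H$.
   Context: All spaces are real. Let $V,H$ be separable Hilbert spaces (of functions on some spatial domain) with $V\hookrightarrow H$ densely and compactly; identify $H$ with its dual, giving the Gelfand triple $V\hookrightarrow H\simeq H'\hookrightarrow V'$. $\langle\cdot,\cdot\rangle$ denotes the scalar product on $H$ and also its continuous extension to the duality pairing on $V'\times V$. Let $T>0$ and $I:=(0,T)$. For a.e. $t\in I$, $a(t;\cdot,\cdot)$ is a bilinear form on $V\times V$ such that $t\mapsto a(t;\eta,\zeta)$ is measurable for all $\eta,\zeta\in V$, and, with constants independent of $t$, $|a(t;\eta,\zeta)|\lesssim\|\eta\|_V\|\zeta\|_V$ and $a(t;\eta,\eta)\gtrsim\|\eta\|_V^2$ for all $\eta,\zeta\in V$ and a.e. $t\in I$. Set $Y:=L_2(I;V)$ and $X:=L_2(I;V)\cap H^1(I;V')$. One has $X\hookrightarrow C(\bar I;H)$, and for $t\in\bar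 I$, $\gamma_t\colon X\to H$, $\gamma_tu:=u(t,\cdot)$, is the bounded trace map. Define $A\colon Y\to Y'$, $(Au)(v):=\int_I a(t;u(t),v(t))\,dt$, and $B\colon X\to Y'$, $(Bw)(v):=\int_I\langle\frac{dw}{dt}(t),v(t)\rangle+a(t;w(t),v(t))\,dt$. Let $A_s:=\frac12(A+A')$ and $C:=B-A_s\colon X\to Y'$. Primes on operators denote dual operators (e.g. $C'\colon Y\to X'$, $(C'v)(w)=(Cw)(v)$; $\gamma_t'\colon H\to X'$, $(\gamma_t'h)(w)=\langle h,w(t)\rangle$). Elements of $Y'$ are also viewed as elements of $X'$ by restriction to $X\subset Y$. It is known that $\begin{bmatrix}B\\\gamma_0\end{bmatrix}\colon X\to Y'\times H$ is bounded and boundedly invertible. *)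

theory Defs
  imports "HOL-Analysis.Analysis" "HOL-Library.Function_Algebras"
begin

section \<open>Pointwise scalar multiplication of functions\<close>

instantiation "fun" :: (type, real_vector) real_vector
begin

definition scaleR_fun :: "real \<Rightarrow> ('a \<Rightarrow> 'b) \<Rightarrow> 'a \<Rightarrow> 'b"
  where "scaleR_fun c f = (\<lambda>x. c *\<^sub>R f x)"

instance
  by standard (simp_all add: scaleR_fun_def fun_eq_iff scaleR_add_left scaleR_add_right)

end

section \<open>Operators between (semi)normed spaces given by carriers\<close>

text \<open>
  A space is a linear subspace \<open>S\<close> of a real vector space together with a seminorm \<open>N\<close> on it,
  and stands for the normed quotient space \<open>S / {x. N x = 0}\<close>: two elements \<open>x\<close>, \<open>y\<close> of \<open>S\<close>
  represent the same vector iff \<open>N (x - y) = 0\<close>. For Lebesgue spaces this is equality almost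
  everywhere.
\<close>

definition bounded_operator ::
    "'a::real_vector set \<Rightarrow> ('a \<Rightarrow> real) \<Rightarrow> 'b::real_vector set \<Rightarrow> ('b \<Rightarrow> real) \<Rightarrow> ('a \<Rightarrow> 'b) \<Rightarrow> bool"
  where "bounded_operator S N R M F \<longleftrightarrow>
    (\<forall>x\<in>S. F x \<in> R) \<and>
    (\<forall>x\<in>S. \<forall>y\<in>S. M (F (x + y) - (F x + F y)) = 0) \<and>
    (\<forall>c. \<forall>x\<in>S. M (F (c *\<^sub>R x) - c *\<^sub>R F x) = 0) \<and>
    (\<exists>K. \<forall>x\<in>S. M (F x) \<le> K * N x)"

definition boundedly_invertible ::
    "'a::real_vector set \<Rightarrow> ('a \<Rightarrow> real) \<Rightarrow> 'b::real_vector set \<Rightarrow> ('b \<Rightarrow> real) \<Rightarrow> ('a \<Rightarrow> 'b) \<Rightarrow> bool"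
  where "boundedly_invertible S N R M F \<longleftrightarrow>
    (\<exists>G. bounded_operator R M S N G \<and>
         (\<forall>x\<in>S. N (G (F x) - x) = 0) \<and> (\<forall>y\<in>R. M (F (G y) - y) = 0))"

definition zero_outside :: "'a set \<Rightarrow> ('a \<Rightarrow> real) \<Rightarrow> 'a \<Rightarrow> real"
  where "zero_outside S f = (\<lambda>x. if x \<in> S then f x else 0)"

text \<open>
  Functionals on \<open>S\<close> are total functions; the value \<open>0\<close> off \<open>S\<close> makes each of them unique.
\<close>

definition dual_space :: "'a::real_vector set \<Rightarrow> ('a \<Rightarrow> real) \<Rightarrow> ('a \<Rightarrow> real) set"
  where "dual_space S N = {f.
    (\<forall>x. x \<notin> S \<longrightarrow> f x = 0) \<and>
    (\<forall>x\<in>S. \<forall>y\<in>S. f (x + y) = f x + f y) \<and>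
    (\<forall>c. \<forall>x\<in>S. f (c *\<^sub>R x) = c * f x) \<and>
    (\<exists>K. \<forall>x\<in>S. \<bar>f x\<bar> \<le> K * N x)}"

definition dual_norm :: "'a set \<Rightarrow> ('a \<Rightarrow> real) \<Rightarrow> ('a \<Rightarrow> real) \<Rightarrow> real"
  where "dual_norm S N f = (SUP x\<in>{x\<in>S. N x \<le> 1}. \<bar>f x\<bar>)"

text \<open>The dual \<open>F' : R \<rightarrow> S'\<close> of an operator \<open>F : S \<rightarrow> R'\<close>, for reflexive \<open>R\<close>.\<close>

definition dual_operator :: "'a set \<Rightarrow> ('a \<Rightarrow> 'b \<Rightarrow> real) \<Rightarrow> 'b \<Rightarrow> 'a \<Rightarrow> real"
  where "dual_operator S F = (\<lambda>v. zero_outside S (\<lambda>w. F w v))"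

definition prod_norm :: "('a \<Rightarrow> real) \<Rightarrow> ('b \<Rightarrow> real) \<Rightarrow> 'a \<times> 'b \<Rightarrow> real"
  where "prod_norm N M = (\<lambda>(x, y). sqrt ((N x)\<^sup>2 + (M y)\<^sup>2))"

text \<open>The identification of \<open>S' \<times> R'\<close> with \<open>(S \<times> R)'\<close>.\<close>

definition pair_functional :: "('a \<Rightarrow> real) \<times> ('b \<Rightarrow> real) \<Rightarrow> 'a \<times> 'b \<Rightarrow> real"
  where "pair_functional = (\<lambda>(f, g) (x, y). f x + g y)"

text \<open>
  For an operator \<open>F : S \<times> R \<rightarrow> S' \<times> R'\<close> on reflexive spaces: \<open>F' = F\<close>.
\<close>

definition self_adjoint ::
    "'a set \<Rightarrow> 'b set \<Rightarrow> ('a \<times> 'b \<Rightarrow> ('a \<Rightarrow> real) \<times> ('b \<Rightarrow> real)) \<Rightarrow> bool"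
  where "self_adjoint S R F \<longleftrightarrow>
    (\<forall>q\<in>S \<times> R. \<forall>p\<in>S \<times> R.
       dual_operator (S \<times> R) (\<lambda>p. pair_functional (F p)) q p = pair_functional (F q) p)"

section \<open>Bochner spaces on \<open>(0, T)\<close>\<close>

abbreviation time_measure :: "real \<Rightarrow> real measure"
  where "time_measure T \<equiv> lebesgue_on {0<..<T}"

text \<open>
  Borel measurability is strong measurability here, as the values lie in separable spaces
  (\<open>V\<close>, or the dual of the separable Hilbert space \<open>V\<close>).
\<close>

definition L2_space :: "real \<Rightarrow> (real \<Rightarrow> 'b::real_normed_vector) set"
  where "L2_space T = {v. v \<in> borel_measurable (time_measure T) \<and>
                          integrable (time_measure T) (\<lambda>t. (norm (v t))\<^sup>2)}"

definition L2_norm :: "real \<Rightarrow> (real \<Rightarrow> 'b::real_normed_vector) \<Rightarrow> real"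
  where "L2_norm T v = sqrt (\<integral>t. (norm (v t))\<^sup>2 \<partial>time_measure T)"

definition test_function :: "real \<Rightarrow> (real \<Rightarrow> real) \<Rightarrow> bool"
  where "test_function T \<phi> \<longleftrightarrow>
    (\<forall>n t. (deriv ^^ n) \<phi> differentiable (at t)) \<and>
    (\<exists>K. compact K \<and> K \<subseteq> {0<..<T} \<and> (\<forall>t. t \<notin> K \<longrightarrow> \<phi> t = 0))"

text \<open>
  Here \<open>V'\<close> is the type \<open>'v \<Rightarrow>\<^sub>L real\<close>, and \<open>j : V \<rightarrow> H\<close> is the embedding, so that \<open>\<eta> \<in> V\<close>,
  seen in \<open>V'\<close>, is the functional \<open>\<zeta> \<mapsto> j \<eta> \<bullet> j \<zeta>\<close>. The identity
  \<open>\<integral> \<phi>' u = - \<integral> \<phi> w\<close> of Bochner integrals in \<open>V'\<close> is written out by evaluation at each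
  \<open>\<zeta> \<in> V\<close>; the Bochner integral of the library is not available for the type \<open>'v \<Rightarrow>\<^sub>L real\<close>, which
  is not an instance of \<open>second_countable_topology\<close>.
\<close>

definition weak_derivative ::
    "real \<Rightarrow> ('v::real_normed_vector \<Rightarrow> 'h::real_inner) \<Rightarrow> (real \<Rightarrow> 'v) \<Rightarrow> (real \<Rightarrow> 'v \<Rightarrow>\<^sub>L real) \<Rightarrow> bool"
  where "weak_derivative T j u w \<longleftrightarrow> w \<in> L2_space T \<and>
    (\<forall>\<phi> \<zeta>. test_function T \<phi> \<longrightarrow>
       (\<integral>t. deriv \<phi> t * (j (u t) \<bullet> j \<zeta>) \<partial>time_measure T) =
       - (\<integral>t. \<phi> t * blinfun_apply (w t) \<zeta> \<partial>time_measure T))"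

definition time_deriv ::
    "real \<Rightarrow> ('v::real_normed_vector \<Rightarrow> 'h::real_inner) \<Rightarrow> (real \<Rightarrow> 'v) \<Rightarrow> real \<Rightarrow> 'v \<Rightarrow>\<^sub>L real"
  where "time_deriv T j u = (SOME w. weak_derivative T j u w)"

text \<open>\<open>X = L\<^sub>2(I; V) \<inter> H\<^sup>1(I; V')\<close>, and \<open>Y = L\<^sub>2(I; V)\<close> is \<open>L2_space T\<close>.\<close>

definition X_space :: "real \<Rightarrow> ('v::real_normed_vector \<Rightarrow> 'h::real_inner) \<Rightarrow> (real \<Rightarrow> 'v) set"
  where "X_space T j = {u \<in> L2_space T. \<exists>w. weak_derivative T j u w}"

text \<open>
  The \<open>L\<^sub>2(I; V')\<close>-norm of \<open>u\<close> itself is dominated by its \<open>L\<^sub>2(I; V)\<close>-norm and is left out.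
\<close>

definition X_norm :: "real \<Rightarrow> ('v::real_normed_vector \<Rightarrow> 'h::real_inner) \<Rightarrow> (real \<Rightarrow> 'v) \<Rightarrow> real"
  where "X_norm T j u = sqrt ((L2_norm T u)\<^sup>2 + (L2_norm T (time_deriv T j u))\<^sup>2)"

text \<open>
  \<open>\<gamma>\<^sub>t u\<close>: the value at \<open>t \<in> [0, T]\<close> of the representative of \<open>u\<close> in \<open>C([0, T]; H)\<close>.
\<close>

definition time_trace :: "real \<Rightarrow> ('v \<Rightarrow> 'h::real_inner) \<Rightarrow> real \<Rightarrow> (real \<Rightarrow> 'v) \<Rightarrow> 'h"
  where "time_trace T j t u =
    (THE h. \<exists>c. continuous_on {0..T} c \<and> (AE s in time_measure T. c s = j (u s)) \<and> h = c t)"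

definition trace_dual ::
    "real \<Rightarrow> ('v::real_normed_vector \<Rightarrow> 'h::real_inner) \<Rightarrow> real \<Rightarrow> 'h \<Rightarrow> (real \<Rightarrow> 'v) \<Rightarrow> real"
  where "trace_dual T j t h = zero_outside (X_space T j) (\<lambda>w. h \<bullet> time_trace T j t w)"

section \<open>The parabolic operators\<close>

definition op_A ::
    "real \<Rightarrow> (real \<Rightarrow> 'v::real_normed_vector \<Rightarrow> 'v \<Rightarrow> real) \<Rightarrow> (real \<Rightarrow> 'v) \<Rightarrow> (real \<Rightarrow> 'v) \<Rightarrow> real"
  where "op_A T a u = zero_outside (L2_space T) (\<lambda>v. \<integral>t. a t (u t) (v t) \<partial>time_measure T)"

definition op_B ::
    "real \<Rightarrow> ('v::real_normed_vector \<Rightarrow> 'h::real_inner) \<Rightarrow> (real \<Rightarrow> 'v \<Rightarrow> 'v \<Rightarrow> real) \<Rightarrow>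
     (real \<Rightarrow> 'v) \<Rightarrow> (real \<Rightarrow> 'v) \<Rightarrow> real"
  where "op_B T j a w = zero_outside (L2_space T)
    (\<lambda>v. \<integral>t. blinfun_apply (time_deriv T j w t) (v t) + a t (w t) (v t) \<partial>time_measure T)"

definition op_As ::
    "real \<Rightarrow> (real \<Rightarrow> 'v::real_normed_vector \<Rightarrow> 'v \<Rightarrow> real) \<Rightarrow> (real \<Rightarrow> 'v) \<Rightarrow> (real \<Rightarrow> 'v) \<Rightarrow> real"
  where "op_As T a u = (1/2) *\<^sub>R (op_A T a u + dual_operator (L2_space T) (op_A T a) u)"

definition op_C ::
    "real \<Rightarrow> ('v::real_normed_vector \<Rightarrow> 'h::real_inner) \<Rightarrow> (real \<Rightarrow> 'v \<Rightarrow> 'v \<Rightarrow> real) \<Rightarrow>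
     (real \<Rightarrow> 'v) \<Rightarrow> (real \<Rightarrow> 'v) \<Rightarrow> real"
  where "op_C T j a u = op_B T j a u - op_As T a u"

definition block_operator ::
    "real \<Rightarrow> ('v::real_normed_vector \<Rightarrow> 'h::real_inner) \<Rightarrow> (real \<Rightarrow> 'v \<Rightarrow> 'v \<Rightarrow> real) \<Rightarrow>
     (real \<Rightarrow> 'v) \<times> (real \<Rightarrow> 'v) \<Rightarrow> ((real \<Rightarrow> 'v) \<Rightarrow> real) \<times> ((real \<Rightarrow> 'v) \<Rightarrow> real)"
  where "block_operator T j a = (\<lambda>(l, u).
    (op_As T a l + op_C T j a u,
     dual_operator (X_space T j) (op_C T j a) l -
       (zero_outside (X_space T j) (op_As T a u) + trace_dual T j T (time_trace T j T u))))"

end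

(*
  Eliminating l through the coercive form of A_s, the system becomes an equation on X for the Schur
  complement C' A_s^-1 C + A_s + gamma_T' gamma_T. It is coercive on X, because u' is recovered from
  C u and u, so the Riesz theorem solves it; testing the system with (l, -u) gives the a priori bound.

  For the data (g, -(g + gamma_0' u0)), integration by parts turns the system for e = l - u into
  (B w)(e) = <u(0) - u0, w(0)> for all w in X. Hence e lies in X and solves -e' + A'e = 0, e(T) = 0,
  so e = 0. Existence for the parabolic problem is thus a consequence, not an ingredient.

  Traces and integration by parts are obtained by regularising in space rather than in time: with
  K = j* j on V and Z_b = (1 + b K)^-1, the function b Z_b K u is absolutely continuous into V because
  K u is, and it converges to u as b tends to infinity.
*)

theory Submission
  imports Defs "HOL-Computational_Algebra.Polynomial"
begin

section \<open>Minimisation and dual norms on seminormed carriers\<close>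

text \<open>The derivative of u lies only in V', so the square of the H-norm of u cannot be
  differentiated directly. Under the Riesz isometry V' becomes V and the inclusion of V in V'
  becomes \<open>K\<close>; the weak derivative then says that \<open>K u\<close> has the derivative
  \<open>W\<close>, both with values in V, where a product rule is available. Since n Z_n commutes
  with K and n K Z_n = 1 - Z_n, the H-energy of the regularised function changes by the integral of
  twice the inner product of (1 - Z_n) W and (1 - Z_n) u, and both factors converge in L2. Nothing
  is extended past 0 or T, so the end times are treated like interior ones.

  Function spaces are carriers with seminorms, so the Riesz theorem is proved once for such carriers
  and serves V, Y and X alike.

  The form of A_s and the terminal term do not see the derivative: testing with (l, -u) bounds the
  Y-norms of l and u in terms of the data and the X-norm of u, and the derivative of u has to be
  read off from the first equation.\<close>

definition seminorm_on :: "'a::real_vector set \<Rightarrow> ('a \<Rightarrow> real) \<Rightarrow> bool"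
  where "seminorm_on S N \<longleftrightarrow> subspace S \<and> (\<forall>x\<in>S. 0 \<le> N x) \<and>
    (\<forall>x\<in>S. \<forall>y\<in>S. N (x + y) \<le> N x + N y) \<and> (\<forall>c. \<forall>x\<in>S. N (c *\<^sub>R x) = \<bar>c\<bar> * N x)"

definition complete_on :: "'a::real_vector set \<Rightarrow> ('a \<Rightarrow> real) \<Rightarrow> bool"
  where "complete_on S N \<longleftrightarrow>
    (\<forall>s. (\<forall>n::nat. s n \<in> S) \<and> (\<forall>e>0. \<exists>M. \<forall>m\<ge>M. \<forall>n\<ge>M. N (s m - s n) < e) \<longrightarrow>
      (\<exists>x\<in>S. (\<lambda>n. N (s n - x)) \<longlonglongrightarrow> 0))"

definition linear_form_on :: "'a::real_vector set \<Rightarrow> ('a \<Rightarrow> real) \<Rightarrow> bool"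
  where "linear_form_on S f \<longleftrightarrow>
    (\<forall>x\<in>S. \<forall>y\<in>S. f (x + y) = f x + f y) \<and> (\<forall>c. \<forall>x\<in>S. f (c *\<^sub>R x) = c * f x)"

definition bilinear_form_on :: "'a::real_vector set \<Rightarrow> 'b::real_vector set \<Rightarrow> ('a \<Rightarrow> 'b \<Rightarrow> real) \<Rightarrow> bool"
  where "bilinear_form_on S R b \<longleftrightarrow>
    (\<forall>x\<in>S. linear_form_on R (b x)) \<and> (\<forall>y\<in>R. linear_form_on S (\<lambda>x. b x y))"

lemma linear_form_onD:
  assumes "linear_form_on S f"
  shows "x \<in> S \<Longrightarrow> y \<in> S \<Longrightarrow> f (x + y) = f x + f y" "x \<in> S \<Longrightarrow> f (c *\<^sub>R x) = c * f x"
  using assms by (auto simp: linear_form_on_def)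

lemma linear_form_on_diff:
  assumes "linear_form_on S f" "subspace S" "x \<in> S" "y \<in> S"
  shows "f (x - y) = f x - f y"
  using linear_form_onD(1)[OF assms(1), of x "(-1) *\<^sub>R y"] linear_form_onD(2)[OF assms(1,4), of "-1"]
    subspace_scale[OF assms(2,4), of "-1"] assms(3) by simp

lemma bilinear_form_onD:
  assumes "bilinear_form_on S R b"
  shows "x \<in> S \<Longrightarrow> linear_form_on R (b x)" "y \<in> R \<Longrightarrow> linear_form_on S (\<lambda>x. b x y)"
  using assms by (auto simp: bilinear_form_on_def)

lemma seminorm_onD:
  assumes "seminorm_on S N"
  shows "subspace S" "x \<in> S \<Longrightarrow> 0 \<le> N x" "x \<in> S \<Longrightarrow> y \<in> S \<Longrightarrow> N (x + y) \<le> N x + N y"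
    "x \<in> S \<Longrightarrow> N (c *\<^sub>R x) = \<bar>c\<bar> * N x"
  using assms by (auto simp: seminorm_on_def)

text \<open>The first-variation argument in scalar form. At t = -q / P the expression is
  \<open>q\<^sup>2 / P * (p / P - 2)\<close>, negative unless q = 0; \<open>P\<close> stands in for
  p, which may be zero or negative.\<close>

lemma linear_coefficient_zero:
  fixes p q :: real
  assumes "\<And>t. 0 \<le> t\<^sup>2 * p + 2 * t * q"
  shows "q = 0"
proof (rule ccontr)
  assume q: "q \<noteq> 0"
  define P where "P = \<bar>p\<bar> + 1"
  have P: "P > 0" "p < P" unfolding P_def by auto
  have "(- q / P)\<^sup>2 * p + 2 * (- q / P) * q = q\<^sup>2 / P * (p / P - 2)"
    using P by (simp add: field_simps power2_eq_square)
  moreover have "p / P - 2 < 0" using P by (simp add: field_simps)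
  moreover have "q\<^sup>2 / P > 0" using P q by simp
  ultimately have "(- q / P)\<^sup>2 * p + 2 * (- q / P) * q < 0"
    by (metis mult_pos_neg)
  then show False using assms[of "- q / P"] by linarith
qed

text \<open>The representer is the minimiser of \<open>b x x - 2 f x\<close>; minimising sequences are Cauchy by the
  parallelogram law.\<close>

lemma riesz_on:
  assumes N: "seminorm_on S N" and complete: "complete_on S N"
    and b: "bilinear_form_on S S b" and sym: "\<And>x y. x \<in> S \<Longrightarrow> y \<in> S \<Longrightarrow> b x y = b y x"
    and c: "0 < c" and coercive: "\<And>x. x \<in> S \<Longrightarrow> c * (N x)\<^sup>2 \<le> b x x"
    and bounded: "\<And>x y. x \<in> S \<Longrightarrow> y \<in> S \<Longrightarrow> \<bar>b x y\<bar> \<le> M * N x * N y"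
    and f: "linear_form_on S f" and fb: "\<And>x. x \<in> S \<Longrightarrow> \<bar>f x\<bar> \<le> K * N x"
  shows "\<exists>x\<in>S. \<forall>y\<in>S. b x y = f y"
proof -
  note S = seminorm_onD(1)[OF N]
  note Sadd = subspace_add[OF S] and Ssc = subspace_scale[OF S] and Sdiff = subspace_diff[OF S]
  note b1 = bilinear_form_onD(1)[OF b] and b2 = bilinear_form_onD(2)[OF b]
  note fD = linear_form_onD[OF f]
  define J where "J x = b x x - 2 * f x" for x
  have J_add: "J (x + t *\<^sub>R y) = J x + (t\<^sup>2 * b y y + 2 * t * (b x y - f y))"
    if "x \<in> S" "y \<in> S" for x y t
    unfolding J_def using that
    by (simp add: Sadd Ssc fD linear_form_onD[OF b1] linear_form_onD[OF b2] sym[of y x]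
        power2_eq_square algebra_simps)
  \<comment> \<open>Completing the square in \<open>N x\<close>: the coercive term beats the linear
    bound on \<open>f\<close>.\<close>
  have J_low: "- (K\<^sup>2 / c) \<le> J x" if x: "x \<in> S" for x
  proof -
    have "0 \<le> (c * N x - K)\<^sup>2 / c" using c by simp
    also have "\<dots> = c * (N x)\<^sup>2 - 2 * (K * N x) + K\<^sup>2 / c"
      using c by (simp add: field_simps power2_eq_square)
    finally show ?thesis using coercive[OF x] fb[OF x] unfolding J_def by linarith
  qed
  have bdd: "bdd_below (J ` S)" using J_low by (auto intro!: bdd_belowI2)
  have ne: "J ` S \<noteq> {}" using subspace_0[OF S] by auto
  define m where "m = Inf (J ` S)"
  have m_le: "m \<le> J x" if "x \<in> S" for x
    unfolding m_def using that bdd by (auto intro: cInf_lower)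
  have "\<exists>x\<in>S. J x < m + 1 / (real n + 1)" for n
  proof -
    have "m < m + 1 / (real n + 1)" by simp
    then show ?thesis unfolding m_def using cInf_lessD[OF ne] by fastforce
  qed
  then obtain s where s: "\<And>n. s n \<in> S" "\<And>n. J (s n) < m + 1 / (real n + 1)" by metis
  \<comment> \<open>The midpoint of \<open>s k\<close> and \<open>s l\<close> still has
    \<open>J\<close> at least \<open>m\<close>, so a quarter of \<open>b ?d ?d\<close> is at most
    the mean of the two excesses over \<open>m\<close>.\<close>
  have par: "c * (N (s k - s l))\<^sup>2 \<le> 2 * (1 / (real k + 1) + 1 / (real l + 1))" for k l
  proof -
    let ?d = "s l - s k"
    have d: "?d \<in> S" by (simp add: Sdiff s)
    have e1: "J (s k + (1/2) *\<^sub>R ?d) = J (s k) + ((1/2)\<^sup>2 * b ?d ?d + 2 * (1/2) * (b (s k) ?d - f ?d))"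
      by (rule J_add[OF s(1) d])
    have e2: "J (s k + 1 *\<^sub>R ?d) = J (s k) + (1\<^sup>2 * b ?d ?d + 2 * 1 * (b (s k) ?d - f ?d))"
      by (rule J_add[OF s(1) d])
    have "b ?d ?d / 4 = J (s k) / 2 + J (s l) / 2 - J (s k + (1/2) *\<^sub>R ?d)"
      using e1 e2 by (simp add: power2_eq_square field_simps)
    moreover have "m \<le> J (s k + (1/2) *\<^sub>R ?d)" by (intro m_le Sadd Ssc s d)
    ultimately have "b ?d ?d \<le> 2 * (1 / (real k + 1) + 1 / (real l + 1))"
      using s(2)[of k] s(2)[of l] by simp
    moreover have "N (s k - s l) = N ?d"
      using seminorm_onD(4)[OF N d, of "-1"] by simp
    ultimately show ?thesis using coercive[OF d] by simp
  qed
  have "\<exists>L. \<forall>k\<ge>L. \<forall>l\<ge>L. N (s k - s l) < e" if e: "0 < e" for e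
  proof -
    obtain L where L: "inverse (real (Suc L)) < c * e\<^sup>2 / 4"
      using reals_Archimedean[of "c * e\<^sup>2 / 4"] c e by auto
    have "N (s k - s l) < e" if kl: "k \<ge> L" "l \<ge> L" for k l
    proof -
      have "1 / (real k + 1) \<le> inverse (real (Suc L))" "1 / (real l + 1) \<le> inverse (real (Suc L))"
        using kl by (simp_all add: field_simps)
      then have "c * (N (s k - s l))\<^sup>2 \<le> 4 * inverse (real (Suc L))"
        using par[of k l] by argo
      then have "c * (N (s k - s l))\<^sup>2 < c * e\<^sup>2" using L by argo
      then have "(N (s k - s l))\<^sup>2 < e\<^sup>2" using c by simp
      then show ?thesis using e by (simp add: power2_less_imp_less)
    qed
    then show ?thesis by blast
  qed
  then obtain x where x: "x \<in> S" "(\<lambda>n. N (s n - x)) \<longlonglongrightarrow> 0"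
    using complete s(1) unfolding complete_on_def by blast
  have "(\<lambda>n. J (s n) + (M * (N (s n - x))\<^sup>2 + 2 * (M * N x * N (s n - x) + K * N (s n - x))))
     \<longlonglongrightarrow> m + (M * 0\<^sup>2 + 2 * (M * N x * 0 + K * 0))"
  proof (intro tendsto_intros x)
    have "(\<lambda>n. 1 / (real n + 1)) \<longlonglongrightarrow> 0" using LIMSEQ_inverse_real_of_nat by (simp add: field_simps)
    then have l: "(\<lambda>n. m + 1 / (real n + 1)) \<longlonglongrightarrow> m" by (auto intro: tendsto_eq_intros)
    show "(\<lambda>n. J (s n)) \<longlonglongrightarrow> m"
      by (rule tendsto_sandwich[OF always_eventually always_eventually tendsto_const l]) (use m_le s less_imp_le in blast)+
  qed
  \<comment> \<open>Expanding \<open>J\<close> around \<open>x\<close> bounds \<open>J x\<close> by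
    \<open>J (s n)\<close> plus terms that vanish with \<open>N (s n - x)\<close>; hence the limit
    attains the infimum.\<close>
  moreover have "J x \<le> J (s n) + (M * (N (s n - x))\<^sup>2 + 2 * (M * N x * N (s n - x) + K * N (s n - x)))" for n
  proof -
    let ?d = "s n - x"
    have d: "?d \<in> S" by (simp add: Sdiff s x)
    have "J (x + 1 *\<^sub>R ?d) = J x + (1\<^sup>2 * b ?d ?d + 2 * 1 * (b x ?d - f ?d))"
      by (rule J_add[OF x(1) d])
    then show ?thesis using bounded[OF d d] bounded[OF x(1) d] fb[OF d]
      by (simp add: power2_eq_square mult.assoc abs_le_iff)
  qed
  ultimately have Jx: "J x \<le> m" by (intro LIMSEQ_le_const[of _ m]) auto
  have "b x y = f y" if y: "y \<in> S" for y
  proof -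
    have "0 \<le> t\<^sup>2 * b y y + 2 * t * (b x y - f y)" for t
      using m_le[of "x + t *\<^sub>R y"] Jx J_add[OF x(1) y, of t] Sadd[OF x(1) Ssc[OF y]] by auto
    from linear_coefficient_zero[OF this] show ?thesis by simp
  qed
  then show ?thesis using x by blast
qed

section \<open>Dual norms\<close>

lemma dual_norm_zero:
  assumes "seminorm_on S N"
  shows "dual_norm S N 0 = 0"
proof -
  have "0 \<in> S" "N 0 = 0"
    using subspace_0[OF seminorm_onD(1)[OF assms]] seminorm_onD(4)[OF assms, of 0 0] by auto
  then have "(\<lambda>x. \<bar>0\<bar> :: real) ` {x \<in> S. N x \<le> 1} = {0}" by (auto intro!: image_eqI[of _ _ 0])
  then show ?thesis unfolding dual_norm_def by simp
qed

lemma dual_norm_le: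
  assumes "seminorm_on S N" "\<And>x. x \<in> S \<Longrightarrow> \<bar>f x\<bar> \<le> K * N x" "0 \<le> K"
  shows "dual_norm S N f \<le> K"
proof -
  have "0 \<in> S" "N 0 = 0"
    using subspace_0[OF seminorm_onD(1)[OF assms(1)]] seminorm_onD(4)[OF assms(1), of 0 0] by auto
  then have "0 \<in> {x \<in> S. N x \<le> 1}" by simp
  then have "{x \<in> S. N x \<le> 1} \<noteq> {}" by blast
  then show ?thesis unfolding dual_norm_def
  proof (rule cSUP_least)
    fix x assume x: "x \<in> {x \<in> S. N x \<le> 1}"
    then have "K * N x \<le> K * 1" using assms(3) by (intro mult_left_mono) auto
    then show "\<bar>f x\<bar> \<le> K" using assms(2)[of x] x by auto
  qed
qed

text \<open>Vectors of positive seminorm are normalised; those of seminorm zero cannot be, but there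
  any bound \<open>K\<close> already forces \<open>f x = 0\<close>. Membership in the dual space
  makes the supremum one of a bounded set, without which \<open>SUP\<close> would carry no
  information.\<close>

lemma dual_norm_bound:
  assumes N: "seminorm_on S N" and f: "f \<in> dual_space S N"
  shows "x \<in> S \<Longrightarrow> \<bar>f x\<bar> \<le> dual_norm S N f * N x" "0 \<le> dual_norm S N f"
proof -
  obtain K where K: "\<And>x. x \<in> S \<Longrightarrow> \<bar>f x\<bar> \<le> K * N x"
    using f unfolding dual_space_def by blast
  have bdd: "bdd_above ((\<lambda>x. \<bar>f x\<bar>) ` {x \<in> S. N x \<le> 1})"
  proof (rule bdd_aboveI2)
    fix x assume x: "x \<in> {x \<in> S. N x \<le> 1}"
    have "K * N x \<le> \<bar>K\<bar> * N x" using seminorm_onD(2)[OF N, of x] x by (intro mult_right_mono) auto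
    also have "\<dots> \<le> \<bar>K\<bar> * 1" using x by (intro mult_left_mono) auto
    finally show "\<bar>f x\<bar> \<le> \<bar>K\<bar>" using K[of x] x by auto
  qed
  have up: "\<bar>f x\<bar> \<le> dual_norm S N f" if "x \<in> S" "N x \<le> 1" for x
    unfolding dual_norm_def using that by (intro cSUP_upper[OF _ bdd]) auto
  have "0 \<in> S" "N 0 = 0"
    using subspace_0[OF seminorm_onD(1)[OF N]] seminorm_onD(4)[OF N, of 0 0] by auto
  with up[of 0] show "0 \<le> dual_norm S N f" by auto
  assume x: "x \<in> S"
  show "\<bar>f x\<bar> \<le> dual_norm S N f * N x"
  proof (cases "N x = 0")
    case True then show ?thesis using K[OF x] by simp
  next
    case False
    then have p: "0 < N x" using seminorm_onD(2)[OF N x] by simp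
    have y: "(1 / N x) *\<^sub>R x \<in> S" by (rule subspace_scale[OF seminorm_onD(1)[OF N] x])
    have "N ((1 / N x) *\<^sub>R x) \<le> 1" using seminorm_onD(4)[OF N x] p by simp
    from up[OF y this] have "\<bar>f x\<bar> / N x \<le> dual_norm S N f"
      using f x p by (simp add: dual_space_def abs_mult)
    then show ?thesis using p by (simp add: field_simps)
  qed
qed

lemma dual_space_linear:
  assumes "f \<in> dual_space S N"
  shows "linear_form_on S f" "x \<notin> S \<Longrightarrow> f x = 0"
  using assms by (auto simp: dual_space_def linear_form_on_def)

section \<open>The space \<open>L2_space\<close>\<close>

lemma quadratic_nonneg_discriminant:
  fixes p q r :: real
  assumes r: "0 \<le> r" and nonneg: "\<And>t. 0 \<le> p + 2 * t * q + t\<^sup>2 * r"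
  shows "q\<^sup>2 \<le> p * r"
proof (cases "r = 0")
  case True
  have "0 \<le> t\<^sup>2 * p + 2 * t * q" for t
  proof (cases "t = 0")
    case False
    \<comment> \<open>Multiplying the inequality at 1 / t by the square of t turns the constant term
      into the quadratic one, so \<open>linear_coefficient_zero\<close> applies.\<close>
    from mult_nonneg_nonneg[OF zero_le_power2 nonneg[of "1 / t"], of t] show ?thesis
      using True False by (simp add: power2_eq_square algebra_simps)
  qed simp
  from linear_coefficient_zero[OF this] show ?thesis using True by simp
next
  case False
  then have "0 < r" using r by simp
  with nonneg[of "- q / r"] show ?thesis by (simp add: field_simps power2_eq_square)
qed

lemma finite_time_measure: "finite_measure (time_measure T)"
  by (rule finite_measure_lebesgue_on) simp

lemma integral_Cauchy_Schwarz:
  fixes f g :: "'a \<Rightarrow> real"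
  assumes [measurable]: "f \<in> borel_measurable M" "g \<in> borel_measurable M"
    and f: "integrable M (\<lambda>x. (f x)\<^sup>2)" and g: "integrable M (\<lambda>x. (g x)\<^sup>2)"
  shows "integrable M (\<lambda>x. f x * g x)"
    and "\<bar>\<integral>x. f x * g x \<partial>M\<bar> \<le> sqrt (\<integral>x. (f x)\<^sup>2 \<partial>M) * sqrt (\<integral>x. (g x)\<^sup>2 \<partial>M)"
proof -
  show i: "integrable M (\<lambda>x. f x * g x)"
  proof (rule Bochner_Integration.integrable_bound[OF Bochner_Integration.integrable_add[OF f g]])
    show "AE x in M. norm (f x * g x) \<le> norm ((f x)\<^sup>2 + (g x)\<^sup>2)"
    proof (rule AE_I2)
      fix x
      have "2 * (\<bar>f x\<bar> * \<bar>g x\<bar>) \<le> (f x)\<^sup>2 + (g x)\<^sup>2"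
        using sum_squares_bound[of "\<bar>f x\<bar>" "\<bar>g x\<bar>"] by simp
      moreover have "0 \<le> \<bar>f x\<bar> * \<bar>g x\<bar>" by simp
      ultimately show "norm (f x * g x) \<le> norm ((f x)\<^sup>2 + (g x)\<^sup>2)"
        by (simp only: real_norm_def abs_mult)
    qed
  qed simp
  have "0 \<le> (\<integral>x. (f x)\<^sup>2 \<partial>M) + 2 * t * (\<integral>x. f x * g x \<partial>M) + t\<^sup>2 * (\<integral>x. (g x)\<^sup>2 \<partial>M)" for t
  proof -
    have "0 \<le> (\<integral>x. (f x + t * g x)\<^sup>2 \<partial>M)" by simp
    also have "\<dots> = (\<integral>x. (f x)\<^sup>2 + 2 * t * (f x * g x) + t\<^sup>2 * (g x)\<^sup>2 \<partial>M)"
      by (intro Bochner_Integration.integral_cong) (auto simp: power2_eq_square algebra_simps)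
    also have "\<dots> = (\<integral>x. (f x)\<^sup>2 \<partial>M) + 2 * t * (\<integral>x. f x * g x \<partial>M) + t\<^sup>2 * (\<integral>x. (g x)\<^sup>2 \<partial>M)"
      using f g i by simp
    finally show ?thesis .
  qed
  then have "(\<integral>x. f x * g x \<partial>M)\<^sup>2 \<le> (\<integral>x. (f x)\<^sup>2 \<partial>M) * (\<integral>x. (g x)\<^sup>2 \<partial>M)"
    by (intro quadratic_nonneg_discriminant) simp_all
  then have "sqrt ((\<integral>x. f x * g x \<partial>M)\<^sup>2) \<le> sqrt ((\<integral>x. (f x)\<^sup>2 \<partial>M) * (\<integral>x. (g x)\<^sup>2 \<partial>M))"
    by (rule real_sqrt_le_mono)
  then show "\<bar>\<integral>x. f x * g x \<partial>M\<bar> \<le> sqrt (\<integral>x. (f x)\<^sup>2 \<partial>M) * sqrt (\<integral>x. (g x)\<^sup>2 \<partial>M)"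
    by (simp add: real_sqrt_mult)
qed

lemma L2_spaceD:
  assumes "v \<in> L2_space T"
  shows "v \<in> borel_measurable (time_measure T)" "integrable (time_measure T) (\<lambda>t. (norm (v t))\<^sup>2)"
  using assms by (auto simp: L2_space_def)

lemma L2_norm_nonneg [simp]: "0 \<le> L2_norm T v"
  by (simp add: L2_norm_def)

lemma L2_norm_square: "(L2_norm T v)\<^sup>2 = (\<integral>t. (norm (v t))\<^sup>2 \<partial>time_measure T)"
  by (simp add: L2_norm_def)

lemma L2_norm_mult:
  assumes "u \<in> L2_space T" "v \<in> L2_space T"
  shows "integrable (time_measure T) (\<lambda>t. norm (u t) * norm (v t))"
    and "(\<integral>t. norm (u t) * norm (v t) \<partial>time_measure T) \<le> L2_norm T u * L2_norm T v"
proof -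
  have [measurable]: "u \<in> borel_measurable (time_measure T)" "v \<in> borel_measurable (time_measure T)"
    using assms L2_spaceD by auto
  note * = integral_Cauchy_Schwarz[of "\<lambda>t. norm (u t)" "time_measure T" "\<lambda>t. norm (v t)",
      OF _ _ L2_spaceD(2)[OF assms(1)] L2_spaceD(2)[OF assms(2)]]
  show "integrable (time_measure T) (\<lambda>t. norm (u t) * norm (v t))" by (rule *) auto
  show "(\<integral>t. norm (u t) * norm (v t) \<partial>time_measure T) \<le> L2_norm T u * L2_norm T v"
    using *(2) unfolding L2_norm_def by auto
qed

text \<open>One estimate for the inner product and for the time-dependent form: \<open>f\<close>
  enters only through a pointwise bound. The sign of \<open>K\<close> is left open, hence the
  absolute value.\<close>

lemma L2_bounded_form:
  fixes u :: "real \<Rightarrow> 'b::real_normed_vector" and v :: "real \<Rightarrow> 'c::real_normed_vector"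
  assumes u: "u \<in> L2_space T" and v: "v \<in> L2_space T"
    and f: "f \<in> borel_measurable (time_measure T)"
    and bound: "AE t in time_measure T. \<bar>f t\<bar> \<le> K * norm (u t) * norm (v t)"
  shows "integrable (time_measure T) f"
    and "\<bar>\<integral>t. f t \<partial>time_measure T\<bar> \<le> \<bar>K\<bar> * L2_norm T u * L2_norm T v"
proof -
  have i: "integrable (time_measure T) (\<lambda>t. \<bar>K\<bar> * (norm (u t) * norm (v t)))"
    using L2_norm_mult(1)[OF u v] by simp
  have b: "AE t in time_measure T. norm (f t) \<le> \<bar>K\<bar> * (norm (u t) * norm (v t))"
    using bound
  proof eventually_elim
    case (elim t)
    have "K * (norm (u t) * norm (v t)) \<le> \<bar>K\<bar> * (norm (u t) * norm (v t))"
      by (intro mult_right_mono) auto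
    then show ?case using elim by (simp add: mult.assoc)
  qed
  show f': "integrable (time_measure T) f"
    by (rule Bochner_Integration.integrable_bound[OF i f]) (use b in \<open>auto simp: abs_mult\<close>)
  have "\<bar>\<integral>t. f t \<partial>time_measure T\<bar> \<le> (\<integral>t. norm (f t) \<partial>time_measure T)"
    using integral_norm_bound[of "time_measure T" f] by simp
  also have "\<dots> \<le> (\<integral>t. \<bar>K\<bar> * (norm (u t) * norm (v t)) \<partial>time_measure T)"
    by (intro integral_mono_AE i b) (use f' in auto)
  also have "\<dots> = \<bar>K\<bar> * (\<integral>t. norm (u t) * norm (v t) \<partial>time_measure T)" by simp
  also have "\<dots> \<le> \<bar>K\<bar> * (L2_norm T u * L2_norm T v)"
    by (intro mult_left_mono L2_norm_mult u v) auto
  finally show "\<bar>\<integral>t. f t \<partial>time_measure T\<bar> \<le> \<bar>K\<bar> * L2_norm T u * L2_norm T v"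
    by (simp add: mult.assoc)
qed

lemma L2_inner:
  fixes u v :: "real \<Rightarrow> 'b::{real_inner,second_countable_topology}"
  assumes u: "u \<in> L2_space T" and v: "v \<in> L2_space T"
  shows "integrable (time_measure T) (\<lambda>t. u t \<bullet> v t)"
    and "\<bar>\<integral>t. u t \<bullet> v t \<partial>time_measure T\<bar> \<le> L2_norm T u * L2_norm T v"
proof -
  have [measurable]: "u \<in> borel_measurable (time_measure T)" "v \<in> borel_measurable (time_measure T)"
    using assms L2_spaceD by auto
  have "AE t in time_measure T. \<bar>u t \<bullet> v t\<bar> \<le> 1 * norm (u t) * norm (v t)"
    using Cauchy_Schwarz_ineq2 by auto
  from L2_bounded_form[OF u v _ this]
  show "integrable (time_measure T) (\<lambda>t. u t \<bullet> v t)"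
    "\<bar>\<integral>t. u t \<bullet> v t \<partial>time_measure T\<bar> \<le> L2_norm T u * L2_norm T v" by auto
qed

lemma L2_norm_eq_inner: "(L2_norm T u)\<^sup>2 = (\<integral>t. u t \<bullet> u t \<partial>time_measure T)"
  for u :: "real \<Rightarrow> 'b::real_inner"
  by (simp add: L2_norm_square power2_norm_eq_inner)

lemma L2_space_scale: "u \<in> L2_space T \<Longrightarrow> c *\<^sub>R u \<in> L2_space T"
  for u :: "real \<Rightarrow> 'b::{real_normed_vector,second_countable_topology}"
  by (auto simp: L2_space_def scaleR_fun_def power_mult_distrib)

lemma L2_space_add:
  fixes u v :: "real \<Rightarrow> 'b::{real_inner,second_countable_topology}"
  assumes u: "u \<in> L2_space T" and v: "v \<in> L2_space T"
  shows "u + v \<in> L2_space T"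
proof -
  have [measurable]: "u \<in> borel_measurable (time_measure T)" "v \<in> borel_measurable (time_measure T)"
    using assms L2_spaceD by auto
  have "integrable (time_measure T) (\<lambda>t. (norm (u t))\<^sup>2 + 2 * (u t \<bullet> v t) + (norm (v t))\<^sup>2)"
    using L2_inner(1)[OF u v] L2_spaceD(2)[OF u] L2_spaceD(2)[OF v] by auto
  moreover have "(norm (u t + v t))\<^sup>2 = (norm (u t))\<^sup>2 + 2 * (u t \<bullet> v t) + (norm (v t))\<^sup>2" for t
    by (simp add: power2_norm_eq_inner inner_simps inner_commute)
  ultimately show ?thesis by (simp add: L2_space_def plus_fun_def)
qed

lemma L2_space_zero: "0 \<in> L2_space T"
  by (auto simp: L2_space_def zero_fun_def)

lemma subspace_L2_space:
  "subspace (L2_space T :: (real \<Rightarrow> 'b::{real_inner,second_countable_topology}) set)"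
  by (rule subspaceI) (auto simp: L2_space_zero intro: L2_space_scale L2_space_add)

lemma L2_norm_scale: "L2_norm T (c *\<^sub>R u) = \<bar>c\<bar> * L2_norm T u"
  by (simp add: L2_norm_def scaleR_fun_def power_mult_distrib real_sqrt_mult)

lemma L2_norm_triangle:
  fixes u v :: "real \<Rightarrow> 'b::{real_inner,second_countable_topology}"
  assumes u: "u \<in> L2_space T" and v: "v \<in> L2_space T"
  shows "L2_norm T (u + v) \<le> L2_norm T u + L2_norm T v"
proof (rule power2_le_imp_le)
  have "(L2_norm T (u + v))\<^sup>2 =
      (\<integral>t. (norm (u t))\<^sup>2 + 2 * (u t \<bullet> v t) + (norm (v t))\<^sup>2 \<partial>time_measure T)"
    unfolding L2_norm_square
    by (intro Bochner_Integration.integral_cong)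
       (auto simp: power2_norm_eq_inner inner_simps inner_commute)
  also have "\<dots> = (L2_norm T u)\<^sup>2 + 2 * (\<integral>t. u t \<bullet> v t \<partial>time_measure T) + (L2_norm T v)\<^sup>2"
    using L2_inner(1)[OF u v] L2_spaceD(2)[OF u] L2_spaceD(2)[OF v] by (simp add: L2_norm_square)
  also have "\<dots> \<le> (L2_norm T u + L2_norm T v)\<^sup>2"
    using L2_inner(2)[OF u v] by (simp add: power2_sum abs_le_iff)
  finally show "(L2_norm T (u + v))\<^sup>2 \<le> (L2_norm T u + L2_norm T v)\<^sup>2" .
qed simp

lemma seminorm_L2:
  "seminorm_on (L2_space T :: (real \<Rightarrow> 'b::{real_inner,second_countable_topology}) set) (L2_norm T)"
  by (auto simp: seminorm_on_def subspace_L2_space L2_norm_triangle L2_norm_scale)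

lemma L2_norm_zero_iff:
  assumes "u \<in> L2_space T"
  shows "L2_norm T u = 0 \<longleftrightarrow> (AE t in time_measure T. u t = 0)"
  using integral_nonneg_eq_0_iff_AE[OF L2_spaceD(2)[OF assms]]
  by (simp add: L2_norm_def)

lemma L2_norm_AE_eq:
  assumes "AE t in time_measure T. norm (u t) = norm (v t)"
    "u \<in> borel_measurable (time_measure T)" "v \<in> borel_measurable (time_measure T)"
  shows "L2_norm T u = L2_norm T v"
proof -
  have "(\<integral>t. (norm (u t))\<^sup>2 \<partial>time_measure T) = (\<integral>t. (norm (v t))\<^sup>2 \<partial>time_measure T)"
    by (intro integral_cong_AE) (use assms in \<open>auto\<close>)
  then show ?thesis by (simp add: L2_norm_def)
qed

text \<open>Cauchy-Schwarz against the constant 1, whose norm on the interval is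
  \<open>sqrt T\<close>.\<close>

lemma L2_integrable:
  fixes u :: "real \<Rightarrow> 'b::{real_normed_vector,banach,second_countable_topology}"
  assumes u: "u \<in> L2_space T" and T: "0 < T"
  shows "integrable (time_measure T) u"
    and "(\<integral>t. norm (u t) \<partial>time_measure T) \<le> sqrt T * L2_norm T u"
proof -
  interpret finite_measure "time_measure T" by (rule finite_time_measure)
  have [measurable]: "u \<in> borel_measurable (time_measure T)"
    using assms L2_spaceD by auto
  have one: "(\<lambda>_. 1::real) \<in> L2_space T" by (simp add: L2_space_def)
  have n1: "L2_norm T (\<lambda>_. 1::real) = sqrt T"
    using T by (simp add: L2_norm_def measure_restrict_space)
  show "integrable (time_measure T) u"
    by (rule integrable_norm_cancel) (use L2_norm_mult(1)[OF one u] in auto)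
  show "(\<integral>t. norm (u t) \<partial>time_measure T) \<le> sqrt T * L2_norm T u"
    using L2_norm_mult(2)[OF one u] n1 by simp
qed

section \<open>Completeness of the Lebesgue space\<close>

lemma cauchy_fast_subsequence:
  fixes d :: "nat \<Rightarrow> nat \<Rightarrow> real"
  assumes "\<And>e. 0 < e \<Longrightarrow> \<exists>M. \<forall>m\<ge>M. \<forall>n\<ge>M. d m n < e"
  obtains r where "strict_mono r" "\<And>k m n. m \<ge> r k \<Longrightarrow> n \<ge> r k \<Longrightarrow> d m n < (1/2)^k"
proof -
  have "\<exists>M. \<forall>m\<ge>M. \<forall>n\<ge>M. d m n < (1/2)^k" for k using assms[of "(1/2)^k"] by simp
  then obtain R where R: "\<And>k m n. m \<ge> R k \<Longrightarrow> n \<ge> R k \<Longrightarrow> d m n < (1/2)^k" by metis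
  \<comment> \<open>The partial sums dominate \<open>R\<close>, and the added \<open>k\<close> makes
    the sequence strictly increasing.\<close>
  define r where "r k = (\<Sum>i\<le>k. R i) + k" for k
  have ge: "R k \<le> r k" for k
    unfolding r_def using member_le_sum[of k "{..k}" R] by auto
  have "strict_mono r" by (rule strict_mono_Suc_iff[THEN iffD2]) (auto simp: r_def)
  moreover have "d m n < (1/2)^k" if "m \<ge> r k" "n \<ge> r k" for k m n
    using that R ge[of k] by (meson order_trans)
  ultimately show ?thesis using that by blast
qed

text \<open>The Riesz-Fischer argument: along a fast subsequence the increments have summable
  integrals, so they are summable at almost every time and the subsequence converges there; Fatou's
  lemma then carries the Cauchy estimate over to the limit.\<close>

theorem complete_L2:
  assumes T: "0 < T"
  shows "complete_on
    (L2_space T :: (real \<Rightarrow> 'b::{real_inner,banach,second_countable_topology}) set) (L2_norm T)"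
  unfolding complete_on_def
proof (intro allI impI, elim conjE)
  fix s :: "nat \<Rightarrow> real \<Rightarrow> 'b"
  assume s: "\<forall>n. s n \<in> L2_space T"
    and C: "\<forall>e>0. \<exists>M. \<forall>m\<ge>M. \<forall>n\<ge>M. L2_norm T (s m - s n) < e"
  let ?M = "time_measure T"
  have [measurable]: "\<And>n. s n \<in> borel_measurable ?M" using s L2_spaceD by auto
  have sd: "s m - s n \<in> L2_space T" for m n by (rule subspace_diff[OF subspace_L2_space]) (use s in auto)
  from cauchy_fast_subsequence[of "\<lambda>m n. L2_norm T (s m - s n)"] C
  obtain r where r: "strict_mono r"
    "\<And>k m n. m \<ge> r k \<Longrightarrow> n \<ge> r k \<Longrightarrow> L2_norm T (s m - s n) < (1/2)^k" by blast
  define g where "g k t = norm (s (r (Suc k)) t - s (r k) t)" for k t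
  have g: "integrable ?M (g k)" "(\<integral>t. g k t \<partial>?M) \<le> sqrt T * (1/2)^k" for k
  proof -
    note * = L2_integrable[OF sd T, of "r (Suc k)" "r k"]
    show "integrable ?M (g k)" unfolding g_def
      using integrable_norm[OF *(1)] by simp
    have "r k \<le> r (Suc k)" using r(1) by (simp add: strict_mono_less_eq)
    then have "L2_norm T (s (r (Suc k)) - s (r k)) \<le> (1/2)^k"
      using r(2)[where k=k] by (simp add: less_imp_le)
    then have "sqrt T * L2_norm T (s (r (Suc k)) - s (r k)) \<le> sqrt T * (1/2)^k"
      using T by (intro mult_left_mono) auto
    then show "(\<integral>t. g k t \<partial>?M) \<le> sqrt T * (1/2)^k" using *(2) unfolding g_def by simp
  qed
  have [measurable]: "\<And>k. g k \<in> borel_measurable ?M" unfolding g_def by simp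
  have "(\<integral>\<^sup>+ t. (\<Sum>k. ennreal (g k t)) \<partial>?M) = (\<Sum>k. \<integral>\<^sup>+ t. ennreal (g k t) \<partial>?M)"
    by (rule nn_integral_suminf) simp
  also have "\<dots> = (\<Sum>k. ennreal (\<integral>t. g k t \<partial>?M))"
    by (intro suminf_cong nn_integral_eq_integral g(1)) (simp add: g_def)
  also have "\<dots> \<le> (\<Sum>k. ennreal (sqrt T * (1/2)^k))"
    by (intro suminf_le ennreal_leI g(2)) auto
  also have "\<dots> = ennreal (\<Sum>k. sqrt T * (1/2)^k)"
    using T by (intro suminf_ennreal2 summable_mult summable_geometric) auto
  finally have "(\<integral>\<^sup>+ t. (\<Sum>k. ennreal (g k t)) \<partial>?M) \<noteq> \<infinity>" by (auto simp: top_unique)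
  then have "AE t in ?M. (\<Sum>k. ennreal (g k t)) \<noteq> \<infinity>"
    by (intro nn_integral_PInf_AE) auto
  then have conv: "AE t in ?M. convergent (\<lambda>k. s (r k) t)"
  proof eventually_elim
    case (elim t)
    then have "summable (\<lambda>k. g k t)" by (intro summable_suminf_not_top) (auto simp: g_def)
    then have "summable (\<lambda>k. s (r (Suc k)) t - s (r k) t)"
      unfolding g_def by (rule summable_norm_cancel)
    then obtain l where "(\<lambda>k. s (r (Suc k)) t - s (r k) t) sums l" by (auto simp: summable_def)
    then have "(\<lambda>n. \<Sum>k<n. s (r (Suc k)) t - s (r k) t) \<longlonglongrightarrow> l" by (simp add: sums_def)
    then have "(\<lambda>n. s (r n) t - s (r 0) t) \<longlonglongrightarrow> l"
      by (simp add: sum_lessThan_telescope[of "\<lambda>k. s (r k) t"])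
    then have "(\<lambda>n. (s (r n) t - s (r 0) t) + s (r 0) t) \<longlonglongrightarrow> l + s (r 0) t"
      by (intro tendsto_intros)
    then show ?case by (auto simp: convergent_def)
  qed
  define x where "x t = lim (\<lambda>k. s (r k) t)" for t
  have [measurable]: "x \<in> borel_measurable ?M" unfolding x_def by measurable
  have lim: "AE t in ?M. (\<lambda>k. s (r k) t) \<longlonglongrightarrow> x t"
    using conv by eventually_elim (simp add: x_def convergent_LIMSEQ_iff)
  \<comment> \<open>Fatou's lemma with \<open>s n\<close> fixed, while the other index runs along
    the subsequence.\<close>
  have est: "(\<integral>\<^sup>+ t. ennreal ((norm (s n t - x t))\<^sup>2) \<partial>?M) \<le> ennreal (((1/2)^k)\<^sup>2)"
    if n: "n \<ge> r k" for n k
  proof -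
    have "(\<integral>\<^sup>+ t. ennreal ((norm (s n t - x t))\<^sup>2) \<partial>?M)
        = (\<integral>\<^sup>+ t. liminf (\<lambda>i. ennreal ((norm (s n t - s (r i) t))\<^sup>2)) \<partial>?M)"
    proof (rule nn_integral_cong_AE, use lim in eventually_elim)
      case (elim t)
      have "(\<lambda>i. ennreal ((norm (s n t - s (r i) t))\<^sup>2)) \<longlonglongrightarrow> ennreal ((norm (s n t - x t))\<^sup>2)"
        by (intro tendsto_ennrealI tendsto_intros elim)
      then show ?case using lim_imp_Liminf trivial_limit_sequentially by metis
    qed
    also have "\<dots> \<le> liminf (\<lambda>i. \<integral>\<^sup>+ t. ennreal ((norm (s n t - s (r i) t))\<^sup>2) \<partial>?M)"
      by (rule nn_integral_liminf) simp
    also have "\<dots> \<le> limsup (\<lambda>i. \<integral>\<^sup>+ t. ennreal ((norm (s n t - s (r i) t))\<^sup>2) \<partial>?M)"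
      by (rule Liminf_le_Limsup) simp
    also have "\<dots> \<le> ennreal (((1/2)^k)\<^sup>2)"
    proof (rule Limsup_bounded)
      show "\<forall>\<^sub>F i in sequentially.
          (\<integral>\<^sup>+ t. ennreal ((norm (s n t - s (r i) t))\<^sup>2) \<partial>?M) \<le> ennreal (((1/2)^k)\<^sup>2)"
      proof (rule eventually_sequentiallyI[of k])
        fix i assume "i \<ge> k"
        then have i: "r i \<ge> r k" using r(1) by (simp add: strict_mono_less_eq)
        have "(\<integral>\<^sup>+ t. ennreal ((norm (s n t - s (r i) t))\<^sup>2) \<partial>?M)
            = ennreal ((L2_norm T (s n - s (r i)))\<^sup>2)"
          unfolding L2_norm_square using L2_spaceD(2)[OF sd, of n "r i"]
          by (subst nn_integral_eq_integral) auto
        also have "\<dots> \<le> ennreal (((1/2)^k)\<^sup>2)"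
          using r(2)[OF n i] by (intro ennreal_leI power_mono) auto
        finally show "(\<integral>\<^sup>+ t. ennreal ((norm (s n t - s (r i) t))\<^sup>2) \<partial>?M) \<le> ennreal (((1/2)^k)\<^sup>2)" .
      qed
    qed
    finally show ?thesis .
  qed
  have int: "integrable ?M (\<lambda>t. (norm (s n t - x t))\<^sup>2)"
    and bd: "(\<integral>t. (norm (s n t - x t))\<^sup>2 \<partial>?M) \<le> ((1/2)^k)\<^sup>2" if "n \<ge> r k" for n k
  proof -
    show i: "integrable ?M (\<lambda>t. (norm (s n t - x t))\<^sup>2)"
      using est[OF that] by (intro integrableI_bounded) (auto simp: less_top[symmetric] top_unique)
    show "(\<integral>t. (norm (s n t - x t))\<^sup>2 \<partial>?M) \<le> ((1/2)^k)\<^sup>2"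
      using est[OF that] by (subst (asm) nn_integral_eq_integral[OF i]) auto
  qed
  have "s (r 0) - x \<in> L2_space T" using int[of 0 "r 0"] by (auto simp: L2_space_def fun_diff_def)
  then have "s (r 0) - (s (r 0) - x) \<in> L2_space T"
    using s by (blast intro: subspace_diff[OF subspace_L2_space])
  moreover have "s (r 0) - (s (r 0) - x) = x" by (simp add: algebra_simps)
  ultimately have x: "x \<in> L2_space T" by simp
  have "(\<lambda>n. L2_norm T (s n - x)) \<longlonglongrightarrow> 0"
  proof (rule LIMSEQ_I)
    fix e :: real assume "0 < e"
    then obtain k where k: "(1/2)^k < e" using real_arch_pow_inv[of e "1/2"] by auto
    have "norm (L2_norm T (s n - x) - 0) < e" if "n \<ge> r k" for n
    proof -
      have "(L2_norm T (s n - x))\<^sup>2 \<le> ((1/2)^k)\<^sup>2" using bd[OF that] by (simp add: L2_norm_square)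
      then have "L2_norm T (s n - x) \<le> (1/2)^k" by (rule power2_le_imp_le) simp
      then show ?thesis using k by simp
    qed
    then show "\<exists>no. \<forall>n\<ge>no. norm (L2_norm T (s n - x) - 0) < e" by blast
  qed
  with x show "\<exists>x\<in>L2_space T. (\<lambda>n. L2_norm T (s n - x)) \<longlonglongrightarrow> 0" by blast
qed

section \<open>Smooth functions and the lemma of du Bois-Reymond\<close>

text \<open>The differentiability clause of \<open>test_function\<close>, split off because it is
  also shown for functions without compact support.\<close>

definition smooth :: "(real \<Rightarrow> real) \<Rightarrow> bool"
  where "smooth f \<longleftrightarrow> (\<forall>n t. (deriv ^^ n) f differentiable (at t))"

text \<open>Smoothness is established for a whole class at once, because the derivative of a given
  function usually leaves its shape but not a suitable class.\<close>

lemma smooth_coinduct: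
  assumes "f \<in> A" "\<And>f t. f \<in> A \<Longrightarrow> f differentiable (at t)" "\<And>f. f \<in> A \<Longrightarrow> deriv f \<in> A"
  shows "smooth f"
proof -
  have "(deriv ^^ n) f \<in> A" for n by (induction n) (use assms in auto)
  then show ?thesis using assms(2) by (auto simp: smooth_def)
qed

lemma smooth_deriv: "smooth f \<Longrightarrow> smooth (deriv f)"
  unfolding smooth_def by (metis funpow_swap1 funpow.simps(2) o_apply)

lemma smooth_has_derivative: "smooth f \<Longrightarrow> (f has_real_derivative deriv f t) (at t)"
  unfolding smooth_def
  by (metis DERIV_deriv_iff_real_differentiable funpow_0)

lemma smooth_antiderivative:
  assumes "smooth f" "\<And>t. (F has_real_derivative f t) (at t)"
  shows "smooth F" "deriv F = f"
proof -
  show d: "deriv F = f" using assms(2) DERIV_imp_deriv by blast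
  have "(deriv ^^ n) F differentiable (at t)" for n t
  proof (cases n)
    case 0 then show ?thesis using assms(2) real_differentiable_def by auto
  next
    case (Suc k)
    then have "(deriv ^^ n) F = (deriv ^^ k) f" by (simp add: funpow_swap1 d)
    then show ?thesis using assms(1) by (simp add: smooth_def)
  qed
  then show "smooth F" by (simp add: smooth_def)
qed

text \<open>Sums are included because Leibniz' rule turns one product into a sum of two; the class
  is then closed under differentiation, as \<open>smooth_coinduct\<close> requires.\<close>

inductive_set smooth_products :: "(real \<Rightarrow> real) set" where
  prod: "smooth g \<Longrightarrow> smooth h \<Longrightarrow> (\<lambda>t. g t * h t) \<in> smooth_products"
| add: "f \<in> smooth_products \<Longrightarrow> g \<in> smooth_products \<Longrightarrow> (\<lambda>t. f t + g t) \<in> smooth_products"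

lemma smooth_products_deriv:
  assumes "f \<in> smooth_products"
  shows "\<exists>f'\<in>smooth_products. \<forall>t. (f has_real_derivative f' t) (at t)"
  using assms
proof induction
  case (prod g h)
  have "(\<lambda>t. deriv g t * h t + g t * deriv h t) \<in> smooth_products"
    by (intro smooth_products.intros prod smooth_deriv)
  moreover have "((\<lambda>t. g t * h t) has_real_derivative deriv g t * h t + g t * deriv h t) (at t)" for t
    by (rule derivative_eq_intros smooth_has_derivative prod refl | simp)+
  ultimately show ?case by (intro bexI[where x="\<lambda>t. deriv g t * h t + g t * deriv h t"]) auto
next
  case (add f g)
  then obtain f' g' where *: "f' \<in> smooth_products" "\<forall>t. (f has_real_derivative f' t) (at t)"
    "g' \<in> smooth_products" "\<forall>t. (g has_real_derivative g' t) (at t)" by blast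
  then show ?case
    by (intro bexI[where x="\<lambda>t. f' t + g' t"])
       (auto intro!: smooth_products.add derivative_eq_intros)
qed

lemma smooth_products_smooth: "f \<in> smooth_products \<Longrightarrow> smooth f"
proof (rule smooth_coinduct[where A = smooth_products])
  fix f t assume "f \<in> smooth_products"
  then obtain f' where *: "f' \<in> smooth_products" "\<forall>t. (f has_real_derivative f' t) (at t)"
    using smooth_products_deriv by blast
  then show "f differentiable (at t)" using real_differentiable_def by auto
  have "deriv f = f'" using * DERIV_imp_deriv by blast
  then show "deriv f \<in> smooth_products" using * by simp
qed

lemma smooth_mult: "smooth f \<Longrightarrow> smooth g \<Longrightarrow> smooth (\<lambda>t. f t * g t)"
  by (rule smooth_products_smooth[OF smooth_products.prod])

lemma smooth_const: "smooth (\<lambda>t. c)"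
  by (rule smooth_coinduct[where A = "range (\<lambda>c t. c)"])
     (auto simp: image_iff)

lemma smooth_add:
  assumes "smooth f" "smooth g"
  shows "smooth (\<lambda>t. f t + g t)"
proof (rule smooth_products_smooth)
  have "(\<lambda>t. f t * 1 + g t * 1) \<in> smooth_products"
    by (intro smooth_products.intros assms smooth_const)
  then show "(\<lambda>t. f t + g t) \<in> smooth_products" by simp
qed

section \<open>Test functions\<close>

text \<open>The polynomial in 1 / x absorbs every factor that differentiation produces, so the
  family is closed under the derivative. The case p = 1 is the usual smooth function that is flat at
  0.\<close>

definition flat_exp :: "real poly \<Rightarrow> real \<Rightarrow> real"
  where "flat_exp p x = (if 0 < x then poly p (1 / x) * exp (- (1 / x)) else 0)"

lemma poly_mult_exp_tendsto_0:
  fixes p :: "real poly"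
  shows "((\<lambda>y. poly p y * exp (- y)) \<longlongrightarrow> 0) at_top"
proof -
  have "((\<lambda>y. \<Sum>i\<le>degree p. coeff p i * (y ^ i / exp y)) \<longlongrightarrow> (\<Sum>i\<le>degree p. coeff p i * 0)) at_top"
    by (intro tendsto_intros tendsto_power_div_exp_0)
  moreover have "(\<lambda>y. \<Sum>i\<le>degree p. coeff p i * (y ^ i / exp y)) = (\<lambda>y. poly p y * exp (- y))"
    by (simp add: poly_altdef sum_distrib_right exp_minus divide_inverse mult.assoc)
  ultimately show ?thesis by simp
qed

text \<open>With y = 1 / x the derivative in x is minus y squared times the derivative in y, which
  explains the factor \<open>[:0, 0, 1:]\<close> and the term \<open>p - pderiv p\<close>. At 0 the
  difference quotient from the right is y p(y) exp (-y), which tends to 0 as y grows.\<close>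

lemma flat_exp_derivative:
  "(flat_exp p has_real_derivative flat_exp ([:0, 0, 1:] * (p - pderiv p)) x) (at x)"
proof -
  consider "x > 0" | "x < 0" | "x = 0" by linarith
  then show ?thesis
  proof cases
    case 1
    have "((\<lambda>x. poly p (1 / x) * exp (- (1 / x))) has_real_derivative
        flat_exp ([:0, 0, 1:] * (p - pderiv p)) x) (at x)"
    proof -
      have "((\<lambda>x. 1 / x) has_real_derivative - (1 / x\<^sup>2)) (at x)"
        using 1 by (auto intro!: derivative_eq_intros simp: power2_eq_square)
      note d = this DERIV_chain2[OF poly_DERIV this]
      show ?thesis
        by (rule derivative_eq_intros d refl | use 1 in \<open>simp add: flat_exp_def field_simps power2_eq_square\<close>)+
    qed
    then show ?thesis
      by (rule has_field_derivative_transform_within_open[where S="{0<..}"])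
         (use 1 in \<open>auto simp: flat_exp_def\<close>)
  next
    case 2
    have "((\<lambda>x. 0) has_real_derivative flat_exp ([:0, 0, 1:] * (p - pderiv p)) x) (at x)"
      using 2 by (simp add: flat_exp_def)
    then show ?thesis
      by (rule has_field_derivative_transform_within_open[where S="{..<0}"])
         (use 2 in \<open>auto simp: flat_exp_def\<close>)
  next
    case 3
    have l: "((\<lambda>h. flat_exp p h / h) \<longlongrightarrow> 0) (at_left 0)"
      by (rule tendsto_eventually) (auto simp: eventually_at_filter flat_exp_def)
    have "((\<lambda>y. poly ([:0, 1:] * p) y * exp (- y)) \<longlongrightarrow> 0) at_top" by (rule poly_mult_exp_tendsto_0)
    then have "((\<lambda>y. flat_exp p (inverse y) / inverse y) \<longlongrightarrow> 0) at_top"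
    proof (rule Lim_transform_eventually)
      show "\<forall>\<^sub>F y in at_top. poly ([:0, 1:] * p) y * exp (- y) = flat_exp p (inverse y) / inverse y"
        using eventually_gt_at_top[of 0] by eventually_elim (simp add: flat_exp_def field_simps)
    qed
    then have r: "((\<lambda>h. flat_exp p h / h) \<longlongrightarrow> 0) (at_right 0)"
      by (simp add: filterlim_at_right_to_top)
    have "((\<lambda>h. flat_exp p h / h) \<longlongrightarrow> 0) (at 0)"
      using l r by (rule filterlim_split_at)
    then show ?thesis using 3 by (simp add: DERIV_def flat_exp_def)
  qed
qed

lemma smooth_flat_exp_affine: "smooth (\<lambda>t. flat_exp p (a * t + b))"
proof (rule smooth_coinduct[where A = "range (\<lambda>p t. flat_exp p (a * t + b))"])
  show "(\<lambda>t. flat_exp p (a * t + b)) \<in> range (\<lambda>p t. flat_exp p (a * t + b))" by simp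
  fix f t assume "f \<in> range (\<lambda>p t. flat_exp p (a * t + b))"
  then obtain p where f: "f = (\<lambda>t. flat_exp p (a * t + b))" by auto
  have d: "(f has_real_derivative flat_exp (smult a ([:0, 0, 1:] * (p - pderiv p))) (a * t + b)) (at t)" for t
  proof -
    have "((\<lambda>t. a * t + b) has_real_derivative a) (at t)" by (auto intro!: derivative_eq_intros)
    from DERIV_chain2[OF flat_exp_derivative this] show ?thesis
      unfolding f by (rule DERIV_cong) (auto simp: flat_exp_def)
  qed
  then show "f differentiable (at t)" using real_differentiable_def by blast
  have "deriv f = (\<lambda>t. flat_exp (smult a ([:0, 0, 1:] * (p - pderiv p))) (a * t + b))"
    using d DERIV_imp_deriv by blast
  then show "deriv f \<in> range (\<lambda>p t. flat_exp p (a * t + b))" by blast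
qed

lemma test_function_smooth: "test_function T \<phi> \<Longrightarrow> smooth \<phi>"
  by (simp add: test_function_def smooth_def)

lemma test_functionE:
  assumes "test_function T \<phi>" "0 < T"
  obtains \<alpha> \<beta> where "0 < \<alpha>" "\<alpha> < \<beta>" "\<beta> < T" "\<And>t. t \<notin> {\<alpha>..\<beta>} \<Longrightarrow> \<phi> t = 0"
proof -
  obtain K where K: "compact K" "K \<subseteq> {0<..<T}" "\<And>t. t \<notin> K \<Longrightarrow> \<phi> t = 0"
    using assms by (auto simp: test_function_def)
  show ?thesis
  proof (cases "K = {}")
    case True
    then show ?thesis using K assms that[of "T/3" "T/2"] by auto
  next
    case False
    obtain x where x: "x \<in> K" "\<And>t. t \<in> K \<Longrightarrow> x \<le> t" using compact_attains_inf[OF K(1) False] by blast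
    obtain y where y: "y \<in> K" "\<And>t. t \<in> K \<Longrightarrow> t \<le> y" using compact_attains_sup[OF K(1) False] by blast
    have xy: "0 < x" "x \<le> y" "y < T" using x y K by auto
    \<comment> \<open>Halving the left end gives a nondegenerate interval even if \<open>K\<close>
      is a single point.\<close>
    show ?thesis
    proof (rule that[of "x/2" y])
      show "\<phi> t = 0" if "t \<notin> {x/2..y}" for t
      proof (rule K(3), rule notI)
        assume "t \<in> K"
        then show False using x(2)[of t] y(2)[of t] xy that by auto
      qed
    qed (use xy in auto)
  qed
qed

lemma test_functionI:
  assumes "smooth \<phi>" "0 < \<alpha>" "\<beta> < T" "\<And>t. t \<notin> {\<alpha>..\<beta>} \<Longrightarrow> \<phi> t = 0"
  shows "test_function T \<phi>"
  using assms unfolding test_function_def smooth_def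
  by (auto intro!: exI[of _ "{\<alpha>..\<beta>}"])

lemma smooth_continuous: "smooth \<phi> \<Longrightarrow> continuous_on S \<phi>"
  by (rule DERIV_continuous_on[of S \<phi> "deriv \<phi>"])
     (rule has_field_derivative_at_within[OF smooth_has_derivative])

lemma smooth_bounded:
  assumes "smooth \<phi>"
  obtains B where "0 \<le> B" "\<And>t. t \<in> {0<..<T} \<Longrightarrow> \<bar>\<phi> t\<bar> \<le> B"
proof -
  have "compact (\<phi> ` {0..T})"
    by (intro compact_continuous_image smooth_continuous assms compact_Icc)
  then obtain B where "\<And>x. x \<in> \<phi> ` {0..T} \<Longrightarrow> norm x \<le> B"
    using compact_imp_bounded bounded_iff by metis
  then have "norm (\<phi> t) \<le> B" if "t \<in> {0<..<T}" for t using that by simp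
  then have "\<bar>\<phi> t\<bar> \<le> \<bar>B\<bar>" if "t \<in> {0<..<T}" for t using that by fastforce
  then show ?thesis using that[of "\<bar>B\<bar>"] by auto
qed

lemma smooth_measurable: "smooth \<phi> \<Longrightarrow> \<phi> \<in> borel_measurable (lebesgue_on S)"
  by (intro measurable_restrict_space1 measurable_completion)
     (simp add: borel_measurable_continuous_onI smooth_continuous)

lemma smooth_integrable_scaleR:
  fixes f :: "real \<Rightarrow> 'b::{banach,second_countable_topology}"
  assumes \<phi>: "smooth \<phi>" and f: "integrable (time_measure T) f"
  shows "integrable (time_measure T) (\<lambda>t. \<phi> t *\<^sub>R f t)"
proof -
  obtain B where B: "0 \<le> B" "\<And>t. t \<in> {0<..<T} \<Longrightarrow> \<bar>\<phi> t\<bar> \<le> B" using smooth_bounded[OF \<phi>] by blast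
  have [measurable]: "\<phi> \<in> borel_measurable (time_measure T)" "f \<in> borel_measurable (time_measure T)"
    using \<phi> f smooth_measurable by auto
  show ?thesis
    by (rule Bochner_Integration.integrable_bound[of _ "\<lambda>t. B *\<^sub>R f t"])
       (use f B in \<open>auto intro!: AE_I2 mult_right_mono\<close>)
qed

lemma smooth_integrable_mult:
  fixes f :: "real \<Rightarrow> real"
  assumes "smooth \<phi>" "integrable (time_measure T) f"
  shows "integrable (time_measure T) (\<lambda>t. \<phi> t * f t)"
  using smooth_integrable_scaleR[OF assms] by simp

lemma smooth_integrable:
  assumes "smooth \<phi>"
  shows "integrable (time_measure T) \<phi>"
proof -
  interpret finite_measure "time_measure T" by (rule finite_time_measure)
  show ?thesis using smooth_integrable_mult[OF assms, of T "\<lambda>_. 1"] by simp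
qed

lemma test_function_add:
  assumes "test_function T \<phi>" "test_function T \<psi>"
  shows "test_function T (\<lambda>t. \<phi> t + \<psi> t)"
proof -
  obtain K where K: "compact K" "K \<subseteq> {0<..<T}" "\<And>t. t \<notin> K \<Longrightarrow> \<phi> t = 0"
    using assms by (auto simp: test_function_def)
  obtain L where L: "compact L" "L \<subseteq> {0<..<T}" "\<And>t. t \<notin> L \<Longrightarrow> \<psi> t = 0"
    using assms by (auto simp: test_function_def)
  have "smooth (\<lambda>t. \<phi> t + \<psi> t)" using assms by (intro smooth_add test_function_smooth)
  moreover have "\<phi> t + \<psi> t = 0" if "t \<notin> K \<union> L" for t using K(3)[of t] L(3)[of t] that by simp
  moreover have "compact (K \<union> L)" "K \<union> L \<subseteq> {0<..<T}" using K L by auto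
  ultimately show ?thesis unfolding test_function_def smooth_def by blast
qed

lemma test_function_scale:
  assumes "test_function T \<phi>"
  shows "test_function T (\<lambda>t. c * \<phi> t)"
proof -
  have "smooth (\<lambda>t. c * \<phi> t)" using assms by (intro smooth_mult smooth_const test_function_smooth)
  then show ?thesis
    using assms unfolding test_function_def smooth_def by auto
qed

text \<open>The primitive from 0 vanishes to the left of the support; to the right of it, it equals
  the total integral, which is zero.\<close>

lemma test_function_antiderivative:
  assumes \<rho>: "test_function T \<rho>" and T: "0 < T" and zero: "(\<integral>t. \<rho> t \<partial>time_measure T) = 0"
  obtains \<phi> where "test_function T \<phi>" "deriv \<phi> = \<rho>"
proof -
  obtain \<alpha> \<beta> where ab: "0 < \<alpha>" "\<alpha> < \<beta>" "\<beta> < T" "\<And>t. t \<notin> {\<alpha>..\<beta>} \<Longrightarrow> \<rho> t = 0"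
    using test_functionE[OF \<rho> T] by blast
  have cont: "continuous_on S \<rho>" for S by (rule smooth_continuous[OF test_function_smooth[OF \<rho>]])
  have io: "\<rho> integrable_on {s..t}" for s t by (rule integrable_continuous_real[OF cont])
  define \<phi> where "\<phi> t = integral {0..t} \<rho>" for t
  have d: "(\<phi> has_real_derivative \<rho> t) (at t)" for t
  proof (cases "t < \<alpha>")
    case True
    have z: "\<phi> s = 0" if "s < \<alpha>" for s
    proof -
      have "integral {0..s} \<rho> = integral {0..s} (\<lambda>_. 0)"
        using that ab by (intro Henstock_Kurzweil_Integration.integral_cong) auto
      then show ?thesis by (simp add: \<phi>_def)
    qed
    have "((\<lambda>t. 0) has_real_derivative \<rho> t) (at t)" using True ab by simp
    then show ?thesis
      by (rule has_field_derivative_transform_within_open[where S="{..<\<alpha>}"])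
         (use True z in auto)
  next
    case False
    then have t: "0 < t" using ab by linarith
    \<comment> \<open>The point is interior to the interval, so the derivative within it is the full
      one; the times \<open>t \<le> 0\<close> belong to the first case.\<close>
    have "(\<phi> has_real_derivative \<rho> t) (at t within {0..t + 1})"
      unfolding \<phi>_def using t by (intro integral_has_real_derivative cont) auto
    moreover have "at t within {0..t + 1} = at t" using t by (intro at_within_interior) auto
    ultimately show ?thesis by simp
  qed
  note sm = smooth_antiderivative[OF test_function_smooth[OF \<rho>] d]
  have "\<phi> t = 0" if "t \<notin> {\<alpha>..\<beta>}" for t
  proof (cases "t < \<alpha>")
    case True
    have "integral {0..t} \<rho> = integral {0..t} (\<lambda>_. 0)"
      using True ab by (intro Henstock_Kurzweil_Integration.integral_cong) auto
    then show ?thesis by (simp add: \<phi>_def)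
  next
    case False
    then have t: "\<beta> < t" using that by auto
    have "integral {0..T} \<rho> = integral {0<..<T} \<rho>"
      by (simp add: integral_open_interval_real)
    also have "\<dots> = 0"
      using zero by (subst lebesgue_integral_eq_integral[symmetric])
        (auto intro: smooth_integrable[OF test_function_smooth[OF \<rho>]])
    finally have T0: "integral {0..T} \<rho> = 0" .
    have tail: "integral {\<beta>..s} \<rho> = 0" if "\<beta> < s" for s
    proof -
      have "integral {\<beta>..s} \<rho> = integral {\<beta><..<s} \<rho>" by (simp add: integral_open_interval_real)
      also have "\<dots> = integral {\<beta><..<s} (\<lambda>_. 0)"
        using ab by (intro Henstock_Kurzweil_Integration.integral_cong) auto
      finally show ?thesis by simp
    qed
    have "integral {0..s} \<rho> = integral {0..\<beta>} \<rho>" if "\<beta> < s" for s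
      using Henstock_Kurzweil_Integration.integral_combine[of 0 \<beta> s \<rho>] ab that tail[OF that] io by simp
    then show ?thesis using T0 t ab by (simp add: \<phi>_def)
  qed
  then have "test_function T \<phi>" using ab by (intro test_functionI[OF sm(1)]) auto
  with sm(2) show ?thesis using that by blast
qed

text \<open>Let N = n + 1. The two factors are \<open>flat_exp 1\<close> at N (t - a) - 1 and at N
  (b - t) - 1. The shift by 1 keeps the support at distance 1 / N from the end points; for t inside,
  both arguments tend to infinity, where \<open>flat_exp 1\<close> tends to 1.\<close>

lemma test_functions_indicator:
  fixes a b T :: real
  assumes "0 \<le> a" "b \<le> T"
  obtains \<psi> where "\<And>n::nat. test_function T (\<psi> n)" "\<And>n t. 0 \<le> \<psi> n t" "\<And>n t. \<psi> n t \<le> 1"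
    "\<And>t. (\<lambda>n. \<psi> n t) \<longlonglongrightarrow> indicator {a<..<b} t"
proof -
  define \<psi> where "\<psi> n t = flat_exp 1 (real (Suc n) * t + (- real (Suc n) * a - 1)) *
      flat_exp 1 (- real (Suc n) * t + (real (Suc n) * b - 1))" for n t
  have lim: "(\<lambda>n. flat_exp 1 (real (Suc n) * d - 1)) \<longlonglongrightarrow> (if 0 < d then 1 else 0)" for d
  proof (cases "0 < d")
    case True
    have "filterlim (\<lambda>n. - 1 + d * real (Suc n)) at_top sequentially"
      by (intro filterlim_tendsto_add_at_top[OF tendsto_const]
          filterlim_tendsto_pos_mult_at_top[OF tendsto_const True]
          filterlim_compose[OF filterlim_real_sequentially filterlim_Suc])
    then have inf: "filterlim (\<lambda>n. real (Suc n) * d - 1) at_top sequentially"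
      by (simp add: mult.commute)
    then have "(\<lambda>n. 1 / (real (Suc n) * d - 1)) \<longlonglongrightarrow> 0"
      by (rule real_tendsto_divide_at_top[OF tendsto_const])
    then have "(\<lambda>n. exp (- (1 / (real (Suc n) * d - 1)))) \<longlonglongrightarrow> exp (- 0)"
      by (intro tendsto_intros)
    moreover have "\<forall>\<^sub>F n in sequentially.
        exp (- (1 / (real (Suc n) * d - 1))) = flat_exp 1 (real (Suc n) * d - 1)"
      using filterlim_at_top_dense[THEN iffD1, OF inf, rule_format, of 0]
      by eventually_elim (simp add: flat_exp_def)
    ultimately have "(\<lambda>n. flat_exp 1 (real (Suc n) * d - 1)) \<longlonglongrightarrow> exp (- 0)"
      by (rule Lim_transform_eventually)
    then show ?thesis using True by simp
  next
    case False
    then have le: "real (Suc n) * d \<le> 0" for n by (intro mult_nonneg_nonpos) auto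
    have "\<not> 0 < real (Suc n) * d - 1" for n using le[of n] by linarith
    then show ?thesis using False by (simp add: flat_exp_def)
  qed
  have le1: "0 \<le> flat_exp 1 x" "flat_exp 1 x \<le> 1" for x by (auto simp: flat_exp_def)
  show ?thesis
  proof (rule that[of \<psi>])
    fix n t
    show "0 \<le> \<psi> n t" "\<psi> n t \<le> 1" unfolding \<psi>_def by (intro mult_nonneg_nonneg mult_le_one le1)+
    show "test_function T (\<psi> n)"
    proof (rule test_functionI[where \<alpha>="a + 1 / real (Suc n)" and \<beta>="b - 1 / real (Suc n)"])
      show "smooth (\<psi> n)" unfolding \<psi>_def by (intro smooth_mult smooth_flat_exp_affine)
      have "0 < 1 / real (Suc n)" by simp
      then show "0 < a + 1 / real (Suc n)" "b - 1 / real (Suc n) < T" using assms by linarith+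
      fix t assume "t \<notin> {a + 1 / real (Suc n)..b - 1 / real (Suc n)}"
      then consider "t - a < 1 / real (Suc n)" | "b - t < 1 / real (Suc n)" by fastforce
      then show "\<psi> n t = 0"
      proof cases
        case 1
        then have "real (Suc n) * (t - a) < 1" by (simp add: field_simps)
        then show ?thesis by (simp add: \<psi>_def flat_exp_def algebra_simps)
      next
        case 2
        then have "real (Suc n) * (b - t) < 1" by (simp add: field_simps)
        then show ?thesis by (simp add: \<psi>_def flat_exp_def algebra_simps)
      qed
    qed
  next
    fix t
    have "(\<lambda>n. flat_exp 1 (real (Suc n) * (t - a) - 1) * flat_exp 1 (real (Suc n) * (b - t) - 1))
       \<longlonglongrightarrow> (if 0 < t - a then 1 else 0) * (if 0 < b - t then 1 else 0)"
      by (intro tendsto_mult lim)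
    moreover have "(\<lambda>n. flat_exp 1 (real (Suc n) * (t - a) - 1) * flat_exp 1 (real (Suc n) * (b - t) - 1))
        = (\<lambda>n. \<psi> n t)"
      unfolding \<psi>_def fun_eq_iff by (intro allI arg_cong2[where f="(*)"] arg_cong[where f="flat_exp 1"])
        (auto simp: algebra_simps)
    moreover have "(if 0 < t - a then 1 else 0) * (if 0 < b - t then 1 else 0) = (indicator {a<..<b} t :: real)"
      by (auto simp: indicator_def)
    ultimately show "(\<lambda>n. \<psi> n t) \<longlonglongrightarrow> indicator {a<..<b} t" by simp
  qed
qed

section \<open>The fundamental lemma of the calculus of variations\<close>

text \<open>Open intervals are an intersection-stable generator of the Borel sets, so the integral
  vanishes over every Borel set, in particular over those where \<open>f\<close> is positive or
  negative.\<close>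

lemma AE_zero_if_interval_integrals_zero:
  fixes f :: "real \<Rightarrow> real"
  assumes f: "integrable lborel f"
    and zero: "\<And>a b. (LINT x:{a<..<b}|lborel. f x) = 0"
  shows "AE x in lborel. f x = 0"
proof -
  have [measurable]: "f \<in> borel_measurable borel" using f by (simp add: borel_measurable_integrable)
  have si: "set_integrable lborel A f" if "A \<in> sets borel" for A
    unfolding set_integrable_def by (rule integrable_mult_indicator) (use that f in auto)
  \<comment> \<open>The complement step of the induction on Borel sets uses the integral over the
    whole line, which is not a bounded interval.\<close>
  have UN: "(LINT x|lborel. f x) = 0"
  proof -
    have "(\<lambda>n. LINT x:{- real n<..<real n}|lborel. f x) \<longlonglongrightarrow> (LINT x|lborel. f x)"
      unfolding set_lebesgue_integral_def
    proof (rule integral_dominated_convergence[where w="\<lambda>x. \<bar>f x\<bar>"])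
      show "AE x in lborel. (\<lambda>n. indicat_real {- real n<..<real n} x *\<^sub>R f x) \<longlonglongrightarrow> f x"
      proof (rule AE_I2)
        fix x
        obtain n where "\<bar>x\<bar> < real n" using reals_Archimedean2 by blast
        then have "\<forall>\<^sub>F n in sequentially. indicat_real {- real n<..<real n} x *\<^sub>R f x = f x"
          by (intro eventually_sequentiallyI[of n]) (auto simp: indicator_def)
        then show "(\<lambda>n. indicat_real {- real n<..<real n} x *\<^sub>R f x) \<longlonglongrightarrow> f x"
          by (rule tendsto_eventually)
      qed
    qed (use f in \<open>auto simp: indicator_def\<close>)
    then show ?thesis using zero by (simp add: LIMSEQ_const_iff)
  qed
  have all: "(LINT x:A|lborel. f x) = 0" if "A \<in> sets borel" for A
  proof -
    let ?G = "range (\<lambda>(a, b). {a<..<b::real})"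
    have beq: "borel = sigma UNIV ?G" unfolding borel_eq_box box_real ..
    have G: "A \<in> sigma_sets UNIV ?G" using that by (simp add: beq)
    have stable: "Int_stable ?G"
    proof (rule Int_stableI)
      fix p q assume "p \<in> ?G" "q \<in> ?G"
      then obtain a b c d where "p = {a<..<b}" "q = {c<..<d}" by auto
      then have "p \<inter> q = {max a c<..<min b d}" by auto
      then show "p \<inter> q \<in> ?G" by auto
    qed
    have "?G \<subseteq> Pow UNIV" by simp
    from stable this G show ?thesis
    proof (induction rule: sigma_sets_induct_disjoint)
      case (basic A) then show ?case using zero by auto
    next
      case empty show ?case by (simp add: set_lebesgue_integral_def)
    next
      case (compl A)
      then have [measurable]: "A \<in> sets borel" by (simp add: beq)
      have "(LINT x:UNIV|lborel. f x) = (LINT x:A|lborel. f x) + (LINT x:UNIV - A|lborel. f x)"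
        using set_integral_Un[of A "UNIV - A" lborel f] si[of A] si[of "UNIV - A"] by simp
      then show ?case using compl UN by (simp add: set_lebesgue_integral_def)
    next
      case (union A)
      have "A i \<in> sigma_sets UNIV ?G" for i using union(2) by blast
      then have m: "\<And>i. A i \<in> sets borel" by (simp add: beq)
      have "(LINT x:(\<Union>i. A i)|lborel. f x) = (\<Sum>i. (LINT x:(A i)|lborel. f x))"
        by (rule lebesgue_integral_countable_add)
           (use m union(1) in \<open>auto simp: disjoint_family_on_def intro!: si\<close>)
      then show ?case using union by simp
    qed
  qed
  have pos: "AE x in lborel. x \<in> {x. 0 < g x} \<longrightarrow> g x = 0"
    if g: "integrable lborel g" and z: "(LINT x:{x. 0 < g x}|lborel. g x) = 0" for g :: "real \<Rightarrow> real"
  proof -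
    have [measurable]: "g \<in> borel_measurable borel" using g by (simp add: borel_measurable_integrable)
    have i: "integrable lborel (\<lambda>x. indicat_real {x. 0 < g x} x *\<^sub>R g x)"
      by (rule integrable_mult_indicator) (use g in auto)
    have "AE x in lborel. indicat_real {x. 0 < g x} x *\<^sub>R g x = 0"
      using integral_nonneg_eq_0_iff_AE[OF i] z
      by (auto simp: set_lebesgue_integral_def indicator_def)
    then show ?thesis by eventually_elim (auto simp: indicator_def)
  qed
  have 1: "AE x in lborel. x \<in> {x. 0 < f x} \<longrightarrow> f x = 0"
    by (rule pos[OF f all]) simp
  have "(LINT x:{x. 0 < - f x}|lborel. - f x) = 0"
    using all[of "{x. 0 < - f x}"] by (simp add: set_lebesgue_integral_def)
  then have 2: "AE x in lborel. x \<in> {x. 0 < - f x} \<longrightarrow> - f x = 0"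
    using f by (intro pos) auto
  from 1 2 show ?thesis by eventually_elim force
qed

text \<open>Dominated convergence passes from test functions to indicators of intervals. Since
  \<open>time_measure\<close> comes from the completed measure, \<open>f\<close> is extended by zero
  and replaced by a Borel function \<open>G\<close> that agrees with it almost everywhere.\<close>

lemma fundamental_lemma:
  fixes f :: "real \<Rightarrow> real"
  assumes f: "integrable (time_measure T) f"
    and zero: "\<And>\<psi>. test_function T \<psi> \<Longrightarrow> (\<integral>t. \<psi> t * f t \<partial>time_measure T) = 0"
  shows "AE t in time_measure T. f t = 0"
proof -
  have sub: "(\<integral>t. indicator {a<..<b} t * f t \<partial>time_measure T) = 0" if ab: "0 \<le> a" "b \<le> T" for a b
  proof -
    obtain \<psi> where \<psi>: "\<And>n::nat. test_function T (\<psi> n)" "\<And>n t. 0 \<le> \<psi> n t" "\<And>n t. \<psi> n t \<le> 1"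
      "\<And>t. (\<lambda>n. \<psi> n t) \<longlonglongrightarrow> indicator {a<..<b} t" using test_functions_indicator[OF ab] by blast
    have [measurable]: "\<And>n. \<psi> n \<in> borel_measurable (time_measure T)"
      using \<psi>(1) test_function_smooth by (auto intro!: smooth_measurable)
    have "(\<lambda>n. \<integral>t. \<psi> n t * f t \<partial>time_measure T) \<longlonglongrightarrow>
        (\<integral>t. indicator {a<..<b} t * f t \<partial>time_measure T)"
    proof (rule integral_dominated_convergence[where w="\<lambda>t. \<bar>f t\<bar>"])
      show "(\<lambda>t. indicator {a<..<b} t * f t) \<in> borel_measurable (time_measure T)"
      proof (intro borel_measurable_times borel_measurable_indicator)
        show "{a<..<b} \<in> sets (time_measure T)"
          using ab by (auto simp: sets_restrict_space_iff)
      qed (use f in auto)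
      show "AE t in time_measure T. (\<lambda>n. \<psi> n t * f t) \<longlonglongrightarrow> indicator {a<..<b} t * f t"
        by (intro AE_I2 tendsto_intros \<psi>)
      show "AE t in time_measure T. norm (\<psi> n t * f t) \<le> \<bar>f t\<bar>" for n
        using \<psi>(2,3)[of n] by (auto simp: abs_mult intro!: mult_left_le_one_le)
    qed (use f in auto)
    then show ?thesis using zero[OF \<psi>(1)] by (simp add: LIMSEQ_const_iff)
  qed
  define F where "F t = indicator {0<..<T} t *\<^sub>R f t" for t
  have F: "integrable lebesgue F" unfolding F_def
    using f by (subst integrable_restrict_space[symmetric]) auto
  then obtain G where G: "G \<in> borel_measurable lborel" "AE t in lborel. F t = G t"
    using completion_ex_borel_measurable_real[of F lborel] by auto
  have G': "AE t in lebesgue. F t = G t" using G(2) by (rule AE_completion)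
  have iG: "integrable lebesgue G"
    by (rule integrable_cong_AE_imp[OF F]) (use G G' in \<open>auto intro: measurable_completion\<close>)
  have "AE t in lborel. G t = 0"
  proof (rule AE_zero_if_interval_integrals_zero)
    show "integrable lborel G" using iG G by (simp add: integrable_completion)
    fix a b :: real
    have [measurable]: "G \<in> borel_measurable borel" "{a<..<b} \<in> sets borel" using G by auto
    have "(LINT x:{a<..<b}|lborel. G x) = (\<integral>x. indicator {a<..<b} x *\<^sub>R G x \<partial>lebesgue)"
      unfolding set_lebesgue_integral_def by (subst integral_completion) auto
    also have "\<dots> = (\<integral>x. indicator {a<..<b} x *\<^sub>R F x \<partial>lebesgue)"
    proof (rule integral_cong_AE)
      have [measurable]: "G \<in> borel_measurable lborel" by (rule G)
      have "(\<lambda>x. indicator {a<..<b} x *\<^sub>R G x) \<in> borel_measurable lborel" by measurable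
      then show "(\<lambda>x. indicator {a<..<b} x *\<^sub>R G x) \<in> borel_measurable lebesgue"
        by (rule measurable_completion)
      show "(\<lambda>x. indicator {a<..<b} x *\<^sub>R F x) \<in> borel_measurable lebesgue"
        using F by (intro borel_measurable_scaleR borel_measurable_indicator) auto
      show "AE x in lebesgue. indicator {a<..<b} x *\<^sub>R G x = indicator {a<..<b} x *\<^sub>R F x"
        using G' by eventually_elim auto
    qed
    also have "\<dots> = (\<integral>x. indicator {0<..<T} x *\<^sub>R (indicator {max a 0<..<min b T} x * f x) \<partial>lebesgue)"
      by (intro Bochner_Integration.integral_cong) (auto simp: F_def indicator_def)
    also have "\<dots> = (\<integral>x. indicator {max a 0<..<min b T} x * f x \<partial>time_measure T)"
      by (subst integral_restrict_space) auto
    also have "\<dots> = 0" by (rule sub) auto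
    finally show "(LINT x:{a<..<b}|lborel. G x) = 0" .
  qed
  then have "AE t in lebesgue. G t = 0" by (rule AE_completion)
  with G' have "AE t in lebesgue. F t = 0" by eventually_elim simp
  then show ?thesis
    by (subst AE_restrict_space_iff) (auto simp: F_def elim!: eventually_mono)
qed

lemma countable_dense:
  obtains D :: "'b::second_countable_topology set" where "countable D" "closure D = UNIV"
proof -
  obtain D :: "'b set" where D: "countable D" "\<And>X. open X \<Longrightarrow> X \<noteq> {} \<Longrightarrow> \<exists>d \<in> D. d \<in> X"
    by (rule countable_dense_setE) blast
  have "closure D = UNIV"
  proof (rule ccontr)
    assume "closure D \<noteq> UNIV"
    then have "open (- closure D)" "- closure D \<noteq> {}" by auto
    then obtain d where "d \<in> D" "d \<in> - closure D" using D(2) by blast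
    then show False using closure_subset by auto
  qed
  with D(1) show ?thesis using that by blast
qed

text \<open>The exceptional null set depends on \<open>z\<close>; a countable dense set of
  directions leaves a single null set.\<close>

lemma AE_zero_if_inner_zero:
  fixes f :: "'a \<Rightarrow> 'b::{real_inner,second_countable_topology}"
  assumes "\<And>z. AE t in M. f t \<bullet> z = 0"
  shows "AE t in M. f t = 0"
proof -
  obtain D :: "'b set" where D: "countable D" "closure D = UNIV" by (rule countable_dense)
  have "AE t in M. \<forall>z\<in>D. f t \<bullet> z = 0" using D(1) assms by (intro AE_ball_countable[THEN iffD2]) auto
  then show ?thesis
  proof eventually_elim
    case (elim t)
    have "f t \<bullet> z = 0" if "z \<in> closure D" for z
      by (rule continuous_constant_on_closure[OF _ _ that]) (use elim in \<open>auto intro!: continuous_intros\<close>)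
    then show ?case using D(2) by (metis UNIV_I inner_eq_zero_iff)
  qed
qed

text \<open>Let \<eta> be a test function of integral 1. Every test function differs from a multiple
  of \<eta> by one of integral zero, that is, by the derivative of a test function. So
  \<open>f\<close> minus its \<eta>-weighted mean \<open>c\<close> is annihilated by all test
  functions.\<close>

lemma du_Bois_Reymond:
  fixes f :: "real \<Rightarrow> 'b::{real_inner,banach,second_countable_topology}"
  assumes T: "0 < T" and f: "integrable (time_measure T) f"
    and zero: "\<And>\<phi> z. test_function T \<phi> \<Longrightarrow> (\<integral>t. deriv \<phi> t * (f t \<bullet> z) \<partial>time_measure T) = 0"
  shows "\<exists>c. AE t in time_measure T. f t = c"
proof -
  \<comment> \<open>Otherwise the fundamental lemma would make the constant 1 vanish almost
    everywhere on an interval of positive length.\<close>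
  have "\<exists>\<psi>. test_function T \<psi> \<and> (\<integral>t. \<psi> t \<partial>time_measure T) \<noteq> 0"
  proof (rule ccontr)
    interpret finite_measure "time_measure T" by (rule finite_time_measure)
    assume "\<not> ?thesis"
    then have "AE t in time_measure T. (1::real) = 0" by (intro fundamental_lemma) auto
    then have F: "AE t in time_measure T. False" by simp
    have "{t \<in> space (time_measure T). \<not> False} = {0<..<T}" by auto
    from AE_iff_measurable[OF _ this] F have "emeasure (time_measure T) {0<..<T} = 0" by simp
    then show False using T by (simp add: emeasure_restrict_space)
  qed
  then obtain \<psi>\<^sub>0 where \<psi>\<^sub>0: "test_function T \<psi>\<^sub>0" "(\<integral>t. \<psi>\<^sub>0 t \<partial>time_measure T) \<noteq> 0" by blast
  define \<eta> where "\<eta> t = (1 / (\<integral>t. \<psi>\<^sub>0 t \<partial>time_measure T)) * \<psi>\<^sub>0 t" for t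
  have \<eta>: "test_function T \<eta>" unfolding \<eta>_def by (rule test_function_scale[OF \<psi>\<^sub>0(1)])
  have \<eta>1: "(\<integral>t. \<eta> t \<partial>time_measure T) = 1"
    using \<psi>\<^sub>0(2) unfolding \<eta>_def by simp
  define c where "c = (\<integral>t. \<eta> t *\<^sub>R f t \<partial>time_measure T)"
  have fz: "integrable (time_measure T) (\<lambda>t. f t \<bullet> z)" for z using f by simp
  have "AE t in time_measure T. (f t - c) \<bullet> z = 0" for z
  proof (rule fundamental_lemma)
    interpret finite_measure "time_measure T" by (rule finite_time_measure)
    show "integrable (time_measure T) (\<lambda>t. (f t - c) \<bullet> z)" using f by simp
    fix \<psi> assume \<psi>: "test_function T \<psi>"
    note sm = test_function_smooth[OF \<psi>] test_function_smooth[OF \<eta>]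
    note int = smooth_integrable[OF sm(1)] smooth_integrable[OF sm(2)]
      smooth_integrable_mult[OF sm(1) fz] smooth_integrable_mult[OF sm(2) fz]
    define I where "I = (\<integral>t. \<psi> t \<partial>time_measure T)"
    have tf: "test_function T (\<lambda>t. \<psi> t + (- I) * \<eta> t)"
      by (intro test_function_add test_function_scale \<psi> \<eta>)
    have "(\<integral>t. \<psi> t + (- I) * \<eta> t \<partial>time_measure T) = 0"
      using int \<eta>1 by (simp add: I_def)
    then obtain \<phi> where \<phi>: "test_function T \<phi>" "deriv \<phi> = (\<lambda>t. \<psi> t + (- I) * \<eta> t)"
      using test_function_antiderivative[OF tf T] by blast
    have cz: "(\<integral>t. \<eta> t * (f t \<bullet> z) \<partial>time_measure T) = c \<bullet> z"
      unfolding c_def using smooth_integrable_scaleR[OF sm(2) f]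
      by (subst integral_inner_left[symmetric]) auto
    have "0 = (\<integral>t. \<psi> t * (f t \<bullet> z) - I * (\<eta> t * (f t \<bullet> z)) \<partial>time_measure T)"
      using zero[OF \<phi>(1), of z] unfolding \<phi>(2) by (simp add: algebra_simps)
    also have "\<dots> = (\<integral>t. \<psi> t * (f t \<bullet> z) \<partial>time_measure T) - I * (c \<bullet> z)"
      using int by (simp add: cz)
    finally have "(\<integral>t. \<psi> t * (f t \<bullet> z) \<partial>time_measure T) = I * (c \<bullet> z)" by simp
    moreover have "(\<integral>t. \<psi> t * ((f t - c) \<bullet> z) \<partial>time_measure T)
        = (\<integral>t. \<psi> t * (f t \<bullet> z) - (c \<bullet> z) * \<psi> t \<partial>time_measure T)"
      by (intro Bochner_Integration.integral_cong) (auto simp: inner_diff_left algebra_simps)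
    ultimately show "(\<integral>t. \<psi> t * ((f t - c) \<bullet> z) \<partial>time_measure T) = 0"
      using int by (simp add: I_def)
  qed
  then have "AE t in time_measure T. f t - c = 0" by (rule AE_zero_if_inner_zero)
  then show ?thesis by auto
qed

section \<open>Absolutely continuous functions\<close>

lemma time_measurable_borel:
  assumes "f \<in> borel_measurable borel"
  shows "f \<in> borel_measurable (time_measure T)"
  by (intro measurable_restrict_space1 measurable_completion) (use assms in simp)

lemma time_measurable_continuous:
  fixes f :: "real \<Rightarrow> 'b::real_normed_vector"
  assumes "continuous_on {0..T} f"
  shows "f \<in> borel_measurable (time_measure T)"
proof -
  have "continuous_on {0<..<T} f" by (rule continuous_on_subset[OF assms]) auto
  then have "f \<in> borel_measurable (restrict_space borel {0<..<T})"
    by (rule borel_measurable_continuous_on_restrict)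
  then have "(\<lambda>x. indicator {0<..<T} x *\<^sub>R f x) \<in> borel_measurable lborel"
    by (subst (asm) borel_measurable_restrict_space_iff) auto
  then have "(\<lambda>x. indicator {0<..<T} x *\<^sub>R f x) \<in> borel_measurable lebesgue"
    by (rule measurable_completion)
  then show ?thesis by (subst borel_measurable_restrict_space_iff) auto
qed

lemma time_integrable_indicator:
  fixes f :: "real \<Rightarrow> 'b::{banach,second_countable_topology}"
  assumes "integrable (time_measure T) f" "A \<in> sets borel"
  shows "integrable (time_measure T) (\<lambda>r. indicator A r *\<^sub>R f r)"
proof (rule Bochner_Integration.integrable_bound[OF assms(1)])
  have [measurable]: "(indicator A :: real \<Rightarrow> real) \<in> borel_measurable (time_measure T)"
    by (rule time_measurable_borel) (use assms(2) in simp)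
  show "(\<lambda>r. indicator A r *\<^sub>R f r) \<in> borel_measurable (time_measure T)"
    using assms(1) by measurable
qed (auto simp: indicator_def)

text \<open>Absolute continuity in integral form: no pointwise derivative of \<open>p\<close> is
  ever taken, and \<open>p'\<close> matters only up to null sets. The times 0 and T are included
  although the measure lives on the open interval.\<close>

definition primitive_on :: "real \<Rightarrow> (real \<Rightarrow> 'b::{banach,second_countable_topology}) \<Rightarrow> (real \<Rightarrow> 'b) \<Rightarrow> bool"
  where "primitive_on T p p' \<longleftrightarrow> integrable (time_measure T) p' \<and>
    (\<forall>s t. 0 \<le> s \<longrightarrow> s \<le> t \<longrightarrow> t \<le> T \<longrightarrow>
       p t - p s = (\<integral>r. indicator {s<..t} r *\<^sub>R p' r \<partial>time_measure T))"

lemma primitive_onD: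
  assumes "primitive_on T p p'"
  shows "integrable (time_measure T) p'"
    "0 \<le> s \<Longrightarrow> s \<le> t \<Longrightarrow> t \<le> T \<Longrightarrow>
      p t - p s = (\<integral>r. indicator {s<..t} r *\<^sub>R p' r \<partial>time_measure T)"
  using assms by (auto simp: primitive_on_def)

lemma integral_indicator_combine:
  fixes f :: "real \<Rightarrow> 'b::{banach,second_countable_topology}"
  assumes f: "integrable (time_measure T) f" and st: "s \<le> t" "t \<le> u"
  shows "(\<integral>r. indicator {s<..u} r *\<^sub>R f r \<partial>time_measure T) =
    (\<integral>r. indicator {s<..t} r *\<^sub>R f r \<partial>time_measure T) +
    (\<integral>r. indicator {t<..u} r *\<^sub>R f r \<partial>time_measure T)"
proof -
  have i: "integrable (time_measure T) (\<lambda>r. indicator {x<..y} r *\<^sub>R f r)" for x y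
    by (rule time_integrable_indicator[OF f]) simp
  have "indicator {s<..u} r *\<^sub>R f r = indicator {s<..t} r *\<^sub>R f r + indicator {t<..u} r *\<^sub>R f r" for r
    using st by (auto simp: indicator_def)
  then have "(\<integral>r. indicator {s<..u} r *\<^sub>R f r \<partial>time_measure T) =
      (\<integral>r. indicator {s<..t} r *\<^sub>R f r + indicator {t<..u} r *\<^sub>R f r \<partial>time_measure T)"
    by (intro Bochner_Integration.integral_cong refl)
  also have "\<dots> = (\<integral>r. indicator {s<..t} r *\<^sub>R f r \<partial>time_measure T) +
      (\<integral>r. indicator {t<..u} r *\<^sub>R f r \<partial>time_measure T)"
    by (rule Bochner_Integration.integral_add[OF i i])
  finally show ?thesis .
qed

lemma primitive_on_integral:
  fixes f :: "real \<Rightarrow> 'b::{banach,second_countable_topology}"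
  assumes "integrable (time_measure T) f"
  shows "primitive_on T (\<lambda>t. c + (\<integral>r. indicator {0<..t} r *\<^sub>R f r \<partial>time_measure T)) f"
  unfolding primitive_on_def
proof (intro conjI allI impI assms)
  fix s t :: real assume st: "0 \<le> s" "s \<le> t"
  show "c + (\<integral>r. indicator {0<..t} r *\<^sub>R f r \<partial>time_measure T) -
      (c + (\<integral>r. indicator {0<..s} r *\<^sub>R f r \<partial>time_measure T)) =
      (\<integral>r. indicator {s<..t} r *\<^sub>R f r \<partial>time_measure T)"
    unfolding integral_indicator_combine[OF assms st] by simp
qed

text \<open>Dominated convergence: the indicators of \<open>{0<..u n}\<close> converge at every time
  except possibly \<open>a\<close>, which is a null set.\<close>

lemma primitive_on_continuous:
  assumes p: "primitive_on T p p'"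
  shows "continuous_on {0..T} p"
proof (rule continuous_on_sequentiallyI)
  fix u a assume u: "\<forall>n. u n \<in> {0..T}" and a: "a \<in> {0..T}" and lim: "u \<longlonglongrightarrow> a"
  have eq: "p x = p 0 + (\<integral>r. indicator {0<..x} r *\<^sub>R p' r \<partial>time_measure T)" if "x \<in> {0..T}" for x
    using primitive_onD(2)[OF p, of 0 x] that by (simp add: algebra_simps)
  have [measurable]: "p' \<in> borel_measurable (time_measure T)"
    using primitive_onD(1)[OF p] by auto
  have [measurable]: "\<And>x. (indicator {0<..x} :: real \<Rightarrow> real) \<in> borel_measurable (time_measure T)"
    by (rule time_measurable_borel) simp
  have "AE r in lebesgue. r \<noteq> a"
    by (rule AE_I'[of "{a}"]) auto
  then have ne: "AE r in time_measure T. r \<noteq> a"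
    by (subst AE_restrict_space_iff) auto
  have "(\<lambda>n. \<integral>r. indicator {0<..u n} r *\<^sub>R p' r \<partial>time_measure T) \<longlonglongrightarrow>
      (\<integral>r. indicator {0<..a} r *\<^sub>R p' r \<partial>time_measure T)"
  proof (rule integral_dominated_convergence[where w="\<lambda>r. norm (p' r)"])
    show "(\<lambda>r. indicator {0<..a} r *\<^sub>R p' r) \<in> borel_measurable (time_measure T)" by measurable
    show "(\<lambda>r. indicator {0<..u n} r *\<^sub>R p' r) \<in> borel_measurable (time_measure T)" for n
      by measurable
    show "AE r in time_measure T.
        (\<lambda>n. indicat_real {0<..u n} r *\<^sub>R p' r) \<longlonglongrightarrow> indicat_real {0<..a} r *\<^sub>R p' r"
      using ne
    proof eventually_elim
      case (elim r)
      have "\<forall>\<^sub>F n in sequentially. indicat_real {0<..u n} r = indicat_real {0<..a} r"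
      proof (cases "r < a")
        case True
        then have "\<forall>\<^sub>F n in sequentially. r < u n" using lim by (rule order_tendstoD(1)[rotated])
        then show ?thesis by eventually_elim (use True in \<open>auto simp: indicator_def\<close>)
      next
        case False
        then have "a < r" using elim by simp
        then have "\<forall>\<^sub>F n in sequentially. u n < r" using lim by (rule order_tendstoD(2)[rotated])
        then show ?thesis by eventually_elim (use \<open>a < r\<close> in \<open>auto simp: indicator_def\<close>)
      qed
      then show ?case by (intro tendsto_scaleR tendsto_const tendsto_eventually)
    qed
    show "AE r in time_measure T. norm (indicat_real {0<..u n} r *\<^sub>R p' r) \<le> norm (p' r)" for n
      by (intro AE_I2) (simp add: indicator_def)
    show "integrable (time_measure T) (\<lambda>r. norm (p' r))" by (rule integrable_norm[OF primitive_onD(1)[OF p]])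
  qed
  then have "(\<lambda>n. p 0 + (\<integral>r. indicator {0<..u n} r *\<^sub>R p' r \<partial>time_measure T)) \<longlonglongrightarrow>
      p 0 + (\<integral>r. indicator {0<..a} r *\<^sub>R p' r \<partial>time_measure T)" by (intro tendsto_intros)
  moreover have "p (u n) = p 0 + (\<integral>r. indicator {0<..u n} r *\<^sub>R p' r \<partial>time_measure T)" for n
    by (rule eq) (use u in blast)
  ultimately show "(\<lambda>n. p (u n)) \<longlonglongrightarrow> p a" unfolding eq[OF a] by presburger
qed

lemma primitive_on_measurable:
  "primitive_on T p p' \<Longrightarrow> p \<in> borel_measurable (time_measure T)"
  by (intro time_measurable_continuous primitive_on_continuous)

text \<open>Telescoping over a partition of mesh \<open>\<delta>\<close> turns a local bound by \<open>\<epsilon>\<close> times an integral into a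
  global one, and \<open>\<epsilon>\<close> is arbitrary.\<close>

lemma vanishing_increments:
  fixes D :: "real \<Rightarrow> real \<Rightarrow> real"
  assumes m: "integrable (time_measure T) m"
    and additive: "\<And>s t u. 0 \<le> s \<Longrightarrow> s \<le> t \<Longrightarrow> t \<le> u \<Longrightarrow> u \<le> T \<Longrightarrow> D s u = D s t + D t u"
    and small: "\<And>\<epsilon>. 0 < \<epsilon> \<Longrightarrow> \<exists>\<delta>>0. \<forall>s t. 0 \<le> s \<longrightarrow> s \<le> t \<longrightarrow> t \<le> T \<longrightarrow> t \<le> s + \<delta> \<longrightarrow>
       \<bar>D s t\<bar> \<le> \<epsilon> * (\<integral>r. indicator {s<..t} r *\<^sub>R m r \<partial>time_measure T)"
    and st: "0 \<le> s" "s \<le> t" "t \<le> T"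
  shows "D s t = 0"
proof -
  let ?m = "\<lambda>s t. \<integral>r. indicator {s<..t} r *\<^sub>R m r \<partial>time_measure T"
  have bound: "\<bar>D s t\<bar> \<le> \<epsilon> * ?m s t" if \<epsilon>: "0 < \<epsilon>" for \<epsilon>
  proof -
    obtain \<delta> where \<delta>: "0 < \<delta>" "\<And>s t. 0 \<le> s \<Longrightarrow> s \<le> t \<Longrightarrow> t \<le> T \<Longrightarrow> t \<le> s + \<delta> \<Longrightarrow> \<bar>D s t\<bar> \<le> \<epsilon> * ?m s t"
      using small[OF \<epsilon>] by metis
    have *: "\<bar>D s t\<bar> \<le> \<epsilon> * ?m s t" if "0 \<le> s" "s \<le> t" "t \<le> T" "t \<le> s + real (Suc n) * \<delta>" for s t n
      using that
    proof (induction n arbitrary: t)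
      case 0 then show ?case using \<delta>(2) by simp
    next
      case (Suc n)
      show ?case
      proof (cases "t \<le> s + \<delta>")
        case True then show ?thesis using \<delta>(2) Suc.prems by simp
      next
        case False
        have 1: "s \<le> t - \<delta>" "t - \<delta> \<le> t" "t - \<delta> \<le> T" using False \<delta>(1) Suc.prems by auto
        have "\<bar>D s (t - \<delta>)\<bar> \<le> \<epsilon> * ?m s (t - \<delta>)"
          using Suc.prems 1 by (intro Suc.IH) (auto simp: algebra_simps)
        moreover have "\<bar>D (t - \<delta>) t\<bar> \<le> \<epsilon> * ?m (t - \<delta>) t"
          using Suc.prems 1 by (intro \<delta>(2)) auto
        moreover have "D s t = D s (t - \<delta>) + D (t - \<delta>) t"
          using Suc.prems 1 by (intro additive) auto
        moreover have "?m s t = ?m s (t - \<delta>) + ?m (t - \<delta>) t"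
          using 1 by (intro integral_indicator_combine m)
        ultimately show ?thesis by (simp add: distrib_left)
      qed
    qed
    obtain n where "(t - s) / \<delta> < real n" using reals_Archimedean2 by blast
    then have "t \<le> s + real (Suc n) * \<delta>" using \<delta>(1) by (simp add: field_simps)
    then show ?thesis using * st by blast
  qed
  show ?thesis
  proof (rule ccontr)
    assume "D s t \<noteq> 0"
    \<comment> \<open>With this \<epsilon> the bound is at most half of
      \<open>\<bar>D s t\<bar>\<close>; the added 1 keeps the divisor positive.\<close>
    then have "0 < \<bar>D s t\<bar> / (2 * (\<bar>?m s t\<bar> + 1))" by (simp add: add_nonneg_pos)
    from bound[OF this] have "\<bar>D s t\<bar> \<le> \<bar>D s t\<bar> / (2 * (\<bar>?m s t\<bar> + 1)) * ?m s t" .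
    also have "\<dots> \<le> \<bar>D s t\<bar> / (2 * (\<bar>?m s t\<bar> + 1)) * (\<bar>?m s t\<bar> + 1)"
      by (intro mult_left_mono divide_nonneg_nonneg) auto
    also have "\<dots> = \<bar>D s t\<bar> / 2"
    proof -
      have "\<bar>?m s t\<bar> + 1 \<noteq> 0" using abs_ge_zero[of "?m s t"] by linarith
      then show ?thesis by (simp add: field_simps)
    qed
    finally show False using \<open>D s t \<noteq> 0\<close> by simp
  qed
qed

lemma bounded_bilinear_integrable:
  fixes f :: "real \<Rightarrow> 'a::{banach,second_countable_topology}"
    and g :: "real \<Rightarrow> 'b::{banach,second_countable_topology}" and B :: "'a \<Rightarrow> 'b \<Rightarrow> real"
  assumes B: "bounded_bilinear B" and f: "integrable (time_measure T) f" and g: "continuous_on {0..T} g"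
  shows "integrable (time_measure T) (\<lambda>r. B (f r) (g r))"
proof -
  interpret bounded_bilinear B by fact
  obtain K where K: "0 < K" "\<And>x y. norm (B x y) \<le> norm x * norm y * K" using pos_bounded by blast
  have "compact (g ` {0..T})" by (intro compact_continuous_image g) simp
  then obtain C where C: "\<And>x. x \<in> g ` {0..T} \<Longrightarrow> norm x \<le> C"
    using compact_imp_bounded bounded_iff by metis
  have [measurable]: "f \<in> borel_measurable (time_measure T)" "g \<in> borel_measurable (time_measure T)"
    using f g time_measurable_continuous by auto
  show ?thesis
  proof (rule Bochner_Integration.integrable_bound)
    show "integrable (time_measure T) (\<lambda>r. norm (f r) * (\<bar>C\<bar> * K))" using f by simp
    show "(\<lambda>r. B (f r) (g r)) \<in> borel_measurable (time_measure T)"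
      by (rule borel_measurable_continuous_Pair) (auto intro!: continuous_on continuous_intros)
    show "AE r in time_measure T. norm (B (f r) (g r)) \<le> norm (norm (f r) * (\<bar>C\<bar> * K))"
    proof (rule AE_I2)
      fix r assume "r \<in> space (time_measure T)"
      then have "norm (g r) \<le> C" by (intro C) auto
      then have "norm (g r) \<le> \<bar>C\<bar>" by simp
      then have "norm (f r) * norm (g r) * K \<le> norm (f r) * \<bar>C\<bar> * K"
        using K(1) by (intro mult_right_mono mult_left_mono) auto
      then show "norm (B (f r) (g r)) \<le> norm (norm (f r) * (\<bar>C\<bar> * K))"
        using K(2)[of "f r" "g r"] K(1) by (simp add: abs_mult mult.assoc)
    qed
  qed
qed

text \<open>The increment of the product is
  \<open>B (p t - p s) (q t) + B (p s) (q t - q s)\<close>, which is the integral formula with the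
  factors frozen at \<open>q t\<close> and \<open>p s\<close>. On short intervals uniform continuity
  makes freezing cost little, so the defect \<open>D\<close> is covered by
  \<open>vanishing_increments\<close>.\<close>

theorem primitive_on_product:
  fixes B :: "'a::{banach,second_countable_topology} \<Rightarrow> 'b::{banach,second_countable_topology} \<Rightarrow> real"
  assumes B: "bounded_bilinear B" and p: "primitive_on T p p'" and q: "primitive_on T q q'"
  shows "primitive_on T (\<lambda>t. B (p t) (q t)) (\<lambda>r. B (p' r) (q r) + B (p r) (q' r))"
proof -
  interpret bounded_bilinear B by fact
  obtain K where K: "0 < K" "\<And>x y. norm (B x y) \<le> norm x * norm y * K" using pos_bounded by blast
  let ?M = "time_measure T"
  note pc = primitive_on_continuous[OF p] and qc = primitive_on_continuous[OF q]
  note pi = primitive_onD(1)[OF p] and qi = primitive_onD(1)[OF q]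
  have i1: "integrable ?M (\<lambda>r. B (p' r) (q r))" by (rule bounded_bilinear_integrable[OF B pi qc])
  have i2: "integrable ?M (\<lambda>r. B (p r) (q' r))"
    by (rule bounded_bilinear_integrable[OF bounded_bilinear.flip[OF B] qi pc])
  have i12: "integrable ?M (\<lambda>r. B (p' r) (q r) + B (p r) (q' r))" using i1 i2 by simp
  let ?R = "\<lambda>s t. \<integral>r. indicator {s<..t} r *\<^sub>R (B (p' r) (q r) + B (p r) (q' r)) \<partial>?M"
  define D where "D s t = B (p t) (q t) - B (p s) (q s) - ?R s t" for s t
  define m where "m r = norm (p' r) + norm (q' r)" for r
  have m: "integrable ?M m" unfolding m_def using pi qi by simp
  have "D s t = 0" if st: "0 \<le> s" "s \<le> t" "t \<le> T" for s t
  proof (rule vanishing_increments[OF m _ _ st])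
    fix s t u assume "0 \<le> s" "s \<le> t" "t \<le> u" "u \<le> (T::real)"
    then show "D s u = D s t + D t u"
      unfolding D_def by (subst integral_indicator_combine[OF i12, of s t u]) auto
  next
    fix \<epsilon> :: real assume \<epsilon>: "0 < \<epsilon>"
    have "uniformly_continuous_on {0..T} p" "uniformly_continuous_on {0..T} q"
      by (intro compact_uniformly_continuous pc qc compact_Icc)+
    \<comment> \<open>Dividing by \<open>K\<close> compensates the bound of
      \<open>B\<close>.\<close>
    note uc = this[unfolded uniformly_continuous_on_def, rule_format, OF divide_pos_pos[OF \<epsilon> K(1)]]
    obtain d1 where d1: "0 < d1"
      "\<And>x y. x \<in> {0..T} \<Longrightarrow> y \<in> {0..T} \<Longrightarrow> dist y x < d1 \<Longrightarrow> dist (p y) (p x) < \<epsilon> / K"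
      using uc(1) by blast
    obtain d2 where d2: "0 < d2"
      "\<And>x y. x \<in> {0..T} \<Longrightarrow> y \<in> {0..T} \<Longrightarrow> dist y x < d2 \<Longrightarrow> dist (q y) (q x) < \<epsilon> / K"
      using uc(2) by blast
    note d = d1(1) d2(1) d1(2) d2(2)
    \<comment> \<open>Half of the minimum, because the continuity estimates ask for strict
      inequalities.\<close>
    have "\<bar>D s t\<bar> \<le> \<epsilon> * (\<integral>r. indicator {s<..t} r *\<^sub>R m r \<partial>?M)"
      if st: "0 \<le> s" "s \<le> t" "t \<le> T" and td: "t \<le> s + min d1 d2 / 2" for s t
    proof -
      let ?E = "\<lambda>r. indicator {s<..t} r *\<^sub>R (B (p' r) (q t - q r) + B (p s - p r) (q' r))"
      have j1: "integrable ?M (\<lambda>r. B (p' r) (q t))"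
        by (rule bounded_bilinear_integrable[OF B pi]) simp
      have j2: "integrable ?M (\<lambda>r. B (p s) (q' r))"
        by (rule bounded_bilinear_integrable[OF bounded_bilinear.flip[OF B] qi]) simp
      have j12: "integrable ?M (\<lambda>r. B (p' r) (q t) + B (p s) (q' r))" using j1 j2 by simp
      have E: "integrable ?M ?E"
      proof -
        have "integrable ?M (\<lambda>r. (B (p' r) (q t) + B (p s) (q' r)) - (B (p' r) (q r) + B (p r) (q' r)))"
          using j12 i12 by simp
        from time_integrable_indicator[OF this, of "{s<..t}"] show ?thesis
          by (simp add: diff_right diff_left algebra_simps)
      qed
      have pt: "B (p t - p s) (q t) = (\<integral>r. indicator {s<..t} r *\<^sub>R B (p' r) (q t) \<partial>?M)"
      proof -
        have "B (p t - p s) (q t) = (\<integral>r. B (indicator {s<..t} r *\<^sub>R p' r) (q t) \<partial>?M)"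
          unfolding primitive_onD(2)[OF p st]
          by (rule integral_bounded_linear[OF bounded_linear_left time_integrable_indicator[OF pi], symmetric])
             simp
        then show ?thesis by (simp add: scaleR_left)
      qed
      have qt: "B (p s) (q t - q s) = (\<integral>r. indicator {s<..t} r *\<^sub>R B (p s) (q' r) \<partial>?M)"
      proof -
        have "B (p s) (q t - q s) = (\<integral>r. B (p s) (indicator {s<..t} r *\<^sub>R q' r) \<partial>?M)"
          unfolding primitive_onD(2)[OF q st]
          by (rule integral_bounded_linear[OF bounded_linear_right time_integrable_indicator[OF qi], symmetric])
             simp
        then show ?thesis by (simp add: scaleR_right)
      qed
      have "B (p t) (q t) - B (p s) (q s) = B (p t - p s) (q t) + B (p s) (q t - q s)"
        by (simp add: diff_left diff_right)
      also have "\<dots> = (\<integral>r. indicator {s<..t} r *\<^sub>R (B (p' r) (q t) + B (p s) (q' r)) \<partial>?M)"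
        unfolding pt qt scaleR_add_right
        by (rule Bochner_Integration.integral_add[symmetric];
            rule time_integrable_indicator; simp add: j1 j2)
      finally have "D s t = (\<integral>r. indicator {s<..t} r *\<^sub>R (B (p' r) (q t) + B (p s) (q' r)) \<partial>?M) - ?R s t"
        by (simp add: D_def)
      also have "\<dots> = (\<integral>r. ?E r \<partial>?M)"
        by (subst Bochner_Integration.integral_diff[symmetric],
            rule time_integrable_indicator[OF j12], simp,
            rule time_integrable_indicator[OF i12], simp,
            rule Bochner_Integration.integral_cong[OF refl])
           (simp add: diff_left diff_right algebra_simps)
      finally have "\<bar>D s t\<bar> \<le> (\<integral>r. norm (?E r) \<partial>?M)"
        using integral_norm_bound[of ?M ?E] by simp
      also have "\<dots> \<le> (\<integral>r. \<epsilon> * (indicator {s<..t} r *\<^sub>R m r) \<partial>?M)"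
      proof (rule integral_mono)
        show "integrable ?M (\<lambda>r. \<epsilon> * (indicator {s<..t} r *\<^sub>R m r))"
          by (intro integrable_mult_right time_integrable_indicator m) simp
        fix r assume "r \<in> space ?M"
        then have r: "r \<in> {0..T}" by auto
        show "norm (?E r) \<le> \<epsilon> * (indicator {s<..t} r *\<^sub>R m r)"
        proof (cases "r \<in> {s<..t}")
          case True
          have "dist (q t) (q r) < \<epsilon> / K" "dist (p s) (p r) < \<epsilon> / K"
            using True r st td d(1,2) by (auto intro!: d simp: dist_real_def)
          then have l: "norm (q t - q r) * K \<le> \<epsilon>" "norm (p s - p r) * K \<le> \<epsilon>"
            using K(1) by (auto simp: dist_norm field_simps)
          have "norm (B (p' r) (q t - q r)) \<le> norm (p' r) * (norm (q t - q r) * K)"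
            using K(2) by (simp add: mult.assoc)
          also have "\<dots> \<le> norm (p' r) * \<epsilon>" by (intro mult_left_mono l) simp
          finally have a: "norm (B (p' r) (q t - q r)) \<le> norm (p' r) * \<epsilon>" .
          have "norm (B (p s - p r) (q' r)) \<le> norm (q' r) * (norm (p s - p r) * K)"
            using K(2)[of "p s - p r" "q' r"] by (simp add: mult_ac)
          also have "\<dots> \<le> norm (q' r) * \<epsilon>" by (intro mult_left_mono l) simp
          finally have b: "norm (B (p s - p r) (q' r)) \<le> norm (q' r) * \<epsilon>" .
          have "norm (B (p' r) (q t - q r) + B (p s - p r) (q' r)) \<le> norm (p' r) * \<epsilon> + norm (q' r) * \<epsilon>"
            by (intro norm_triangle_le add_mono a b)
          then show ?thesis using True by (simp add: m_def algebra_simps)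
        qed simp
      qed (use E in simp)
      finally show ?thesis by simp
    qed
    then show "\<exists>\<delta>>0. \<forall>s t. 0 \<le> s \<longrightarrow> s \<le> t \<longrightarrow> t \<le> T \<longrightarrow> t \<le> s + \<delta> \<longrightarrow>
        \<bar>D s t\<bar> \<le> \<epsilon> * (\<integral>r. indicator {s<..t} r *\<^sub>R m r \<partial>?M)"
      using d(1,2) by (intro exI[of _ "min d1 d2 / 2"]) auto
  qed
  then show ?thesis using i12 unfolding primitive_on_def D_def by simp
qed

lemma primitive_on_C1:
  fixes f :: "real \<Rightarrow> real"
  assumes "\<And>t. t \<in> {0..T} \<Longrightarrow> (f has_real_derivative f' t) (at t)" "continuous_on {0..T} f'"
  shows "primitive_on T f f'"
  unfolding primitive_on_def
proof (intro conjI allI impI)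
  obtain C where C: "\<And>x. x \<in> f' ` {0..T} \<Longrightarrow> norm x \<le> C"
    using compact_imp_bounded[OF compact_continuous_image[OF assms(2) compact_Icc]] bounded_iff by metis
  interpret finite_measure "time_measure T" by (rule finite_time_measure)
  show i: "integrable (time_measure T) f'"
    by (rule integrable_const_bound[of _ C])
       (use C in \<open>auto intro!: AE_I2 time_measurable_continuous assms(2)\<close>)
  fix s t assume st: "0 \<le> s" "s \<le> t" "t \<le> T"
  let ?g = "\<lambda>r. indicator {s<..t} r *\<^sub>R f' r"
  have "(f' has_integral (f t - f s)) {s..t}"
    by (rule fundamental_theorem_of_calculus[OF st(2)])
       (use st assms(1) in \<open>auto simp: has_real_derivative_iff_has_vector_derivative[symmetric]
          intro: has_field_derivative_at_within\<close>)
  then have "(f' has_integral (f t - f s)) {s<..<t}"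
    by (simp add: has_integral_Icc_iff_Ioo)
  then have "((\<lambda>r. if r \<in> {s<..<t} then f' r else 0) has_integral (f t - f s)) {0<..<T}"
    by (subst has_integral_restrict) (use st in auto)
  \<comment> \<open>The half-open indicator differs from the open interval only at
    \<open>t\<close>.\<close>
  then have "(?g has_integral (f t - f s)) {0<..<T}"
    by (rule has_integral_spike_finite[of "{t}", rotated 2]) auto
  moreover have "(?g has_integral (\<integral>r. ?g r \<partial>time_measure T)) {0<..<T}"
    by (rule has_integral_integral_lebesgue_on[OF time_integrable_indicator[OF i]]) auto
  ultimately show "f t - f s = (\<integral>r. ?g r \<partial>time_measure T)" by (rule has_integral_unique)
qed

lemma primitive_on_total:
  assumes "primitive_on T p p'" "0 < T"
  shows "p T - p 0 = (\<integral>r. p' r \<partial>time_measure T)"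
proof -
  have "p T - p 0 = (\<integral>r. indicator {0<..T} r *\<^sub>R p' r \<partial>time_measure T)"
    using assms by (intro primitive_onD(2)) auto
  also have "\<dots> = (\<integral>r. p' r \<partial>time_measure T)"
    by (intro Bochner_Integration.integral_cong) auto
  finally show ?thesis .
qed

section \<open>The Riesz isometry\<close>

text \<open>\<open>riesz_on\<close> for a complete type in place of a carrier. Coercivity constant 1
  fits the inner product and its sums with nonnegative forms, which yield \<open>riesz_rep\<close>,
  \<open>K\<close> and \<open>Z\<close>.\<close>

lemma coercive_form_representation:
  fixes b :: "'v::{real_inner,banach} \<Rightarrow> 'v \<Rightarrow> real"
  assumes b: "bounded_bilinear b" and sym: "\<And>x y. b x y = b y x"
    and coercive: "\<And>x. (norm x)\<^sup>2 \<le> b x x" and f: "bounded_linear f"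
  shows "\<exists>x. \<forall>y. b x y = f y"
proof -
  interpret b: bounded_bilinear b by fact
  interpret f: bounded_linear f by fact
  obtain M where M: "\<And>x y. norm (b x y) \<le> norm x * norm y * M" using b.bounded by blast
  obtain C where C: "\<And>x. norm (f x) \<le> norm x * C" using f.bounded by blast
  have "\<exists>x\<in>UNIV. \<forall>y\<in>UNIV. b x y = f y"
  proof (rule riesz_on[where N=norm and c=1 and M=M and K=C])
    show "seminorm_on UNIV norm" by (auto simp: seminorm_on_def norm_triangle_ineq)
    show "complete_on UNIV (norm :: 'v \<Rightarrow> real)"
      unfolding complete_on_def
    proof (intro allI impI, elim conjE)
      fix s :: "nat \<Rightarrow> 'v"
      assume "\<forall>e>0. \<exists>M. \<forall>m\<ge>M. \<forall>n\<ge>M. norm (s m - s n) < e"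
      then have "Cauchy s" by (simp add: Cauchy_def dist_norm)
      then obtain l where "s \<longlonglongrightarrow> l" by (auto simp: Cauchy_convergent_iff convergent_def)
      then show "\<exists>x\<in>UNIV. (\<lambda>n. norm (s n - x)) \<longlonglongrightarrow> 0"
        by (auto simp: LIM_zero_iff tendsto_norm_zero_iff)
    qed
  qed (use M C in \<open>auto simp: sym coercive bilinear_form_on_def linear_form_on_def b.add_left b.add_right
      b.scaleR_left b.scaleR_right f.add f.scaleR mult_ac\<close>)
  then show ?thesis by simp
qed

definition riesz_rep :: "('v::real_inner \<Rightarrow>\<^sub>L real) \<Rightarrow> 'v"
  where "riesz_rep f = (THE x. \<forall>y. blinfun_apply f y = x \<bullet> y)"

lemma inner_eqI: "(\<And>y. x \<bullet> y = z \<bullet> y) \<Longrightarrow> x = z"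
  by (metis inner_diff_left inner_eq_zero_iff right_minus_eq)

lemma riesz_rep_inner:
  fixes f :: "'v::{real_inner,banach} \<Rightarrow>\<^sub>L real"
  shows "riesz_rep f \<bullet> y = blinfun_apply f y"
proof -
  obtain x where x: "\<forall>y. x \<bullet> y = blinfun_apply f y"
    using coercive_form_representation[OF bounded_bilinear_inner inner_commute _ blinfun.bounded_linear_right, of f]
    by (auto simp: power2_norm_eq_inner)
  then have "riesz_rep f = x"
    unfolding riesz_rep_def
    by (intro the_equality) (simp, rule inner_eqI, simp)
  then show ?thesis using x by simp
qed

lemma riesz_rep_blinfun_inner: "riesz_rep (blinfun_inner_right x) = x"
  for x :: "'v::{real_inner,banach}"
  by (rule inner_eqI) (simp add: riesz_rep_inner)

lemma riesz_rep_add: "riesz_rep (f + g) = riesz_rep f + riesz_rep g"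
  for f g :: "'v::{real_inner,banach} \<Rightarrow>\<^sub>L real"
  by (rule inner_eqI) (simp add: riesz_rep_inner inner_add_left blinfun.add_left)

lemma riesz_rep_scale: "riesz_rep (c *\<^sub>R f) = c *\<^sub>R riesz_rep f"
  for f :: "'v::{real_inner,banach} \<Rightarrow>\<^sub>L real"
  by (rule inner_eqI) (simp add: riesz_rep_inner blinfun.scaleR_left)

lemma norm_riesz_rep: "norm (riesz_rep f) = norm f"
  for f :: "'v::{real_inner,banach} \<Rightarrow>\<^sub>L real"
proof (rule antisym)
  have "(norm (riesz_rep f))\<^sup>2 = blinfun_apply f (riesz_rep f)"
    by (simp add: power2_norm_eq_inner riesz_rep_inner)
  also have "\<dots> \<le> norm f * norm (riesz_rep f)"
    using norm_blinfun[of f "riesz_rep f"] by simp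
  finally show "norm (riesz_rep f) \<le> norm f"
    by (cases "riesz_rep f = 0") (auto simp: power2_eq_square)
  show "norm f \<le> norm (riesz_rep f)"
    by (rule norm_blinfun_bound) (auto simp: riesz_rep_inner[symmetric] Cauchy_Schwarz_ineq2)
qed

lemma bounded_linear_riesz_rep:
  "bounded_linear (riesz_rep :: ('v::{real_inner,banach} \<Rightarrow>\<^sub>L real) \<Rightarrow> 'v)"
  by (rule bounded_linear_intro[where K=1]) (auto simp: riesz_rep_add riesz_rep_scale norm_riesz_rep)

lemma blinfun_inner_riesz_rep: "blinfun_inner_right (riesz_rep f) = f"
  for f :: "'v::{real_inner,banach} \<Rightarrow>\<^sub>L real"
  by (rule blinfun_eqI) (simp add: riesz_rep_inner)

lemma measurable_bounded_linear:
  assumes "bounded_linear f" "g \<in> borel_measurable M"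
  shows "(\<lambda>t. f (g t)) \<in> borel_measurable M"
  by (rule measurable_compose[OF assms(2)])
     (intro borel_measurable_continuous_onI bounded_linear.continuous_on[OF assms(1)] continuous_on_id)

text \<open>The Riesz map and its inverse are both continuous, so measurability passes in each
  direction, and derivatives with values in V' can be handled in V.\<close>

lemma L2_space_riesz_rep:
  fixes w :: "real \<Rightarrow> 'v::{real_inner,banach} \<Rightarrow>\<^sub>L real"
  shows "w \<in> L2_space T \<longleftrightarrow> (\<lambda>t. riesz_rep (w t)) \<in> L2_space T"
proof
  assume "w \<in> L2_space T"
  then show "(\<lambda>t. riesz_rep (w t)) \<in> L2_space T"
    by (auto simp: L2_space_def norm_riesz_rep intro: measurable_bounded_linear[OF bounded_linear_riesz_rep])
next
  assume *: "(\<lambda>t. riesz_rep (w t)) \<in> L2_space T"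
  then have "(\<lambda>t. blinfun_inner_right (riesz_rep (w t))) \<in> borel_measurable (time_measure T)"
    by (intro measurable_bounded_linear[OF bounded_linear_blinfun_inner_right]) (auto simp: L2_space_def)
  with * show "w \<in> L2_space T"
    by (auto simp: L2_space_def norm_riesz_rep blinfun_inner_riesz_rep)
qed

lemma L2_norm_riesz_rep: "L2_norm T (\<lambda>t. riesz_rep (w t)) = L2_norm T w"
  for w :: "real \<Rightarrow> 'v::{real_inner,banach} \<Rightarrow>\<^sub>L real"
  by (simp add: L2_norm_def norm_riesz_rep)

lemma L2_space_bounded_linear:
  fixes f :: "'a::{real_normed_vector} \<Rightarrow> 'b::real_normed_vector"
  assumes f: "bounded_linear f" and u: "u \<in> L2_space T" and C: "\<And>x. norm (f x) \<le> C * norm x" "0 \<le> C"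
  shows "(\<lambda>t. f (u t)) \<in> L2_space T" "L2_norm T (\<lambda>t. f (u t)) \<le> C * L2_norm T u"
proof -
  have [measurable]: "(\<lambda>t. f (u t)) \<in> borel_measurable (time_measure T)"
    by (rule measurable_bounded_linear[OF f L2_spaceD(1)[OF u]])
  have sq: "(norm (f x))\<^sup>2 \<le> C\<^sup>2 * (norm x)\<^sup>2" for x
    using power_mono[OF C(1)[of x], of 2] by (simp add: power_mult_distrib)
  have i: "integrable (time_measure T) (\<lambda>t. C\<^sup>2 * (norm (u t))\<^sup>2)"
    using L2_spaceD(2)[OF u] by simp
  have i': "integrable (time_measure T) (\<lambda>t. (norm (f (u t)))\<^sup>2)"
    by (rule Bochner_Integration.integrable_bound[OF i]) (use sq in auto)
  then show "(\<lambda>t. f (u t)) \<in> L2_space T" by (simp add: L2_space_def)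
  have "(L2_norm T (\<lambda>t. f (u t)))\<^sup>2 \<le> (C * L2_norm T u)\<^sup>2"
    unfolding power_mult_distrib L2_norm_square
    using integral_mono[OF i' i] sq by simp
  then show "L2_norm T (\<lambda>t. f (u t)) \<le> C * L2_norm T u"
    by (rule power2_le_imp_le) (use C in simp)
qed

section \<open>Regularisation in space\<close>

locale gelfand =
  fixes T :: real
    and j :: "'v::{real_inner,banach,second_countable_topology} \<Rightarrow> 'h::{real_inner,banach,second_countable_topology}"
  assumes T: "0 < T" and j: "bounded_linear j" and inj: "inj j" and dense: "closure (range j) = UNIV"
begin

lemmas j_simps = linear_add[OF bounded_linear.linear[OF j]] linear_scale[OF bounded_linear.linear[OF j]]
  linear_diff[OF bounded_linear.linear[OF j]] linear_0[OF bounded_linear.linear[OF j]]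

definition Cj :: real where "Cj = onorm j"

lemma Cj: "norm (j x) \<le> Cj * norm x" "0 \<le> Cj"
  unfolding Cj_def by (rule onorm[OF j], rule onorm_pos_le[OF j])

lemma bilinear_j: "bounded_linear f \<Longrightarrow> bounded_linear g \<Longrightarrow> bounded_bilinear (\<lambda>x y. j (f x) \<bullet> j (g y))"
  by (rule bounded_bilinear.comp[OF bounded_bilinear_inner
        bounded_linear_compose[OF j] bounded_linear_compose[OF j]])

text \<open>Under the Riesz identification of V' with V, this is the inclusion of V in V' through
  H.\<close>

definition K :: "'v \<Rightarrow> 'v" where "K x = (SOME z. \<forall>y. z \<bullet> y = j x \<bullet> j y)"

lemma K: "K x \<bullet> y = j x \<bullet> j y"
proof -
  have "bounded_linear (\<lambda>y. j x \<bullet> j y)"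
    by (rule bounded_linear_compose[OF bounded_linear_inner_right j])
  then have "\<exists>z. \<forall>y. z \<bullet> y = j x \<bullet> j y"
    by (intro coercive_form_representation[OF bounded_bilinear_inner])
       (auto simp: inner_commute power2_norm_eq_inner)
  then show ?thesis unfolding K_def by (rule someI2_ex) blast
qed

lemma bounded_linear_K: "bounded_linear K"
proof (rule bounded_linear_intro[where K="Cj\<^sup>2"])
  show "K (x + y) = K x + K y" for x y by (rule inner_eqI) (simp add: K inner_simps j_simps)
  show "K (r *\<^sub>R x) = r *\<^sub>R K x" for r x by (rule inner_eqI) (simp add: K inner_simps j_simps)
  show "norm (K x) \<le> norm x * Cj\<^sup>2" for x
  proof -
    have "(norm (K x))\<^sup>2 = j x \<bullet> j (K x)" by (simp add: power2_norm_eq_inner K)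
    also have "\<dots> \<le> norm (j x) * norm (j (K x))" by (rule norm_cauchy_schwarz)
    also have "\<dots> \<le> (Cj * norm x) * (Cj * norm (K x))" by (intro mult_mono Cj) (auto simp: Cj(2))
    finally show ?thesis
      by (cases "K x = 0") (auto simp: power2_eq_square mult_ac Cj(2))
  qed
qed

definition Z :: "real \<Rightarrow> 'v \<Rightarrow> 'v"
  where "Z \<beta> x = (SOME z. \<forall>v. z \<bullet> v + \<beta> * (j z \<bullet> j v) = x \<bullet> v)"

context
  fixes \<beta> :: real
  assumes \<beta>: "0 \<le> \<beta>"
begin

lemma Z: "Z \<beta> x \<bullet> v + \<beta> * (j (Z \<beta> x) \<bullet> j v) = x \<bullet> v"
proof -
  have "bounded_bilinear (\<lambda>z v. z \<bullet> v + \<beta> * (j z \<bullet> j v))"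
  proof
    have "norm (x \<bullet> y + \<beta> * (j x \<bullet> j y)) \<le> norm x * norm y * (1 + \<beta> * Cj\<^sup>2)" for x y
    proof -
      have "\<bar>j x \<bullet> j y\<bar> \<le> (Cj * norm x) * (Cj * norm y)"
        by (rule order_trans[OF Cauchy_Schwarz_ineq2 mult_mono]) (auto simp: Cj)
      then have "\<beta> * \<bar>j x \<bullet> j y\<bar> \<le> \<beta> * ((Cj * norm x) * (Cj * norm y))"
        using \<beta> by (rule mult_left_mono)
      moreover have "\<bar>x \<bullet> y\<bar> \<le> norm x * norm y" by (rule Cauchy_Schwarz_ineq2)
      moreover have "norm (x \<bullet> y + \<beta> * (j x \<bullet> j y)) \<le> \<bar>x \<bullet> y\<bar> + \<beta> * \<bar>j x \<bullet> j y\<bar>"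
        using \<beta> by (simp add: abs_triangle_ineq[THEN order_trans] abs_mult)
      ultimately show ?thesis by (simp add: power2_eq_square algebra_simps)
    qed
    then show "\<exists>K. \<forall>x y. norm (x \<bullet> y + \<beta> * (j x \<bullet> j y)) \<le> norm x * norm y * K" by blast
  qed (auto simp: inner_simps j_simps algebra_simps)
  then have "\<exists>z. \<forall>v. z \<bullet> v + \<beta> * (j z \<bullet> j v) = x \<bullet> v"
    using \<beta> by (intro coercive_form_representation)
      (auto simp: inner_commute power2_norm_eq_inner bounded_linear_inner_right)
  then show ?thesis unfolding Z_def by (rule someI2_ex) blast
qed

text \<open>Testing the difference with itself leaves a sum of two nonnegative terms equal to zero.
  Linearity of \<open>Z\<close> and the identity \<open>ZK\<close> are then verified on the defining
  equation.\<close>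

lemma Z_unique:
  assumes "\<And>v. z \<bullet> v + \<beta> * (j z \<bullet> j v) = x \<bullet> v"
  shows "Z \<beta> x = z"
proof -
  let ?d = "Z \<beta> x - z"
  have "?d \<bullet> ?d + \<beta> * (j ?d \<bullet> j ?d) = 0"
    using Z[of x ?d] assms[of ?d] by (simp add: inner_diff_left j_simps algebra_simps)
  moreover have "0 \<le> \<beta> * (j ?d \<bullet> j ?d)" using \<beta> by simp
  ultimately have "?d \<bullet> ?d = 0" using inner_ge_zero[of ?d] by linarith
  then show ?thesis by simp
qed

lemma norm_Z_le: "norm (Z \<beta> x) \<le> 1 * norm x"
proof -
  have "0 \<le> \<beta> * (j (Z \<beta> x) \<bullet> j (Z \<beta> x))" using \<beta> by simp
  then have "(norm (Z \<beta> x))\<^sup>2 \<le> x \<bullet> Z \<beta> x"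
    using Z[of x "Z \<beta> x"] unfolding power2_norm_eq_inner by linarith
  also have "\<dots> \<le> norm x * norm (Z \<beta> x)" by (rule norm_cauchy_schwarz)
  finally show ?thesis
    by (cases "Z \<beta> x = 0") (auto simp: power2_eq_square)
qed

lemma bounded_linear_Z: "bounded_linear (Z \<beta>)"
proof (rule bounded_linear_intro[where K=1])
  show "Z \<beta> (x + y) = Z \<beta> x + Z \<beta> y" for x y
  proof (rule Z_unique)
    show "(Z \<beta> x + Z \<beta> y) \<bullet> v + \<beta> * (j (Z \<beta> x + Z \<beta> y) \<bullet> j v) = (x + y) \<bullet> v" for v
      using Z[of x v] Z[of y v] by (simp add: inner_add_left j_simps algebra_simps)
  qed
  show "Z \<beta> (r *\<^sub>R x) = r *\<^sub>R Z \<beta> x" for r x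
  proof (rule Z_unique)
    show "(r *\<^sub>R Z \<beta> x) \<bullet> v + \<beta> * (j (r *\<^sub>R Z \<beta> x) \<bullet> j v) = (r *\<^sub>R x) \<bullet> v" for v
      using arg_cong[OF Z[of x v], of "\<lambda>a. r * a"] by (simp add: j_simps algebra_simps)
  qed
  show "norm (Z \<beta> x) \<le> norm x * 1" for x using norm_Z_le by simp
qed

text \<open>Together with \<open>ZK\<close> this says that \<beta> K commutes with
  \<open>Z \<beta>\<close>. Keeping the factor \<beta> avoids a division and covers \<beta> =
  0.\<close>

lemma KZ: "\<beta> *\<^sub>R K (Z \<beta> x) = x - Z \<beta> x"
proof (rule inner_eqI)
  show "(\<beta> *\<^sub>R K (Z \<beta> x)) \<bullet> y = (x - Z \<beta> x) \<bullet> y" for y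
    using Z[of x y] by (simp add: K inner_diff_left)
qed

lemma ZK: "\<beta> *\<^sub>R Z \<beta> (K x) = x - Z \<beta> x"
proof -
  have "Z \<beta> (\<beta> *\<^sub>R K x) = x - Z \<beta> x"
  proof (rule Z_unique)
    show "(x - Z \<beta> x) \<bullet> v + \<beta> * (j (x - Z \<beta> x) \<bullet> j v) = (\<beta> *\<^sub>R K x) \<bullet> v" for v
      using Z[of x v] by (simp add: K inner_diff_left j_simps algebra_simps)
  qed
  then show ?thesis by (simp add: linear_scale[OF bounded_linear.linear[OF bounded_linear_Z]])
qed

text \<open>\<open>Z \<beta> x\<close> minimises the functional \<open>penalty \<beta> x\<close>.\<close>

definition penalty :: "'v \<Rightarrow> 'v \<Rightarrow> real"
  where "penalty x v = (norm (v - x))\<^sup>2 + \<beta> * (norm (j v))\<^sup>2"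

text \<open>The expansion of a quadratic functional around its minimiser: the linear term is the
  defining equation of \<open>Z\<close> tested with \<open>v - Z \<beta> x\<close> and
  vanishes.\<close>

lemma penalty_Z: "penalty x v = penalty x (Z \<beta> x) + (norm (v - Z \<beta> x))\<^sup>2 + \<beta> * (norm (j (v - Z \<beta> x)))\<^sup>2"
proof -
  let ?z = "Z \<beta> x"
  have "(?z - x) \<bullet> (v - ?z) + \<beta> * (j ?z \<bullet> j (v - ?z)) = 0"
    using Z[of x "v - ?z"] by (simp add: inner_diff_left)
  then show ?thesis unfolding penalty_def power2_norm_eq_inner
    by (simp add: j_simps inner_simps inner_commute algebra_simps)
qed

end

text \<open>The minimisers \<open>Z n x\<close> of an increasing family of functionals, bounded above by
  \<open>(norm x)\<^sup>2\<close>, form a Cauchy sequence by strong convexity; the limit lies in the kernel of \<open>j\<close>.\<close>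

lemma Z_tendsto_0: "(\<lambda>n. Z (real n) x) \<longlonglongrightarrow> 0"
proof -
  define m where "m n = penalty (real n) x (Z (real n) x)" for n :: nat
  have pen_def: "penalty (real n) x v = (norm (v - x))\<^sup>2 + real n * (norm (j v))\<^sup>2" for n v
    by (simp add: penalty_def)
  have step: "m n + (norm (Z (real k) x - Z (real n) x))\<^sup>2 \<le> m k" if "n \<le> k" for n k
  proof -
    have "0 \<le> real n * (norm (j (Z (real k) x - Z (real n) x)))\<^sup>2" by simp
    then have "m n + (norm (Z (real k) x - Z (real n) x))\<^sup>2 \<le> penalty (real n) x (Z (real k) x)"
      using penalty_Z[of "real n" x "Z (real k) x"] unfolding m_def by simp
    also have "\<dots> \<le> m k"
      unfolding m_def pen_def using that by (intro add_left_mono mult_right_mono) auto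
    finally show ?thesis .
  qed
  have mono: "m n \<le> m k" if "n \<le> k" for n k
    using step[OF that] zero_le_power2[of "norm (Z (real k) x - Z (real n) x)"] by linarith
  have bound: "m n \<le> (norm x)\<^sup>2" for n
  proof -
    have "m n \<le> penalty (real n) x 0"
      using penalty_Z[of "real n" x 0] unfolding m_def by simp
    then show ?thesis unfolding pen_def by (simp add: j_simps)
  qed
  have "convergent m"
    using mono bound by (intro Bseq_mono_convergent BseqI'[where K="(norm x)\<^sup>2"])
      (auto simp: m_def pen_def abs_le_iff intro!: order_trans[OF _ bound[unfolded m_def pen_def]])
  then have mC: "Cauchy m" by (simp add: convergent_Cauchy)
  have "Cauchy (\<lambda>n. Z (real n) x)"
  proof (rule CauchyI)
    fix e :: real assume "0 < e"
    then obtain M where M: "\<And>p q. p \<ge> M \<Longrightarrow> q \<ge> M \<Longrightarrow> norm (m p - m q) < e\<^sup>2"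
      using CauchyD[OF mC, of "e\<^sup>2"] by auto
    have le: "norm (Z (real k) x - Z (real n) x) < e" if "n \<le> k" "M \<le> n" for n k
    proof -
      have "(norm (Z (real k) x - Z (real n) x))\<^sup>2 \<le> m k - m n" using step[OF that(1)] by simp
      also have "\<dots> < e\<^sup>2" using M[of k n] that by simp
      finally show ?thesis using \<open>0 < e\<close> by (simp add: power2_less_imp_less)
    qed
    show "\<exists>M. \<forall>p\<ge>M. \<forall>q\<ge>M. norm (Z (real p) x - Z (real q) x) < e"
      by (metis le nle_le norm_minus_commute)
  qed
  then obtain z where z: "(\<lambda>n. Z (real n) x) \<longlonglongrightarrow> z" by (auto simp: Cauchy_convergent_iff convergent_def)
  have "(\<lambda>n. j (Z (real n) x)) \<longlonglongrightarrow> j z" by (rule bounded_linear.tendsto[OF j z])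
  then have "(\<lambda>n. (norm (j (Z (real n) x)))\<^sup>2) \<longlonglongrightarrow> (norm (j z))\<^sup>2" by (intro tendsto_intros)
  \<comment> \<open>The weighted term of the minimal penalty stays below the square of
    \<open>norm x\<close>, while its weight n grows.\<close>
  moreover have "(\<lambda>n. (norm (j (Z (real n) x)))\<^sup>2) \<longlonglongrightarrow> 0"
  proof (rule Lim_null_comparison)
    show "\<forall>\<^sub>F n in sequentially. norm ((norm (j (Z (real n) x)))\<^sup>2) \<le> (norm x)\<^sup>2 / real n"
    proof (rule eventually_sequentiallyI[of 1])
      fix n :: nat assume "1 \<le> n"
      moreover have "real n * (norm (j (Z (real n) x)))\<^sup>2 \<le> (norm x)\<^sup>2"
        using bound[of n] zero_le_power2[of "norm (Z (real n) x - x)"] unfolding m_def pen_def by linarith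
      ultimately show "norm ((norm (j (Z (real n) x)))\<^sup>2) \<le> (norm x)\<^sup>2 / real n"
        by (simp add: field_simps)
    qed
    show "(\<lambda>n. (norm x)\<^sup>2 / real n) \<longlonglongrightarrow> 0" by (rule lim_const_over_n)
  qed
  ultimately have "(norm (j z))\<^sup>2 = 0" by (rule LIMSEQ_unique)
  then have "j z = j 0" by (simp add: j_simps)
  then have "z = 0" using inj by (simp add: inj_eq)
  with z show ?thesis by simp
qed

lemma Z_L2:
  assumes "u \<in> L2_space T"
  shows "(\<lambda>t. Z (real n) (u t)) \<in> L2_space T"
  by (rule L2_space_bounded_linear(1)[OF bounded_linear_Z assms norm_Z_le]) auto

lemma Z_L2_tendsto_0:
  assumes u: "u \<in> L2_space T"
  shows "(\<lambda>n. L2_norm T (\<lambda>t. Z (real n) (u t))) \<longlonglongrightarrow> 0"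
proof -
  have "(\<lambda>n. \<integral>t. (norm (Z (real n) (u t)))\<^sup>2 \<partial>time_measure T) \<longlonglongrightarrow> (\<integral>t. 0 \<partial>time_measure T)"
  proof (rule integral_dominated_convergence[where w="\<lambda>t. (norm (u t))\<^sup>2"])
    show "(\<lambda>t. (norm (Z (real n) (u t)))\<^sup>2) \<in> borel_measurable (time_measure T)" for n
      using L2_spaceD(2)[OF Z_L2[OF u]] by auto
    show "AE t in time_measure T. (\<lambda>n. (norm (Z (real n) (u t)))\<^sup>2) \<longlonglongrightarrow> 0"
    proof (rule AE_I2)
      fix t
      have "(\<lambda>n. (norm (Z (real n) (u t)))\<^sup>2) \<longlonglongrightarrow> (norm (0::'v))\<^sup>2"
        by (intro tendsto_intros Z_tendsto_0)
      then show "(\<lambda>n. (norm (Z (real n) (u t)))\<^sup>2) \<longlonglongrightarrow> 0" by simp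
    qed
    show "AE t in time_measure T. norm ((norm (Z (real n) (u t)))\<^sup>2) \<le> (norm (u t))\<^sup>2" for n
      using norm_Z_le[of "real n"] by (auto intro!: AE_I2 power_mono)
  qed (use L2_spaceD(2)[OF u] in auto)
  then have "(\<lambda>n. sqrt (\<integral>t. (norm (Z (real n) (u t)))\<^sup>2 \<partial>time_measure T)) \<longlonglongrightarrow> sqrt 0"
    by (intro tendsto_intros) simp
  then show ?thesis by (simp add: L2_norm_def)
qed

section \<open>Continuous representatives and the energy identity\<close>

context
  fixes u W P :: "real \<Rightarrow> 'v"
  assumes u: "u \<in> L2_space T" and W: "W \<in> L2_space T" and P: "primitive_on T P W"
    and Pu: "AE t in time_measure T. P t = K (u t)"
begin

text \<open>After the product rule, \<open>P\<close> is replaced by \<open>K u\<close>; then j (D W)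
  . j (D (K u)) = K (D W) . E u = E W . E u, which uses the two relations between \<open>D\<close>,
  \<open>K\<close> and \<open>E\<close>. A general \<open>D\<close> is allowed so that differences
  of two regularisations are covered as well.\<close>

lemma regularised_energy:
  assumes D: "bounded_linear D" and DK: "\<And>x. D (K x) = E x" and KD: "\<And>x. K (D x) = E x"
    and st: "0 \<le> s" "s \<le> t" "t \<le> T"
  shows "(norm (j (D (P t))))\<^sup>2 - (norm (j (D (P s))))\<^sup>2 =
    (\<integral>r. indicator {s<..t} r *\<^sub>R (2 * (E (W r) \<bullet> E (u r))) \<partial>time_measure T)"
proof -
  let ?M = "time_measure T"
  have prim: "primitive_on T (\<lambda>t. j (D (P t)) \<bullet> j (D (P t)))
      (\<lambda>r. j (D (W r)) \<bullet> j (D (P r)) + j (D (P r)) \<bullet> j (D (W r)))"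
    by (rule primitive_on_product[OF bilinear_j[OF D D] P P])
  have E: "bounded_linear E" using bounded_linear_compose[OF D bounded_linear_K] DK by simp
  have [measurable]: "(\<lambda>r. E (W r)) \<in> borel_measurable ?M" "(\<lambda>r. E (u r)) \<in> borel_measurable ?M"
    "(indicator {s<..t} :: real \<Rightarrow> real) \<in> borel_measurable ?M"
    using measurable_bounded_linear[OF E L2_spaceD(1)[OF W]]
      measurable_bounded_linear[OF E L2_spaceD(1)[OF u]]
    by (auto intro: time_measurable_borel)
  have "(norm (j (D (P t))))\<^sup>2 - (norm (j (D (P s))))\<^sup>2 =
      (\<integral>r. indicator {s<..t} r *\<^sub>R (j (D (W r)) \<bullet> j (D (P r)) + j (D (P r)) \<bullet> j (D (W r))) \<partial>?M)"
    unfolding power2_norm_eq_inner by (rule primitive_onD(2)[OF prim st])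
  also have "\<dots> = (\<integral>r. indicator {s<..t} r *\<^sub>R (2 * (E (W r) \<bullet> E (u r))) \<partial>?M)"
  proof (rule integral_cong_AE)
    have "integrable ?M (\<lambda>r. indicator {s<..t} r *\<^sub>R (j (D (W r)) \<bullet> j (D (P r)) + j (D (P r)) \<bullet> j (D (W r))))"
      by (rule time_integrable_indicator[OF primitive_onD(1)[OF prim]]) simp
    then show "(\<lambda>r. indicator {s<..t} r *\<^sub>R (j (D (W r)) \<bullet> j (D (P r)) + j (D (P r)) \<bullet> j (D (W r))))
        \<in> borel_measurable ?M" by simp
    show "(\<lambda>r. indicator {s<..t} r *\<^sub>R (2 * (E (W r) \<bullet> E (u r)))) \<in> borel_measurable ?M" by measurable
    show "AE r in ?M. indicator {s<..t} r *\<^sub>R (j (D (W r)) \<bullet> j (D (P r)) + j (D (P r)) \<bullet> j (D (W r)))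
        = indicator {s<..t} r *\<^sub>R (2 * (E (W r) \<bullet> E (u r)))"
      using Pu
    proof eventually_elim
      case (elim r)
      have "j (D (W r)) \<bullet> j (D (P r)) = E (W r) \<bullet> E (u r)"
        unfolding elim DK by (simp add: K[symmetric] KD)
      then show ?case by (simp add: inner_commute)
    qed
  qed
  finally show ?thesis .
qed

text \<open>Built from \<open>P\<close> and not from \<open>u\<close>, so that it is continuous and
  has a value at every time; almost everywhere it is \<open>j (u t - Z n (u t))\<close>.\<close>

definition approx :: "nat \<Rightarrow> real \<Rightarrow> 'h"
  where "approx n t = j (real n *\<^sub>R Z (real n) (P t))"

lemma bounded_linear_nZ: "bounded_linear (\<lambda>x. real n *\<^sub>R Z (real n) x)"
  by (rule bounded_linear_compose[OF bounded_linear_scaleR_right bounded_linear_Z]) simp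

lemma approx_AE: "AE t in time_measure T. \<forall>n. approx n t = j (u t - Z (real n) (u t))"
  using Pu by eventually_elim (simp add: approx_def ZK)

lemma approx_continuous: "continuous_on {0..T} (approx n)"
  unfolding approx_def
  by (rule bounded_linear.continuous_on[OF bounded_linear_compose[OF j bounded_linear_nZ]
        primitive_on_continuous[OF P]])

lemma approx_energy:
  assumes st: "0 \<le> s" "s \<le> t" "t \<le> T"
  shows "(norm (approx n t))\<^sup>2 - (norm (approx n s))\<^sup>2 = (\<integral>r. indicator {s<..t} r *\<^sub>R
      (2 * ((W r - Z (real n) (W r)) \<bullet> (u r - Z (real n) (u r)))) \<partial>time_measure T)"
  unfolding approx_def
  by (rule regularised_energy[OF bounded_linear_nZ _ _ st])
     (simp_all add: ZK KZ linear_scale[OF bounded_linear.linear[OF bounded_linear_K]])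

text \<open>In the difference of two regularisations the identity parts cancel and
  \<open>Z m - Z n\<close> remains, which is small in L2. This makes the approximations uniformly
  Cauchy.\<close>

lemma approx_diff_energy:
  assumes st: "0 \<le> s" "s \<le> t" "t \<le> T"
  shows "(norm (approx n t - approx m t))\<^sup>2 - (norm (approx n s - approx m s))\<^sup>2 =
    (\<integral>r. indicator {s<..t} r *\<^sub>R (2 * ((Z (real m) (W r) - Z (real n) (W r)) \<bullet>
        (Z (real m) (u r) - Z (real n) (u r)))) \<partial>time_measure T)"
proof -
  let ?D = "\<lambda>x. real n *\<^sub>R Z (real n) x - real m *\<^sub>R Z (real m) x"
  note lin = linear_scale[OF bounded_linear.linear[OF bounded_linear_K]]
    linear_diff[OF bounded_linear.linear[OF bounded_linear_K]]
  have "approx n t - approx m t = j (?D (P t))" for t by (simp add: approx_def j_simps)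
  then show ?thesis
    using regularised_energy[OF bounded_linear_sub[OF bounded_linear_nZ bounded_linear_nZ] _ _ st,
        of n m "\<lambda>x. Z (real m) x - Z (real n) x"]
    by (simp add: ZK KZ lin)
qed

lemma approx_diff_L2:
  shows "(\<integral>s. (norm (approx n s - approx m s))\<^sup>2 \<partial>time_measure T) \<le>
      Cj\<^sup>2 * (L2_norm T (\<lambda>r. Z (real m) (u r) - Z (real n) (u r)))\<^sup>2"
    and "integrable (time_measure T) (\<lambda>s. (norm (approx n s - approx m s))\<^sup>2)"
proof -
  let ?M = "time_measure T"
  let ?v = "\<lambda>r. Z (real m) (u r) - Z (real n) (u r)"
  have v: "?v \<in> L2_space T"
    using subspace_diff[OF subspace_L2_space Z_L2[OF u] Z_L2[OF u], of m n] by (simp add: fun_diff_def)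
  note jv = L2_space_bounded_linear[OF j v Cj]
  have [measurable]: "approx n \<in> borel_measurable ?M" for n
    by (rule time_measurable_continuous[OF approx_continuous])
  have ae: "AE s in ?M. (norm (approx n s - approx m s))\<^sup>2 = (norm (j (?v s)))\<^sup>2"
    using approx_AE by eventually_elim (simp add: j_simps)
  show "integrable ?M (\<lambda>s. (norm (approx n s - approx m s))\<^sup>2)"
    by (rule integrable_cong_AE_imp[OF L2_spaceD(2)[OF jv(1)]]) (use ae in auto)
  have "(\<integral>s. (norm (approx n s - approx m s))\<^sup>2 \<partial>?M) = (L2_norm T (\<lambda>s. j (?v s)))\<^sup>2"
    unfolding L2_norm_square
    by (rule integral_cong_AE) (use ae L2_spaceD(2)[OF jv(1)] in auto)
  also have "\<dots> \<le> (Cj * L2_norm T ?v)\<^sup>2" by (intro power_mono jv) simp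
  finally show "(\<integral>s. (norm (approx n s - approx m s))\<^sup>2 \<partial>?M) \<le> Cj\<^sup>2 * (L2_norm T ?v)\<^sup>2"
    by (simp add: power_mult_distrib)
qed

lemma indicator_inner_bound:
  fixes f g :: "real \<Rightarrow> 'v"
  assumes f: "f \<in> L2_space T" and g: "g \<in> L2_space T"
  shows "\<bar>\<integral>r. indicator {s<..t} r *\<^sub>R (2 * (f r \<bullet> g r)) \<partial>time_measure T\<bar> \<le> 2 * L2_norm T f * L2_norm T g"
proof -
  have [measurable]: "f \<in> borel_measurable (time_measure T)" "g \<in> borel_measurable (time_measure T)"
    "(indicator {s<..t} :: real \<Rightarrow> real) \<in> borel_measurable (time_measure T)"
    using L2_spaceD f g by (auto intro: time_measurable_borel)
  have "AE r in time_measure T. \<bar>indicator {s<..t} r *\<^sub>R (2 * (f r \<bullet> g r))\<bar> \<le> 2 * norm (f r) * norm (g r)"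
    using Cauchy_Schwarz_ineq2[of "f _" "g _"]
    by (auto simp: indicator_def abs_mult mult.assoc)
  from L2_bounded_form(2)[OF f g _ this] show ?thesis by simp
qed

text \<open>No time is known at which \<open>F\<close> is small, only its integral. Averaging the
  inequality F t \<le> F s + e over s gives a bound at every t, end times included.\<close>

lemma averaged_bound:
  fixes F :: "real \<Rightarrow> real"
  assumes F: "integrable (time_measure T) F" and t: "t \<in> {0..T}"
    and inc: "\<And>s t. 0 \<le> s \<Longrightarrow> s \<le> t \<Longrightarrow> t \<le> T \<Longrightarrow> \<bar>F t - F s\<bar> \<le> e"
  shows "T * F t \<le> (\<integral>s. F s \<partial>time_measure T) + T * e"
proof -
  interpret finite_measure "time_measure T" by (rule finite_time_measure)
  have m: "measure (time_measure T) {0<..<T} = T" using T by (simp add: measure_restrict_space)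
  have "T * F t = (\<integral>s. F t \<partial>time_measure T)" by (simp add: m)
  also have "\<dots> \<le> (\<integral>s. F s + e \<partial>time_measure T)"
  proof (rule integral_mono)
    fix s assume "s \<in> space (time_measure T)"
    then have "\<bar>F t - F s\<bar> \<le> e" using inc[of s t] inc[of t s] t by (cases "s \<le> t") auto
    then show "F t \<le> F s + e" by simp
  qed (use F in auto)
  also have "\<dots> = (\<integral>s. F s \<partial>time_measure T) + T * e" using F by (simp add: m)
  finally show ?thesis .
qed

lemma approx_uniform:
  obtains e where "e \<longlonglongrightarrow> 0"
    "\<And>n m t. t \<in> {0..T} \<Longrightarrow> (norm (approx n t - approx m t))\<^sup>2 \<le> (e n + e m)\<^sup>2"
proof -
  define \<delta> where "\<delta> n = L2_norm T (\<lambda>t. Z (real n) (u t)) + L2_norm T (\<lambda>t. Z (real n) (W t))" for n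
  \<comment> \<open>The first summand comes from the mean over the interval, the second from the
    increments.\<close>
  define C where "C = Cj\<^sup>2 + 2 * T"
  have C: "0 \<le> C" unfolding C_def using T by simp
  have \<delta>: "\<delta> \<longlonglongrightarrow> 0"
    unfolding \<delta>_def using tendsto_add[OF Z_L2_tendsto_0[OF u] Z_L2_tendsto_0[OF W]] by simp
  have diff: "(\<lambda>r. Z (real m) (v r) - Z (real n) (v r)) \<in> L2_space T"
    "L2_norm T (\<lambda>r. Z (real m) (v r) - Z (real n) (v r)) \<le>
      L2_norm T (\<lambda>r. Z (real n) (v r)) + L2_norm T (\<lambda>r. Z (real m) (v r))"
    if v: "v \<in> L2_space T" for v m n
  proof -
    show "(\<lambda>r. Z (real m) (v r) - Z (real n) (v r)) \<in> L2_space T"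
      using subspace_diff[OF subspace_L2_space Z_L2[OF v] Z_L2[OF v], of m n] by (simp add: fun_diff_def)
    have "L2_norm T ((\<lambda>r. Z (real m) (v r)) + (-1) *\<^sub>R (\<lambda>r. Z (real n) (v r))) \<le>
        L2_norm T (\<lambda>r. Z (real m) (v r)) + L2_norm T ((-1) *\<^sub>R (\<lambda>r. Z (real n) (v r)))"
      by (intro L2_norm_triangle L2_space_scale Z_L2 v)
    then show "L2_norm T (\<lambda>r. Z (real m) (v r) - Z (real n) (v r)) \<le>
      L2_norm T (\<lambda>r. Z (real n) (v r)) + L2_norm T (\<lambda>r. Z (real m) (v r))"
      unfolding L2_norm_scale by (simp add: plus_fun_def scaleR_fun_def)
  qed
  have main: "T * (norm (approx n t - approx m t))\<^sup>2 \<le> C * (\<delta> n + \<delta> m)\<^sup>2" if t: "t \<in> {0..T}" for n m t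
  proof -
    let ?a = "L2_norm T (\<lambda>r. Z (real m) (u r) - Z (real n) (u r))"
    let ?b = "L2_norm T (\<lambda>r. Z (real m) (W r) - Z (real n) (W r))"
    have a: "?a \<le> \<delta> n + \<delta> m" and b: "?b \<le> \<delta> n + \<delta> m"
      using diff(2)[OF u, of m n] diff(2)[OF W, of m n] unfolding \<delta>_def
      by (smt (verit) L2_norm_nonneg)+
    have "T * (norm (approx n t - approx m t))\<^sup>2 \<le>
        (\<integral>s. (norm (approx n s - approx m s))\<^sup>2 \<partial>time_measure T) + T * (2 * ?b * ?a)"
      by (rule averaged_bound[OF approx_diff_L2(2) t])
         (simp only: approx_diff_energy indicator_inner_bound[OF diff(1)[OF W] diff(1)[OF u]])
    also have "\<dots> \<le> Cj\<^sup>2 * ?a\<^sup>2 + T * (2 * ?b * ?a)" by (intro add_right_mono approx_diff_L2)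
    also have "\<dots> \<le> Cj\<^sup>2 * (\<delta> n + \<delta> m)\<^sup>2 + T * (2 * (\<delta> n + \<delta> m) * (\<delta> n + \<delta> m))"
      using T a b order_trans[OF L2_norm_nonneg a]
      by (intro add_mono mult_left_mono mult_mono power_mono) auto
    also have "\<dots> = C * (\<delta> n + \<delta> m)\<^sup>2" by (simp add: C_def power2_eq_square algebra_simps)
    finally show ?thesis .
  qed
  show ?thesis
  proof (rule that[of "\<lambda>n. sqrt (C / T) * \<delta> n"])
    show "(\<lambda>n. sqrt (C / T) * \<delta> n) \<longlonglongrightarrow> 0" using tendsto_mult_left[OF \<delta>, of "sqrt (C / T)"] by simp
    fix n m t assume "t \<in> {0..T}"
    from main[OF this, of n m] have "(norm (approx n t - approx m t))\<^sup>2 \<le> C / T * (\<delta> n + \<delta> m)\<^sup>2"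
      using T by (simp add: field_simps)
    also have "\<dots> = (sqrt (C / T) * \<delta> n + sqrt (C / T) * \<delta> m)\<^sup>2"
      using C T by (simp add: distrib_left[symmetric] power_mult_distrib)
    finally show "(norm (approx n t - approx m t))\<^sup>2 \<le> (sqrt (C / T) * \<delta> n + sqrt (C / T) * \<delta> m)\<^sup>2" .
  qed
qed

text \<open>By \<open>approx_uniform\<close> the regularisations converge uniformly, so the limit is
  continuous; the energy identity passes to the limit by dominated convergence. The last clause
  applies \<open>averaged_bound\<close> to the squared norm and becomes the trace estimate.\<close>

theorem continuous_representative:
  obtains c where "continuous_on {0..T} c" "AE t in time_measure T. c t = j (u t)"
    "\<And>s t. 0 \<le> s \<Longrightarrow> s \<le> t \<Longrightarrow> t \<le> T \<Longrightarrow> (norm (c t))\<^sup>2 - (norm (c s))\<^sup>2 =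
       (\<integral>r. indicator {s<..t} r *\<^sub>R (2 * (W r \<bullet> u r)) \<partial>time_measure T)"
    "\<And>t. t \<in> {0..T} \<Longrightarrow> T * (norm (c t))\<^sup>2 \<le> Cj\<^sup>2 * (L2_norm T u)\<^sup>2 + T * (2 * L2_norm T W * L2_norm T u)"
proof -
  let ?M = "time_measure T"
  obtain e where e: "e \<longlonglongrightarrow> 0"
    "\<And>n m t. t \<in> {0..T} \<Longrightarrow> (norm (approx n t - approx m t))\<^sup>2 \<le> (e n + e m)\<^sup>2"
    using approx_uniform by blast
  have "uniformly_Cauchy_on {0..T} approx"
    unfolding uniformly_Cauchy_on_def
  proof (intro allI impI)
    fix \<epsilon> :: real assume "0 < \<epsilon>"
    then have "\<forall>\<^sub>F n in sequentially. norm (e n) < \<epsilon> / 2"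
      using tendstoD[OF e(1), of "\<epsilon> / 2"] by (simp add: dist_norm)
    then obtain M where M: "\<And>n. n \<ge> M \<Longrightarrow> norm (e n) < \<epsilon> / 2" by (auto simp: eventually_sequentially)
    have "dist (approx m t) (approx n t) < \<epsilon>" if "t \<in> {0..T}" "m \<ge> M" "n \<ge> M" for t m n
    proof -
      have "norm (approx m t - approx n t) \<le> \<bar>e m + e n\<bar>"
        using e(2)[OF that(1), of m n] by (simp add: abs_le_square_iff[symmetric])
      also have "\<dots> < \<epsilon>" using M[OF that(2)] M[OF that(3)] by simp
      finally show ?thesis by (simp add: dist_norm)
    qed
    then show "\<exists>M. \<forall>x\<in>{0..T}. \<forall>m\<ge>M. \<forall>n\<ge>M. dist (approx m x) (approx n x) < \<epsilon>" by blast
  qed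
  then obtain c where c: "uniform_limit {0..T} approx c sequentially"
    using Cauchy_uniformly_convergent uniformly_convergent_on_def by blast
  have lim: "(\<lambda>n. approx n t) \<longlonglongrightarrow> c t" if "t \<in> {0..T}" for t
    by (rule tendsto_uniform_limitI[OF c that])
  have cont: "continuous_on {0..T} c"
    by (rule uniform_limit_theorem[OF _ c]) (auto simp: approx_continuous)
  have ae: "AE t in ?M. c t = j (u t)"
    using approx_AE AE_space
  proof eventually_elim
    case (elim t)
    have "(\<lambda>n. j (u t - Z (real n) (u t))) \<longlonglongrightarrow> j (u t - 0)"
      by (intro bounded_linear.tendsto[OF j] tendsto_intros Z_tendsto_0)
    then have "(\<lambda>n. approx n t) \<longlonglongrightarrow> j (u t)" using elim by simp
    moreover have "(\<lambda>n. approx n t) \<longlonglongrightarrow> c t" using elim by (intro lim) auto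
    ultimately show ?case using LIMSEQ_unique by blast
  qed
  have energy: "(norm (c t))\<^sup>2 - (norm (c s))\<^sup>2 = (\<integral>r. indicator {s<..t} r *\<^sub>R (2 * (W r \<bullet> u r)) \<partial>?M)"
    if st: "0 \<le> s" "s \<le> t" "t \<le> T" for s t
  proof -
    have [measurable]: "u \<in> borel_measurable ?M" "W \<in> borel_measurable ?M"
      "\<And>n. (\<lambda>r. Z (real n) (u r)) \<in> borel_measurable ?M" "\<And>n. (\<lambda>r. Z (real n) (W r)) \<in> borel_measurable ?M"
      "(indicator {s<..t} :: real \<Rightarrow> real) \<in> borel_measurable ?M"
      using u W Z_L2 L2_spaceD by (auto intro: time_measurable_borel)
    let ?f = "\<lambda>n r. indicator {s<..t} r *\<^sub>R
        (2 * ((W r - Z (real n) (W r)) \<bullet> (u r - Z (real n) (u r))))"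
    let ?g = "\<lambda>r. indicator {s<..t} r *\<^sub>R (2 * (W r \<bullet> u r))"
    have "(\<lambda>n. \<integral>r. ?f n r \<partial>?M) \<longlonglongrightarrow> (\<integral>r. ?g r \<partial>?M)"
    proof (rule integral_dominated_convergence[where w="\<lambda>r. 8 * (norm (W r) * norm (u r))"])
      show "AE r in ?M. (\<lambda>n. ?f n r) \<longlonglongrightarrow> ?g r"
      proof (rule AE_I2)
        fix r
        have "(\<lambda>n. ?f n r) \<longlonglongrightarrow> indicator {s<..t} r *\<^sub>R (2 * ((W r - 0) \<bullet> (u r - 0)))"
          by (intro tendsto_intros Z_tendsto_0)
        then show "(\<lambda>n. ?f n r) \<longlonglongrightarrow> ?g r" by simp
      qed
      \<comment> \<open>The 8 is the factor 2 of the identity times 2 for each factor, since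
        \<open>norm (x - Z n x)\<close> is at most twice \<open>norm x\<close>.\<close>
      show "AE r in ?M. norm (?f n r) \<le> 8 * (norm (W r) * norm (u r))" for n
      proof (rule AE_I2)
        fix r
        have 2: "norm (x - Z (real n) x) \<le> 2 * norm x" for x
          using norm_triangle_ineq4[of x "Z (real n) x"] norm_Z_le[of "real n" x] by simp
        have "\<bar>(W r - Z (real n) (W r)) \<bullet> (u r - Z (real n) (u r))\<bar> \<le>
            norm (W r - Z (real n) (W r)) * norm (u r - Z (real n) (u r))" by (rule Cauchy_Schwarz_ineq2)
        also have "\<dots> \<le> (2 * norm (W r)) * (2 * norm (u r))" by (intro mult_mono 2) auto
        finally show "norm (?f n r) \<le> 8 * (norm (W r) * norm (u r))"
          by (simp add: indicator_def abs_mult)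
      qed
      show "integrable ?M (\<lambda>r. 8 * (norm (W r) * norm (u r)))" using L2_norm_mult(1)[OF W u] by simp
    qed measurable
    moreover have "(\<lambda>n. (norm (approx n t))\<^sup>2 - (norm (approx n s))\<^sup>2) \<longlonglongrightarrow> (norm (c t))\<^sup>2 - (norm (c s))\<^sup>2"
      using st by (intro tendsto_intros lim) auto
    ultimately show ?thesis unfolding approx_energy[OF st] using LIMSEQ_unique by blast
  qed
  have bound: "T * (norm (c t))\<^sup>2 \<le> Cj\<^sup>2 * (L2_norm T u)\<^sup>2 + T * (2 * L2_norm T W * L2_norm T u)"
    if t: "t \<in> {0..T}" for t
  proof -
    note ju = L2_space_bounded_linear[OF j u Cj]
    have [measurable]: "c \<in> borel_measurable ?M" by (rule time_measurable_continuous[OF cont])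
    have sq: "AE t in ?M. (norm (c t))\<^sup>2 = (norm (j (u t)))\<^sup>2" using ae by eventually_elim simp
    have i: "integrable ?M (\<lambda>t. (norm (c t))\<^sup>2)"
      by (rule integrable_cong_AE_imp[OF L2_spaceD(2)[OF ju(1)]]) (use sq in auto)
    have "T * (norm (c t))\<^sup>2 \<le> (\<integral>s. (norm (c s))\<^sup>2 \<partial>?M) + T * (2 * L2_norm T W * L2_norm T u)"
      by (rule averaged_bound[OF i t]) (simp only: energy indicator_inner_bound[OF W u])
    also have "(\<integral>s. (norm (c s))\<^sup>2 \<partial>?M) = (L2_norm T (\<lambda>s. j (u s)))\<^sup>2"
      unfolding L2_norm_square
      by (rule integral_cong_AE) (use sq L2_spaceD(2)[OF ju(1)] in auto)
    also have "\<dots> \<le> (Cj * L2_norm T u)\<^sup>2" by (intro power_mono ju) simp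
    finally show ?thesis by (simp add: power_mult_distrib)
  qed
  show ?thesis using that[OF cont ae energy bound] by blast
qed

end

end

section \<open>The space \<open>X\<close>\<close>

definition L2_ip :: "real \<Rightarrow> (real \<Rightarrow> 'b::real_inner) \<Rightarrow> (real \<Rightarrow> 'b) \<Rightarrow> real"
  where "L2_ip T u v = (\<integral>t. u t \<bullet> v t \<partial>time_measure T)"

lemma bilinear_L2_ip:
  "bilinear_form_on (L2_space T) (L2_space T)
     (L2_ip T :: (real \<Rightarrow> 'b::{real_inner,second_countable_topology}) \<Rightarrow> _)"
  by (auto simp: bilinear_form_on_def linear_form_on_def L2_ip_def plus_fun_def scaleR_fun_def
      inner_add_left inner_add_right L2_inner(1))

lemma L2_ip_bound:
  "u \<in> L2_space T \<Longrightarrow> v \<in> L2_space T \<Longrightarrow> \<bar>L2_ip T u v\<bar> \<le> L2_norm T u * L2_norm T v"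
  for u v :: "real \<Rightarrow> 'b::{real_inner,second_countable_topology}"
  unfolding L2_ip_def by (rule L2_inner(2))

lemma L2_ip_self: "L2_ip T u u = (L2_norm T u)\<^sup>2"
  by (simp add: L2_ip_def L2_norm_eq_inner)

lemma L2_ip_cong:
  fixes u v u' v' :: "real \<Rightarrow> 'b::{real_inner,second_countable_topology}"
  assumes "u \<in> L2_space T" "u' \<in> L2_space T" "v \<in> L2_space T" "v' \<in> L2_space T"
    "AE t in time_measure T. u t = u' t" "AE t in time_measure T. v t = v' t"
  shows "L2_ip T u v = L2_ip T u' v'"
  unfolding L2_ip_def
proof (rule integral_cong_AE)
  show "AE t in time_measure T. u t \<bullet> v t = u' t \<bullet> v' t"
    using assms(5,6) by eventually_elim simp
qed (use assms L2_inner(1) in auto)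

lemma L2_ip_tendsto:
  fixes u g :: "real \<Rightarrow> 'b::{real_inner,second_countable_topology}"
  assumes s: "\<And>n. s n \<in> L2_space T" and u: "u \<in> L2_space T" and g: "g \<in> L2_space T"
    and lim: "(\<lambda>n. L2_norm T (s n - u)) \<longlonglongrightarrow> 0"
  shows "(\<lambda>n. L2_ip T (s n) g) \<longlonglongrightarrow> L2_ip T u g"
proof -
  have "(\<lambda>n. L2_ip T (s n) g - L2_ip T u g) \<longlonglongrightarrow> 0"
  proof (rule Lim_null_comparison)
    have "norm (L2_ip T (s n) g - L2_ip T u g) \<le> L2_norm T (s n - u) * L2_norm T g" for n
    proof -
      have "L2_ip T (s n - u) g = L2_ip T (s n) g - L2_ip T u g"
        by (rule linear_form_on_diff[OF bilinear_form_onD(2)[OF bilinear_L2_ip g] subspace_L2_space s u])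
      then show ?thesis
        using L2_ip_bound[OF subspace_diff[OF subspace_L2_space s u] g, of n] by simp
    qed
    then show "\<forall>\<^sub>F n in sequentially. norm (L2_ip T (s n) g - L2_ip T u g) \<le> L2_norm T (s n - u) * L2_norm T g"
      by simp
    show "(\<lambda>n. L2_norm T (s n - u) * L2_norm T g) \<longlonglongrightarrow> 0"
      using tendsto_mult_right[OF lim, of "L2_norm T g"] by simp
  qed
  then show ?thesis by (rule LIM_zero_cancel)
qed

lemma smooth_scaleR_L2:
  assumes "smooth \<phi>"
  shows "(\<lambda>t. \<phi> t *\<^sub>R z) \<in> L2_space T"
proof -
  interpret finite_measure "time_measure T" by (rule finite_time_measure)
  have "smooth (\<lambda>t. \<phi> t * \<phi> t)" by (intro smooth_mult assms)
  from smooth_integrable[OF this, of T]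
  have "integrable (time_measure T) (\<lambda>t. (\<phi> t * \<phi> t) * (norm z)\<^sup>2)" by simp
  moreover have "(norm (\<phi> t *\<^sub>R z))\<^sup>2 = (\<phi> t * \<phi> t) * (norm z)\<^sup>2" for t
    by (simp add: power_mult_distrib power2_eq_square)
  moreover have "(\<lambda>t. \<phi> t *\<^sub>R z) \<in> borel_measurable (time_measure T)"
    by (rule time_measurable_continuous) (intro continuous_intros smooth_continuous assms)
  ultimately show ?thesis by (simp add: L2_space_def)
qed

lemma test_function_endpoints:
  assumes "test_function T \<phi>"
  shows "\<phi> 0 = 0" "\<phi> T = 0"
proof -
  obtain S where "S \<subseteq> {0<..<T}" "\<And>t. t \<notin> S \<Longrightarrow> \<phi> t = 0"
    using assms by (auto simp: test_function_def)
  then show "\<phi> 0 = 0" "\<phi> T = 0" by (metis greaterThanLessThan_iff less_irrefl subsetD)+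
qed

text \<open>The interior points of disagreement form an open null set, hence none exist; the end
  points, invisible to the measure, follow by continuity.\<close>

lemma continuous_AE_eq:
  fixes c d :: "real \<Rightarrow> 'b::real_normed_vector"
  assumes T: "0 < T" and c: "continuous_on {0..T} c" and d: "continuous_on {0..T} d"
    and ae: "AE t in time_measure T. c t = d t" and t: "t \<in> {0..T}"
  shows "c t = d t"
proof -
  let ?N = "{t \<in> {0<..<T}. c t - d t \<noteq> 0}"
  have cd: "continuous_on {0..T} (\<lambda>t. c t - d t)" by (intro continuous_intros c d)
  have "AE t in lebesgue. t \<in> {0<..<T} \<longrightarrow> c t = d t"
    using ae by (subst (asm) AE_restrict_space_iff) auto
  then have "negligible ?N"
    unfolding negligible_iff_null_sets by (subst (asm) completion.AE_iff_null_sets) (auto elim: null_sets_subset)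
  moreover have "open ?N"
  proof -
    have "continuous_on {0<..<T} (\<lambda>t. c t - d t)" by (rule continuous_on_subset[OF cd]) auto
    then have "open ({0<..<T} \<inter> (\<lambda>t. c t - d t) -` (- {0}))"
      by (rule continuous_open_preimage) (auto simp: open_Compl)
    moreover have "{0<..<T} \<inter> (\<lambda>t. c t - d t) -` (- {0}) = ?N" by auto
    ultimately show ?thesis by simp
  qed
  ultimately have "?N = {}" using open_not_negligible by blast
  then have z: "c t - d t = 0" if "t \<in> {0<..<T}" for t using that by auto
  have "c t - d t = 0"
    by (rule continuous_constant_on_closure[of "{0<..<T}" "\<lambda>t. c t - d t"])
       (use T cd z t in \<open>auto simp: closure_greaterThanLessThan\<close>)
  then show ?thesis by simp
qed

context gelfand
begin

abbreviation Y :: "(real \<Rightarrow> 'v) set" where "Y \<equiv> L2_space T"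
abbreviation NY :: "(real \<Rightarrow> 'v) \<Rightarrow> real" where "NY \<equiv> L2_norm T"
abbreviation "X \<equiv> X_space T j"
abbreviation "NX \<equiv> X_norm T j"
abbreviation ip :: "(real \<Rightarrow> 'v) \<Rightarrow> (real \<Rightarrow> 'v) \<Rightarrow> real" where "ip \<equiv> L2_ip T"
abbreviation "tr t u \<equiv> time_trace T j t u"

text \<open>The weak derivative, transported from \<open>V'\<close> to \<open>V\<close> by the Riesz isometry.\<close>

definition wd :: "(real \<Rightarrow> 'v) \<Rightarrow> (real \<Rightarrow> 'v) \<Rightarrow> bool"
  where "wd u W \<longleftrightarrow> W \<in> L2_space T \<and> (\<forall>\<phi> z. test_function T \<phi> \<longrightarrow>
    ip u (\<lambda>t. deriv \<phi> t *\<^sub>R K z) = - ip W (\<lambda>t. \<phi> t *\<^sub>R z))"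

text \<open>\<open>time_deriv\<close> picks one of many representatives, so \<open>dt\<close> is
  additive and homogeneous only almost everywhere.\<close>

definition dt :: "(real \<Rightarrow> 'v) \<Rightarrow> real \<Rightarrow> 'v"
  where "dt u = (\<lambda>t. riesz_rep (time_deriv T j u t))"

lemma weak_derivative_iff: "weak_derivative T j u w \<longleftrightarrow> wd u (\<lambda>t. riesz_rep (w t))"
  unfolding weak_derivative_def wd_def L2_space_riesz_rep[symmetric] L2_ip_def
  by (simp add: riesz_rep_inner inner_commute[of _ "K _"] K inner_commute[of "j _" "j _"])

lemma wd_weak_derivative: "wd u W \<Longrightarrow> weak_derivative T j u (\<lambda>t. blinfun_inner_right (W t))"
  by (simp add: weak_derivative_iff riesz_rep_blinfun_inner)

lemma X_iff: "u \<in> X \<longleftrightarrow> u \<in> Y \<and> (\<exists>W. wd u W)"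
  unfolding X_space_def using wd_weak_derivative weak_derivative_iff by blast

lemma X_Y: "u \<in> X \<Longrightarrow> u \<in> Y"
  by (simp add: X_iff)

lemma XI: "u \<in> Y \<Longrightarrow> wd u W \<Longrightarrow> u \<in> X"
  by (auto simp: X_iff)

lemma wd_dt:
  assumes "u \<in> X"
  shows "wd u (dt u)"
proof -
  obtain w where "weak_derivative T j u w" using assms by (auto simp: X_space_def)
  then have "weak_derivative T j u (time_deriv T j u)"
    unfolding time_deriv_def by (rule someI[of "weak_derivative T j u"])
  then show ?thesis by (simp add: weak_derivative_iff dt_def)
qed

lemma wd_L2: "wd u W \<Longrightarrow> W \<in> Y"
  by (simp add: wd_def)

lemma dt_L2: "u \<in> X \<Longrightarrow> dt u \<in> Y"
  using wd_dt wd_L2 by blast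

lemma wdD: "wd u W \<Longrightarrow> test_function T \<phi> \<Longrightarrow> ip u (\<lambda>t. deriv \<phi> t *\<^sub>R K z) = - ip W (\<lambda>t. \<phi> t *\<^sub>R z)"
  by (simp add: wd_def)

lemma test_L2:
  assumes "test_function T \<phi>"
  shows "(\<lambda>t. \<phi> t *\<^sub>R z) \<in> L2_space T" "(\<lambda>t. deriv \<phi> t *\<^sub>R z) \<in> L2_space T"
  by (rule smooth_scaleR_L2[OF test_function_smooth[OF assms]],
      rule smooth_scaleR_L2[OF smooth_deriv[OF test_function_smooth[OF assms]]])

lemma ip_add: "u \<in> Y \<Longrightarrow> v \<in> Y \<Longrightarrow> w \<in> Y \<Longrightarrow> ip (u + v) w = ip u w + ip v w"
  for u v w :: "real \<Rightarrow> 'v"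
  by (rule linear_form_onD(1)[OF bilinear_form_onD(2)[OF bilinear_L2_ip]])

lemma ip_scale: "u \<in> Y \<Longrightarrow> w \<in> Y \<Longrightarrow> ip (c *\<^sub>R u) w = c * ip u w"
  for u w :: "real \<Rightarrow> 'v"
  by (rule linear_form_onD(2)[OF bilinear_form_onD(2)[OF bilinear_L2_ip]])

lemma ip_diff: "u \<in> Y \<Longrightarrow> v \<in> Y \<Longrightarrow> w \<in> Y \<Longrightarrow> ip (u - v) w = ip u w - ip v w"
  for u v w :: "real \<Rightarrow> 'v"
  by (rule linear_form_on_diff[OF bilinear_form_onD(2)[OF bilinear_L2_ip] subspace_L2_space])

lemma ip_add_right: "u \<in> Y \<Longrightarrow> v \<in> Y \<Longrightarrow> w \<in> Y \<Longrightarrow> ip u (v + w) = ip u v + ip u w"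
  for u v w :: "real \<Rightarrow> 'v"
  by (rule linear_form_onD(1)[OF bilinear_form_onD(1)[OF bilinear_L2_ip]])

lemma wd_unique:
  assumes "wd u W" "wd u W'"
  shows "AE t in time_measure T. W t = W' t"
proof -
  note L = wd_L2[OF assms(1)] wd_L2[OF assms(2)]
  have d: "W - W' \<in> Y" by (rule subspace_diff[OF subspace_L2_space L])
  have "AE t in time_measure T. (W - W') t \<bullet> z = 0" for z
  proof (rule fundamental_lemma)
    show "integrable (time_measure T) (\<lambda>t. (W - W') t \<bullet> z)"
      by (rule integrable_inner_left[OF L2_integrable(1)[OF d T]])
    fix \<psi> assume \<psi>: "test_function T \<psi>"
    have "ip (W - W') (\<lambda>t. \<psi> t *\<^sub>R z) = 0"
      using wdD[OF assms(1) \<psi>, of z] wdD[OF assms(2) \<psi>, of z] ip_diff[OF L test_L2(1)[OF \<psi>]] by simp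
    then show "(\<integral>t. \<psi> t * ((W - W') t \<bullet> z) \<partial>time_measure T) = 0" by (simp add: L2_ip_def)
  qed
  then have "AE t in time_measure T. (W - W') t = 0" by (rule AE_zero_if_inner_zero)
  then show ?thesis by eventually_elim (simp add: fun_diff_def)
qed

lemma wd_add:
  assumes "u \<in> Y" "v \<in> Y" "wd u W" "wd v W'"
  shows "wd (u + v) (W + W')"
  unfolding wd_def
  using assms L2_space_add[OF wd_L2 wd_L2] by (auto simp: ip_add wd_L2 test_L2 wdD)

lemma wd_scale:
  assumes "u \<in> Y" "wd u W"
  shows "wd (c *\<^sub>R u) (c *\<^sub>R W)"
  unfolding wd_def
  using assms L2_space_scale[OF wd_L2] by (auto simp: ip_scale wd_L2 test_L2 wdD)

text \<open>Closedness of the weak derivative: each test identity is continuous in both arguments.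
  It reduces the completeness of X to that of Y.\<close>

lemma wd_limit:
  assumes s: "\<And>n. s n \<in> Y" and D: "\<And>n. wd (s n) (D n)" and u: "u \<in> Y" and W: "W \<in> Y"
    and su: "(\<lambda>n. NY (s n - u)) \<longlonglongrightarrow> 0" and DW: "(\<lambda>n. NY (D n - W)) \<longlonglongrightarrow> 0"
  shows "wd u W"
  unfolding wd_def
proof (intro conjI allI impI W)
  fix \<phi> z assume \<phi>: "test_function T \<phi>"
  have "(\<lambda>n. ip (s n) (\<lambda>t. deriv \<phi> t *\<^sub>R K z)) \<longlonglongrightarrow> ip u (\<lambda>t. deriv \<phi> t *\<^sub>R K z)"
    by (rule L2_ip_tendsto[OF s u test_L2(2)[OF \<phi>] su])
  moreover have "(\<lambda>n. - ip (D n) (\<lambda>t. \<phi> t *\<^sub>R z)) \<longlonglongrightarrow> - ip W (\<lambda>t. \<phi> t *\<^sub>R z)"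
    by (rule tendsto_minus[OF L2_ip_tendsto[OF wd_L2[OF D] W test_L2(1)[OF \<phi>] DW]])
  ultimately show "ip u (\<lambda>t. deriv \<phi> t *\<^sub>R K z) = - ip W (\<lambda>t. \<phi> t *\<^sub>R z)"
    unfolding wdD[OF D \<phi>] by (rule LIMSEQ_unique)
qed

lemma subspace_X: "subspace X"
proof (rule subspaceI)
  have "wd 0 0" unfolding wd_def using L2_space_zero by (auto simp: L2_ip_def zero_fun_def)
  then show "0 \<in> X" by (rule XI[OF L2_space_zero])
next
  fix u v assume "u \<in> X" "v \<in> X"
  then show "u + v \<in> X" using XI[OF L2_space_add wd_add] wd_dt X_Y by blast
next
  fix u c assume "u \<in> X"
  then show "c *\<^sub>R u \<in> X" using XI[OF L2_space_scale wd_scale] wd_dt X_Y by blast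
qed

lemma dt_unique: "u \<in> Y \<Longrightarrow> wd u W \<Longrightarrow> AE t in time_measure T. dt u t = W t"
  using wd_unique[OF wd_dt[OF XI]] by blast

lemma NX_eq: "NX u = sqrt ((NY u)\<^sup>2 + (NY (dt u))\<^sup>2)"
  by (simp add: X_norm_def dt_def L2_norm_riesz_rep)

text \<open>Any weak derivative computes the norm, whatever representative \<open>dt\<close> has
  chosen; this is how sums, multiples and limits are treated.\<close>

lemma NX_wd:
  assumes "u \<in> Y" "wd u W"
  shows "NX u = sqrt ((NY u)\<^sup>2 + (NY W)\<^sup>2)"
proof -
  have "NY (dt u) = NY W"
  proof (rule L2_norm_AE_eq)
    show "AE t in time_measure T. norm (dt u t) = norm (W t)"
      using dt_unique[OF assms] by eventually_elim simp
  qed (use dt_L2[OF XI[OF assms]] wd_L2[OF assms(2)] L2_spaceD in auto)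
  then show ?thesis by (simp add: NX_eq)
qed

lemma NY_le_NX: "NY u \<le> NX u" and NY_dt_le_NX: "NY (dt u) \<le> NX u"
  by (auto simp: NX_eq intro!: real_le_rsqrt)

lemma seminorm_X: "seminorm_on X NX"
  unfolding seminorm_on_def
proof (intro conjI ballI allI subspace_X)
  fix u assume u: "u \<in> X"
  show "0 \<le> NX u" by (simp add: NX_eq)
  fix c
  have "NX (c *\<^sub>R u) = sqrt ((NY (c *\<^sub>R u))\<^sup>2 + (NY (c *\<^sub>R dt u))\<^sup>2)"
    by (rule NX_wd[OF L2_space_scale[OF X_Y[OF u]] wd_scale[OF X_Y[OF u] wd_dt[OF u]]])
  then show "NX (c *\<^sub>R u) = \<bar>c\<bar> * NX u"
    unfolding NX_eq[of u] L2_norm_scale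
    by (simp add: power_mult_distrib distrib_left[symmetric] real_sqrt_mult)
next
  fix u v assume u: "u \<in> X" and v: "v \<in> X"
  have "NX (u + v) = sqrt ((NY (u + v))\<^sup>2 + (NY (dt u + dt v))\<^sup>2)"
    by (rule NX_wd[OF L2_space_add[OF X_Y[OF u] X_Y[OF v]]
          wd_add[OF X_Y[OF u] X_Y[OF v] wd_dt[OF u] wd_dt[OF v]]])
  also have "\<dots> \<le> sqrt ((NY u + NY v)\<^sup>2 + (NY (dt u) + NY (dt v))\<^sup>2)"
    by (intro real_sqrt_le_mono add_mono power_mono L2_norm_triangle dt_L2 u v X_Y L2_norm_nonneg)
  also have "\<dots> \<le> NX u + NX v" unfolding NX_eq by (rule real_sqrt_sum_squares_triangle_ineq)
  finally show "NX (u + v) \<le> NX u + NX v" .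
qed

lemma wd_diff:
  assumes "u \<in> Y" "v \<in> Y" "wd u W" "wd v W'"
  shows "wd (u - v) (W - W')"
  using wd_add[OF assms(1) L2_space_scale[OF assms(2)] assms(3) wd_scale[OF assms(2,4)], of "-1"] by simp

lemma complete_X: "complete_on X NX"
  unfolding complete_on_def
proof (intro allI impI, elim conjE)
  fix s :: "nat \<Rightarrow> real \<Rightarrow> 'v"
  assume s: "\<forall>n. s n \<in> X" and C: "\<forall>e>0. \<exists>M. \<forall>m\<ge>M. \<forall>n\<ge>M. NX (s m - s n) < e"
  have sY: "s n \<in> Y" and sd: "dt (s n) \<in> Y" and sw: "wd (s n) (dt (s n))" for n
    using s X_Y dt_L2 wd_dt by auto
  have eq: "NX (s m - s n) = sqrt ((NY (s m - s n))\<^sup>2 + (NY (dt (s m) - dt (s n)))\<^sup>2)" for m n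
    by (rule NX_wd[OF subspace_diff[OF subspace_L2_space sY sY] wd_diff[OF sY sY sw sw]])
  have le: "NY (s m - s n) \<le> NX (s m - s n)" "NY (dt (s m) - dt (s n)) \<le> NX (s m - s n)" for m n
    unfolding eq by (auto intro!: real_le_rsqrt)
  have "\<exists>u\<in>Y. (\<lambda>n. NY (s n - u)) \<longlonglongrightarrow> 0"
    using complete_L2[OF T, unfolded complete_on_def, rule_format, of s] C sY le_less_trans[OF le(1)]
    by meson
  then obtain u where u: "u \<in> Y" "(\<lambda>n. NY (s n - u)) \<longlonglongrightarrow> 0" by blast
  have "\<exists>W\<in>Y. (\<lambda>n. NY (dt (s n) - W)) \<longlonglongrightarrow> 0"
    using complete_L2[OF T, unfolded complete_on_def, rule_format, of "\<lambda>n. dt (s n)"] C sd le_less_trans[OF le(2)]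
    by meson
  then obtain W where W: "W \<in> Y" "(\<lambda>n. NY (dt (s n) - W)) \<longlonglongrightarrow> 0" by blast
  have uW: "wd u W" by (rule wd_limit[OF sY sw u(1) W(1) u(2) W(2)])
  have "NX (s n - u) = sqrt ((NY (s n - u))\<^sup>2 + (NY (dt (s n) - W))\<^sup>2)" for n
    by (rule NX_wd[OF subspace_diff[OF subspace_L2_space sY u(1)] wd_diff[OF sY u(1) sw uW]])
  moreover have "(\<lambda>n. sqrt ((NY (s n - u))\<^sup>2 + (NY (dt (s n) - W))\<^sup>2)) \<longlonglongrightarrow> sqrt (0\<^sup>2 + 0\<^sup>2)"
    by (intro tendsto_intros u W)
  ultimately have "(\<lambda>n. NX (s n - u)) \<longlonglongrightarrow> 0" by (simp only: power_zero_numeral add_0 real_sqrt_zero)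
  then show "\<exists>x\<in>X. (\<lambda>n. NX (s n - x)) \<longlonglongrightarrow> 0"
    using XI[OF u(1) uW] by blast
qed

section \<open>Traces and integration by parts\<close>

text \<open>The integral of \<open>W\<close> from 0 has the same weak derivative as
  \<open>K u\<close>, so by the lemma of du Bois-Reymond they differ by a constant almost
  everywhere; that constant is added to the integral.\<close>

lemma wd_primitive:
  assumes u: "u \<in> Y" and W: "wd u W"
  obtains P where "primitive_on T P W" "AE t in time_measure T. P t = K (u t)"
proof -
  let ?M = "time_measure T"
  define P\<^sub>0 where "P\<^sub>0 t = 0 + (\<integral>r. indicator {0<..t} r *\<^sub>R W r \<partial>?M)" for t
  have Wi: "integrable ?M W" by (rule L2_integrable(1)[OF wd_L2[OF W] T])
  have P\<^sub>0: "primitive_on T P\<^sub>0 W" unfolding P\<^sub>0_def by (rule primitive_on_integral[OF Wi])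
  have Ku: "integrable ?M (\<lambda>t. K (u t))"
    by (rule integrable_bounded_linear[OF bounded_linear_K L2_integrable(1)[OF u T]])
  have P\<^sub>0i: "integrable ?M P\<^sub>0"
  proof -
    interpret finite_measure ?M by (rule finite_time_measure)
    obtain C where C: "\<And>x. x \<in> P\<^sub>0 ` {0..T} \<Longrightarrow> norm x \<le> C"
      using compact_imp_bounded[OF compact_continuous_image[OF primitive_on_continuous[OF P\<^sub>0] compact_Icc]]
        bounded_iff by metis
    show ?thesis
      by (rule integrable_const_bound[of _ C])
         (use C in \<open>auto intro!: AE_I2 primitive_on_measurable[OF P\<^sub>0]\<close>)
  qed
  have i: "integrable ?M (\<lambda>t. K (u t) - P\<^sub>0 t)" using Ku P\<^sub>0i by simp
  have "\<exists>c. AE t in ?M. K (u t) - P\<^sub>0 t = c"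
  proof (rule du_Bois_Reymond[OF T i])
    fix \<phi> z assume \<phi>: "test_function T \<phi>"
    note sm = test_function_smooth[OF \<phi>]
    have B: "bounded_bilinear (\<lambda>(x::real) y::'v. x * (y \<bullet> z))"
      by (rule bounded_bilinear.comp[OF bounded_bilinear_mult bounded_linear_ident bounded_linear_inner_left])
    have p\<phi>: "primitive_on T \<phi> (deriv \<phi>)"
      by (rule primitive_on_C1[OF smooth_has_derivative[OF sm] smooth_continuous[OF smooth_deriv[OF sm]]])
    note \<phi>0 = test_function_endpoints[OF \<phi>]
    have z1: "(\<integral>t. deriv \<phi> t * (P\<^sub>0 t \<bullet> z) + \<phi> t * (W t \<bullet> z) \<partial>?M) = 0"
      using primitive_on_total[OF primitive_on_product[OF B p\<phi> P\<^sub>0] T] by (simp add: \<phi>0)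
    have i1: "integrable ?M (\<lambda>t. deriv \<phi> t * (P\<^sub>0 t \<bullet> z))" "integrable ?M (\<lambda>t. \<phi> t * (W t \<bullet> z))"
      "integrable ?M (\<lambda>t. deriv \<phi> t * (K (u t) \<bullet> z))"
      by (intro smooth_integrable_mult smooth_deriv sm integrable_inner_left P\<^sub>0i Wi Ku)+
    have z2: "(\<integral>t. deriv \<phi> t * (K (u t) \<bullet> z) \<partial>?M) = - (\<integral>t. \<phi> t * (W t \<bullet> z) \<partial>?M)"
    proof -
      \<comment> \<open>Symmetry of \<open>K\<close> moves it from the test vector to
        \<open>u\<close>.\<close>
      have "K a \<bullet> z = a \<bullet> K z" for a by (metis K inner_commute)
      then show ?thesis using wdD[OF W \<phi>, of z] by (simp add: L2_ip_def)
    qed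
    have "(\<integral>t. deriv \<phi> t * ((K (u t) - P\<^sub>0 t) \<bullet> z) \<partial>?M) =
        (\<integral>t. deriv \<phi> t * (K (u t) \<bullet> z) - deriv \<phi> t * (P\<^sub>0 t \<bullet> z) \<partial>?M)"
      by (simp add: inner_diff_left right_diff_distrib)
    also have "\<dots> = 0" using z1 z2 i1 by simp
    finally show "(\<integral>t. deriv \<phi> t * ((K (u t) - P\<^sub>0 t) \<bullet> z) \<partial>?M) = 0" .
  qed
  then obtain c where c: "AE t in ?M. K (u t) - P\<^sub>0 t = c" by blast
  have "primitive_on T (\<lambda>t. c + P\<^sub>0 t) W" using P\<^sub>0 by (simp add: primitive_on_def)
  moreover have "AE t in ?M. c + P\<^sub>0 t = K (u t)" using c by eventually_elim (simp add: algebra_simps)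
  ultimately show ?thesis by (rule that)
qed

text \<open>Makes the \<open>THE\<close> in \<open>time_trace\<close> usable: exhibiting any
  continuous representative computes the trace.\<close>

lemma trace_unique:
  assumes c: "continuous_on {0..T} c" "AE t in time_measure T. c t = j (u t)" and t: "t \<in> {0..T}"
  shows "tr t u = c t"
  unfolding time_trace_def
proof (rule the_equality)
  show "\<exists>d. continuous_on {0..T} d \<and> (AE s in time_measure T. d s = j (u s)) \<and> c t = d t"
    using c by blast
  fix h assume "\<exists>d. continuous_on {0..T} d \<and> (AE s in time_measure T. d s = j (u s)) \<and> h = d t"
  then obtain d where d: "continuous_on {0..T} d" "AE s in time_measure T. d s = j (u s)" "h = d t"
    by blast
  have "AE s in time_measure T. d s = c s" using c(2) d(2) by eventually_elim simp
  from continuous_AE_eq[OF T d(1) c(1) this t] show "h = c t" using d(3) by simp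
qed

lemma trace:
  assumes u: "u \<in> X"
  shows trace_continuous: "continuous_on {0..T} (\<lambda>t. tr t u)"
    and trace_AE: "AE t in time_measure T. tr t u = j (u t)"
    and trace_energy: "(norm (tr T u))\<^sup>2 - (norm (tr 0 u))\<^sup>2 = 2 * ip (dt u) u"
    and trace_bound: "t \<in> {0..T} \<Longrightarrow>
      T * (norm (tr t u))\<^sup>2 \<le> Cj\<^sup>2 * (NY u)\<^sup>2 + T * (2 * NY (dt u) * NY u)"
proof -
  obtain P where P: "primitive_on T P (dt u)" "AE t in time_measure T. P t = K (u t)"
    using wd_primitive[OF X_Y[OF u] wd_dt[OF u]] by blast
  obtain c where c: "continuous_on {0..T} c" "AE t in time_measure T. c t = j (u t)"
    "\<And>s t. 0 \<le> s \<Longrightarrow> s \<le> t \<Longrightarrow> t \<le> T \<Longrightarrow> (norm (c t))\<^sup>2 - (norm (c s))\<^sup>2 =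
       (\<integral>r. indicator {s<..t} r *\<^sub>R (2 * (dt u r \<bullet> u r)) \<partial>time_measure T)"
    "\<And>t. t \<in> {0..T} \<Longrightarrow> T * (norm (c t))\<^sup>2 \<le> Cj\<^sup>2 * (NY u)\<^sup>2 + T * (2 * NY (dt u) * NY u)"
    using continuous_representative[OF X_Y[OF u] dt_L2[OF u] P] by blast
  have eq: "tr t u = c t" if "t \<in> {0..T}" for t by (rule trace_unique[OF c(1,2) that])
  show "continuous_on {0..T} (\<lambda>t. tr t u)" 
    by (rule continuous_on_eq[OF c(1)]) (simp add: eq)
  show "AE t in time_measure T. tr t u = j (u t)"
    using c(2) AE_space by eventually_elim (simp add: eq)
  show "T * (norm (tr t u))\<^sup>2 \<le> Cj\<^sup>2 * (NY u)\<^sup>2 + T * (2 * NY (dt u) * NY u)" if "t \<in> {0..T}"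
    using c(4)[OF that] eq[OF that] by simp
  have "(norm (c T))\<^sup>2 - (norm (c 0))\<^sup>2 =
      (\<integral>r. indicator {0<..T} r *\<^sub>R (2 * (dt u r \<bullet> u r)) \<partial>time_measure T)"
    using T by (intro c(3)) auto
  also have "\<dots> = (\<integral>r. 2 * (dt u r \<bullet> u r) \<partial>time_measure T)"
    by (intro Bochner_Integration.integral_cong) auto
  finally show "(norm (tr T u))\<^sup>2 - (norm (tr 0 u))\<^sup>2 = 2 * ip (dt u) u"
    using eq T by (simp add: L2_ip_def)
qed

lemma trace_add:
  assumes u: "u \<in> X" and v: "v \<in> X" and t: "t \<in> {0..T}"
  shows "tr t (u + v) = tr t u + tr t v"
proof (rule trace_unique[OF _ _ t])
  show "continuous_on {0..T} (\<lambda>t. tr t u + tr t v)" by (intro continuous_intros trace_continuous u v)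
  show "AE t in time_measure T. tr t u + tr t v = j ((u + v) t)"
    using trace_AE[OF u] trace_AE[OF v] by eventually_elim (simp add: j_simps plus_fun_def)
qed

lemma trace_scale:
  assumes u: "u \<in> X" and t: "t \<in> {0..T}"
  shows "tr t (c *\<^sub>R u) = c *\<^sub>R tr t u"
proof (rule trace_unique[OF _ _ t])
  show "continuous_on {0..T} (\<lambda>t. c *\<^sub>R tr t u)" by (intro continuous_intros trace_continuous u)
  show "AE t in time_measure T. c *\<^sub>R tr t u = j ((c *\<^sub>R u) t)"
    using trace_AE[OF u] by eventually_elim (simp add: j_simps scaleR_fun_def)
qed

lemma dt_add_AE: "u \<in> X \<Longrightarrow> v \<in> X \<Longrightarrow> AE t in time_measure T. dt (u + v) t = (dt u + dt v) t"
  by (intro dt_unique L2_space_add wd_add X_Y wd_dt)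

lemma dt_scale_AE: "u \<in> X \<Longrightarrow> AE t in time_measure T. dt (c *\<^sub>R u) t = (c *\<^sub>R dt u) t"
  by (intro dt_unique L2_space_scale wd_scale X_Y wd_dt)

lemma ip_dt_add:
  assumes "u \<in> X" "v \<in> X" "w \<in> Y"
  shows "ip (dt (u + v)) w = ip (dt u) w + ip (dt v) w"
proof -
  have "ip (dt (u + v)) w = ip (dt u + dt v) w"
    by (rule L2_ip_cong[OF dt_L2[OF subspace_add[OF subspace_X]] L2_space_add[OF dt_L2 dt_L2] _ _ dt_add_AE])
       (use assms in auto)
  then show ?thesis using assms by (simp add: ip_add dt_L2)
qed

lemma ip_dt_scale:
  assumes "u \<in> X" "w \<in> Y"
  shows "ip (dt (c *\<^sub>R u)) w = c * ip (dt u) w"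
proof -
  have "ip (dt (c *\<^sub>R u)) w = ip (c *\<^sub>R dt u) w"
    by (rule L2_ip_cong[OF dt_L2[OF subspace_scale[OF subspace_X]] L2_space_scale[OF dt_L2] _ _ dt_scale_AE])
       (use assms in auto)
  then show ?thesis using assms by (simp add: ip_scale dt_L2)
qed

lemma bilinear_dt: "bilinear_form_on X Y (\<lambda>u v. ip (dt u) v)"
  unfolding bilinear_form_on_def
proof (intro conjI ballI)
  show "linear_form_on Y (ip (dt u))" if "u \<in> X" for u
    using bilinear_form_onD(1)[OF bilinear_L2_ip dt_L2[OF that]] .
  show "linear_form_on X (\<lambda>u. ip (dt u) v)" if "v \<in> Y" for v
    using that by (simp add: linear_form_on_def ip_dt_add ip_dt_scale)
qed

text \<open>Polarisation of \<open>trace_energy\<close>: the identity for u + v minus those for u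
  and v.\<close>

theorem integration_by_parts:
  assumes u: "u \<in> X" and v: "v \<in> X"
  shows "ip (dt u) v + ip (dt v) u = tr T u \<bullet> tr T v - tr 0 u \<bullet> tr 0 v"
proof -
  have uv: "u + v \<in> X" by (rule subspace_add[OF subspace_X u v])
  have 0: "0 \<in> {0..T}" "T \<in> {0..T}" using T by auto
  have "(norm (tr T u + tr T v))\<^sup>2 - (norm (tr 0 u + tr 0 v))\<^sup>2 = 2 * ip (dt (u + v)) (u + v)"
    using trace_energy[OF uv] trace_add[OF u v] 0 by simp
  also have "ip (dt (u + v)) (u + v) = ip (dt u) u + ip (dt u) v + (ip (dt v) u + ip (dt v) v)"
    using u v uv by (simp add: ip_dt_add ip_add_right dt_L2 X_Y)
  finally show ?thesis
    using trace_energy[OF u] trace_energy[OF v]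
    by (simp add: power2_norm_eq_inner inner_simps inner_commute)
qed

text \<open>\<open>trace_bound\<close> divided by T, with both L2 norms replaced by the larger norm
  of X.\<close>

lemma trace_norm_bound:
  assumes u: "u \<in> X" and t: "t \<in> {0..T}"
  shows "norm (tr t u) \<le> sqrt (Cj\<^sup>2 / T + 2) * NX u"
proof -
  have n: "0 \<le> NX u" by (rule seminorm_onD(2)[OF seminorm_X u])
  have "T * (norm (tr t u))\<^sup>2 \<le> Cj\<^sup>2 * (NX u)\<^sup>2 + T * (2 * NX u * NX u)"
    by (rule order_trans[OF trace_bound[OF u t]])
       (use T n in \<open>intro add_mono mult_left_mono mult_mono power_mono NY_le_NX NY_dt_le_NX, auto\<close>)
  then have "(norm (tr t u))\<^sup>2 \<le> (Cj\<^sup>2 / T + 2) * (NX u)\<^sup>2"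
    using T by (simp add: field_simps power2_eq_square)
  then have "sqrt ((norm (tr t u))\<^sup>2) \<le> sqrt ((Cj\<^sup>2 / T + 2) * (NX u)\<^sup>2)" by (rule real_sqrt_le_mono)
  then show ?thesis using n by (simp add: real_sqrt_mult)
qed

text \<open>Elements of X with explicit derivative and traces. Compactly supported \<psi> identify
  weak derivatives; \<psi> = t and \<psi> = 1 isolate the values at the two end times.\<close>

lemma separated_function:
  assumes \<psi>: "smooth \<psi>"
  shows "(\<lambda>t. \<psi> t *\<^sub>R z) \<in> X"
    and "AE t in time_measure T. dt (\<lambda>t. \<psi> t *\<^sub>R z) t = deriv \<psi> t *\<^sub>R K z"
    and "t \<in> {0..T} \<Longrightarrow> tr t (\<lambda>t. \<psi> t *\<^sub>R z) = \<psi> t *\<^sub>R j z"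
proof -
  let ?u = "\<lambda>t. \<psi> t *\<^sub>R z"
  have Y: "?u \<in> Y" by (rule smooth_scaleR_L2[OF \<psi>])
  have wd: "wd ?u (\<lambda>t. deriv \<psi> t *\<^sub>R K z)"
    unfolding wd_def
  proof (intro conjI allI impI smooth_scaleR_L2 smooth_deriv \<psi>)
    fix \<phi> \<zeta> assume \<phi>: "test_function T \<phi>"
    note sm = test_function_smooth[OF \<phi>]
    have d: "((\<lambda>t. \<phi> t * \<psi> t) has_real_derivative deriv \<phi> t * \<psi> t + \<phi> t * deriv \<psi> t) (at t)" for t
      by (rule derivative_eq_intros smooth_has_derivative sm \<psi> refl | simp)+
    have "primitive_on T (\<lambda>t. \<phi> t * \<psi> t) (\<lambda>t. deriv \<phi> t * \<psi> t + \<phi> t * deriv \<psi> t)"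
      by (rule primitive_on_C1[OF d])
         (intro continuous_intros smooth_continuous smooth_deriv sm \<psi>)
    from primitive_on_total[OF this T]
    have "(\<integral>t. deriv \<phi> t * \<psi> t + \<phi> t * deriv \<psi> t \<partial>time_measure T) = 0"
      using test_function_endpoints[OF \<phi>] by simp
    moreover have "integrable (time_measure T) (\<lambda>t. deriv \<phi> t * \<psi> t)"
      "integrable (time_measure T) (\<lambda>t. \<phi> t * deriv \<psi> t)"
      by (intro smooth_integrable smooth_mult smooth_deriv sm \<psi>)+
    ultimately have "(\<integral>t. deriv \<phi> t * \<psi> t \<partial>time_measure T) = - (\<integral>t. \<phi> t * deriv \<psi> t \<partial>time_measure T)"
      by simp
    moreover have "ip ?u (\<lambda>t. deriv \<phi> t *\<^sub>R K \<zeta>) = (\<integral>t. (deriv \<phi> t * \<psi> t) * (z \<bullet> K \<zeta>) \<partial>time_measure T)"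
      unfolding L2_ip_def by (intro Bochner_Integration.integral_cong) auto
    moreover have "ip (\<lambda>t. deriv \<psi> t *\<^sub>R K z) (\<lambda>t. \<phi> t *\<^sub>R \<zeta>) =
        (\<integral>t. (\<phi> t * deriv \<psi> t) * (K z \<bullet> \<zeta>) \<partial>time_measure T)"
      unfolding L2_ip_def by (intro Bochner_Integration.integral_cong) auto
    moreover have "K z \<bullet> \<zeta> = z \<bullet> K \<zeta>" by (metis K inner_commute)
    ultimately show "ip ?u (\<lambda>t. deriv \<phi> t *\<^sub>R K \<zeta>) = - ip (\<lambda>t. deriv \<psi> t *\<^sub>R K z) (\<lambda>t. \<phi> t *\<^sub>R \<zeta>)"
      by simp
  qed
  show "?u \<in> X" by (rule XI[OF Y wd])
  show "AE t in time_measure T. dt ?u t = deriv \<psi> t *\<^sub>R K z" by (rule dt_unique[OF Y wd])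
  show "tr t ?u = \<psi> t *\<^sub>R j z" if "t \<in> {0..T}"
    by (rule trace_unique[OF _ _ that])
       (auto intro!: continuous_intros smooth_continuous \<psi> simp: j_simps)
qed

text \<open>Density of V in H turns boundary identities tested with elements \<open>j z\<close> into
  equalities in H.\<close>

lemma dense_inner_zero:
  assumes "\<And>z. h \<bullet> j z = 0"
  shows "h = 0"
proof -
  have "h \<bullet> y = 0" if "y \<in> closure (range j)" for y
    by (rule continuous_constant_on_closure[OF _ _ that])
       (use assms in \<open>auto intro!: continuous_intros\<close>)
  then show ?thesis using dense by (metis UNIV_I inner_eq_zero_iff)
qed

end

section \<open>The abstract saddle point problem\<close>

text \<open>\<open>\<alpha>\<close> is the elliptic form, \<open>d u v\<close> stands for \<open>\<integral> \<langle>u', v\<rangle>\<close> and \<open>\<tau>\<close> for the terminal trace form.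
  The first equation is solved for \<open>l\<close>, and the Schur complement is coercive on \<open>X\<close> because
  \<open>d u\<close> is controlled by \<open>cross u\<close> and \<open>u\<close>.\<close>

locale saddle =
  fixes Y X :: "'a::real_vector set" and N NX :: "'a \<Rightarrow> real"
    and \<alpha> d \<tau> :: "'a \<Rightarrow> 'a \<Rightarrow> real" and M c R :: real
  assumes N: "seminorm_on Y N" and NX: "seminorm_on X NX"
    and complete_Y: "complete_on Y N" and complete_X: "complete_on X NX"
    and X_sub: "X \<subseteq> Y" and N_le: "\<And>u. u \<in> X \<Longrightarrow> N u \<le> NX u"
    and \<alpha>: "bilinear_form_on Y Y \<alpha>" and M: "0 \<le> M"
    and \<alpha>_bound: "\<And>u v. u \<in> Y \<Longrightarrow> v \<in> Y \<Longrightarrow> \<bar>\<alpha> u v\<bar> \<le> M * N u * N v"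
    and c: "0 < c" and \<alpha>_coercive: "\<And>u. u \<in> Y \<Longrightarrow> c * (N u)\<^sup>2 \<le> \<alpha> u u"
    and d: "bilinear_form_on X Y d"
    and d_bound: "\<And>u v. u \<in> X \<Longrightarrow> v \<in> Y \<Longrightarrow> \<bar>d u v\<bar> \<le> NX u * N v"
    and d_dual: "\<And>u K. u \<in> X \<Longrightarrow> 0 \<le> K \<Longrightarrow> (\<And>v. v \<in> Y \<Longrightarrow> \<bar>d u v\<bar> \<le> K * N v) \<Longrightarrow> NX u \<le> N u + K"
    and \<tau>: "bilinear_form_on X X \<tau>" and \<tau>_sym: "\<And>u v. \<tau> u v = \<tau> v u" and \<tau>_pos: "\<And>u. 0 \<le> \<tau> u u"
    and R: "0 \<le> R" and \<tau>_bound: "\<And>u v. u \<in> X \<Longrightarrow> v \<in> X \<Longrightarrow> \<bar>\<tau> u v\<bar> \<le> R * NX u * NX v"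
begin

definition sym :: "'a \<Rightarrow> 'a \<Rightarrow> real" where "sym u v = (\<alpha> u v + \<alpha> v u) / 2"

text \<open>The form of C = B - A_s: besides the derivative, only the skew part of \<alpha> is
  left.\<close>

definition cross :: "'a \<Rightarrow> 'a \<Rightarrow> real" where "cross u v = d u v + \<alpha> u v - sym u v"

definition solves :: "'a \<Rightarrow> 'a \<Rightarrow> ('a \<Rightarrow> real) \<Rightarrow> ('a \<Rightarrow> real) \<Rightarrow> bool"
  where "solves l u f h \<longleftrightarrow> l \<in> Y \<and> u \<in> X \<and> (\<forall>v\<in>Y. sym l v + cross u v = f v) \<and>
    (\<forall>w\<in>X. cross w l - (sym u w + \<tau> u w) = h w)"

lemmas Y_sub = seminorm_onD(1)[OF N] and X_subspace = seminorm_onD(1)[OF NX]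
lemmas N_nonneg = seminorm_onD(2)[OF N] and NX_nonneg = seminorm_onD(2)[OF NX]

lemma XY: "u \<in> X \<Longrightarrow> u \<in> Y" using X_sub by blast

lemma linear_combine:
  "linear_form_on S f \<Longrightarrow> linear_form_on S g \<Longrightarrow> linear_form_on S (\<lambda>x. f x + g x)"
  "linear_form_on S f \<Longrightarrow> linear_form_on S g \<Longrightarrow> linear_form_on S (\<lambda>x. f x - g x)"
  "linear_form_on S f \<Longrightarrow> linear_form_on S (\<lambda>x. f x / k)"
  by (auto simp: linear_form_on_def right_diff_distrib distrib_left add_divide_distrib)

lemma linear_subset: "linear_form_on Y f \<Longrightarrow> linear_form_on X f"
  using XY by (simp add: linear_form_on_def)

lemma bilinear_sym: "bilinear_form_on Y Y sym"
  unfolding bilinear_form_on_def sym_def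
  using \<alpha> by (auto simp: bilinear_form_on_def intro!: linear_combine)

lemma bilinear_cross: "bilinear_form_on X Y cross"
  unfolding bilinear_form_on_def cross_def
proof (intro conjI ballI linear_combine)
  fix u assume u: "u \<in> X"
  show "linear_form_on Y (d u)" by (rule bilinear_form_onD(1)[OF d u])
  show "linear_form_on Y (\<alpha> u)" by (rule bilinear_form_onD(1)[OF \<alpha> XY[OF u]])
  show "linear_form_on Y (sym u)" by (rule bilinear_form_onD(1)[OF bilinear_sym XY[OF u]])
next
  fix v assume v: "v \<in> Y"
  show "linear_form_on X (\<lambda>u. d u v)" by (rule bilinear_form_onD(2)[OF d v])
  show "linear_form_on X (\<lambda>u. \<alpha> u v)" by (rule linear_subset[OF bilinear_form_onD(2)[OF \<alpha> v]])
  show "linear_form_on X (\<lambda>u. sym u v)" by (rule linear_subset[OF bilinear_form_onD(2)[OF bilinear_sym v]])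
qed

lemma sym_commute: "sym u v = sym v u"
  by (simp add: sym_def)

lemma sym_coercive: "u \<in> Y \<Longrightarrow> c * (N u)\<^sup>2 \<le> sym u u"
  using \<alpha>_coercive by (simp add: sym_def)

lemma sym_bound: "u \<in> Y \<Longrightarrow> v \<in> Y \<Longrightarrow> \<bar>sym u v\<bar> \<le> M * N u * N v"
  using \<alpha>_bound[of u v] \<alpha>_bound[of v u] unfolding sym_def by (simp add: mult_ac)

lemma skew_bound: "u \<in> Y \<Longrightarrow> v \<in> Y \<Longrightarrow> \<bar>\<alpha> u v - sym u v\<bar> \<le> M * N u * N v"
proof -
  assume "u \<in> Y" "v \<in> Y"
  moreover have "\<alpha> u v - sym u v = (\<alpha> u v - \<alpha> v u) / 2" by (simp add: sym_def field_simps)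
  ultimately show ?thesis using \<alpha>_bound[of u v] \<alpha>_bound[of v u] by (simp add: mult_ac)
qed

lemma cross_bound:
  assumes u: "u \<in> X" and v: "v \<in> Y"
  shows "\<bar>cross u v\<bar> \<le> (M + 1) * NX u * N v"
proof -
  have "M * N u * N v \<le> M * NX u * N v"
    by (intro mult_right_mono mult_left_mono N_le u M N_nonneg v)
  then show ?thesis
    using d_bound[OF u v] skew_bound[OF XY[OF u] v] unfolding cross_def by (simp add: algebra_simps)
qed

lemma second_bound:
  assumes l: "l \<in> Y" and u: "u \<in> X" and w: "w \<in> X"
  shows "\<bar>cross w l - (sym u w + \<tau> u w)\<bar> \<le> ((M + 1) * N l + (M + R) * NX u) * NX w"
proof -
  have "\<bar>sym u w\<bar> \<le> M * N u * N w" by (intro sym_bound XY u w)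
  also have "\<dots> \<le> M * NX u * NX w"
    using M N_nonneg[OF XY[OF w]] N_nonneg[OF XY[OF u]] NX_nonneg[OF u] by (intro mult_mono N_le u w mult_nonneg_nonneg) auto
  finally show ?thesis
    using cross_bound[OF w l] \<tau>_bound[OF u w] by (simp add: algebra_simps)
qed

text \<open>Removing the skew part of \<alpha>, of size \<open>M * N u\<close>, from
  \<open>cross u\<close> leaves \<open>d u\<close>; \<open>d_dual\<close> converts its dual bound
  into one for \<open>NX u\<close>.\<close>

lemma d_recover:
  assumes u: "u \<in> X" and F: "0 \<le> F" and g: "\<And>v. v \<in> Y \<Longrightarrow> \<bar>cross u v\<bar> \<le> F * N v"
  shows "NX u \<le> N u + (F + M * N u)"
proof (rule d_dual[OF u])
  show "0 \<le> F + M * N u" using F M N_nonneg[OF XY[OF u]] by simp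
  fix v assume v: "v \<in> Y"
  show "\<bar>d u v\<bar> \<le> (F + M * N u) * N v"
    using g[OF v] skew_bound[OF XY[OF u] v] unfolding cross_def by (simp add: distrib_right)
qed

lemma solves_diff:
  assumes "solves l u f h" "solves l' u' f' h'"
  shows "solves (l - l') (u - u') (\<lambda>v. f v - f' v) (\<lambda>w. h w - h' w)"
proof -
  note ls = linear_form_on_diff[OF bilinear_form_onD(2)[OF bilinear_sym] Y_sub]
    linear_form_on_diff[OF bilinear_form_onD(2)[OF bilinear_cross] X_subspace]
    linear_form_on_diff[OF bilinear_form_onD(1)[OF bilinear_cross] Y_sub]
    linear_form_on_diff[OF bilinear_form_onD(2)[OF \<tau>] X_subspace]
  have s: "l \<in> Y" "l' \<in> Y" "u \<in> X" "u' \<in> X" "u \<in> Y" "u' \<in> Y"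
    using assms XY by (auto simp: solves_def)
  have "sym (l - l') v + cross (u - u') v = f v - f' v" if "v \<in> Y" for v
  proof -
    have "sym l v + cross u v = f v" "sym l' v + cross u' v = f' v"
      using assms that by (auto simp: solves_def)
    then show ?thesis using ls(1)[OF that s(1,2)] ls(2)[OF that s(3,4)] by simp
  qed
  moreover have "cross w (l - l') - (sym (u - u') w + \<tau> (u - u') w) = h w - h' w" if "w \<in> X" for w
  proof -
    have "cross w l - (sym u w + \<tau> u w) = h w" "cross w l' - (sym u' w + \<tau> u' w) = h' w"
      using assms that by (auto simp: solves_def)
    then show ?thesis
      using ls(1)[OF XY[OF that] s(5,6)] ls(3)[OF that s(1,2)] ls(4)[OF that s(3,4)] by simp
  qed
  ultimately show ?thesis
    using s subspace_diff[OF Y_sub] subspace_diff[OF X_subspace] by (auto simp: solves_def)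
qed

text \<open>Testing the two equations with l and u and subtracting cancels \<open>cross u l\<close>
  and leaves \<open>sym l l + sym u u + \<tau> u u = f l - h u\<close>. The left side controls
  \<open>N l\<close> and \<open>N u\<close> only; \<open>NX u\<close>, which enters through h, is
  bounded by \<open>d_recover\<close> and the first equation, and Young's inequality absorbs the
  terms in l and u.\<close>

theorem solves_estimate:
  obtains \<kappa> where "0 \<le> \<kappa>"
    "\<And>l u f h F H. solves l u f h \<Longrightarrow> 0 \<le> F \<Longrightarrow> 0 \<le> H \<Longrightarrow> (\<And>v. v \<in> Y \<Longrightarrow> \<bar>f v\<bar> \<le> F * N v) \<Longrightarrow>
      (\<And>w. w \<in> X \<Longrightarrow> \<bar>h w\<bar> \<le> H * NX w) \<Longrightarrow> (N l)\<^sup>2 + (NX u)\<^sup>2 \<le> \<kappa> * (F\<^sup>2 + H\<^sup>2)"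
proof -
  define m where "m = M + 1"
  \<comment> \<open>The constant in the bound of \<open>r\<^sup>2\<close> by
    \<open>G\<^sup>2\<close> that Young's inequality leaves. In \<kappa> the bound for
    \<open>z\<^sup>2\<close> is added, and the outer 2 comes from passing from the square of F + H
    to the sum of squares.\<close>
  define k where "k = (4 / c) * ((1 + m)\<^sup>2 / c + 1)"
  define \<kappa> where "\<kappa> = 2 * (k + 2 + 2 * m\<^sup>2 * k)"
  have m: "0 \<le> m" "1 \<le> m" and k: "0 \<le> k" unfolding m_def k_def using M c by auto
  have \<kappa>: "0 \<le> \<kappa>" unfolding \<kappa>_def using k by simp
  have "(N l)\<^sup>2 + (NX u)\<^sup>2 \<le> \<kappa> * (F\<^sup>2 + H\<^sup>2)"
    if sol: "solves l u f h" and F: "0 \<le> F" and H: "0 \<le> H"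
      and f: "\<And>v. v \<in> Y \<Longrightarrow> \<bar>f v\<bar> \<le> F * N v" and h: "\<And>w. w \<in> X \<Longrightarrow> \<bar>h w\<bar> \<le> H * NX w"
    for l u f h F H
  proof -
    have l: "l \<in> Y" and u: "u \<in> X" and uY: "u \<in> Y" using sol XY by (auto simp: solves_def)
    define x y z G r where "x = N l" and "y = N u" and "z = NX u" and "G = F + H" and "r = N l + N u"
    have pos: "0 \<le> x" "0 \<le> y" "0 \<le> z" "0 \<le> G" "0 \<le> r"
      unfolding x_def y_def z_def G_def r_def using N_nonneg l uY NX_nonneg u F H by auto
    have z: "z \<le> F + m * r"
    proof -
      have "NX u \<le> N u + ((F + M * N l) + M * N u)"
      proof (rule d_recover[OF u])
        show "0 \<le> F + M * N l" using F M N_nonneg[OF l] by simp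
        fix v assume v: "v \<in> Y"
        have "cross u v = f v - sym l v" using sol v by (auto simp: solves_def)
        then show "\<bar>cross u v\<bar> \<le> (F + M * N l) * N v"
          using f[OF v] sym_bound[OF l v] by (simp add: algebra_simps)
      qed
      then show ?thesis using N_nonneg[OF l]
        unfolding z_def m_def r_def by (simp add: algebra_simps)
    qed
    have "sym l l + cross u l = f l" "cross u l - (sym u u + \<tau> u u) = h u"
      using sol l u by (auto simp: solves_def)
    then have "sym l l + sym u u + \<tau> u u = f l - h u" by simp
    then have "c * (x\<^sup>2 + y\<^sup>2) \<le> F * x + H * z"
      using sym_coercive[OF l] sym_coercive[OF uY] \<tau>_pos[of u] f[OF l] h[OF u]
      unfolding x_def y_def z_def by (simp add: distrib_left)
    also have "\<dots> \<le> G * r + G * (G + m * r)"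
    proof (intro add_mono mult_mono)
      show "z \<le> G + m * r" using z H by (simp add: G_def)
    qed (use F H pos m in \<open>auto simp: G_def r_def x_def y_def N_nonneg uY l\<close>)
    finally have 1: "c * (x\<^sup>2 + y\<^sup>2) \<le> G * r + G * (G + m * r)" .
    have r2: "r\<^sup>2 \<le> 2 * (x\<^sup>2 + y\<^sup>2)"
      unfolding r_def x_def[symmetric] y_def[symmetric]
      using sum_squares_bound[of x y] by (simp add: power2_sum)
    \<comment> \<open>Young's inequality, weighted so that half of the term
      \<open>c * r\<^sup>2 / 2\<close> survives on the left.\<close>
    have "0 \<le> (c * r / 2 - (1 + m) * G)\<^sup>2 / c" using c by simp
    also have "\<dots> = c * r\<^sup>2 / 4 - (1 + m) * G * r + (1 + m)\<^sup>2 * G\<^sup>2 / c"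
      using c by (simp add: field_simps power2_eq_square)
    finally have 2: "(1 + m) * G * r \<le> c * r\<^sup>2 / 4 + (1 + m)\<^sup>2 * G\<^sup>2 / c" by simp
    have "c * r\<^sup>2 / 2 \<le> c * (x\<^sup>2 + y\<^sup>2)" using mult_left_mono[OF r2, of c] c by simp
    also have "\<dots> \<le> (1 + m) * G * r + G\<^sup>2" using 1 by (simp add: algebra_simps power2_eq_square)
    finally have "c * r\<^sup>2 / 4 \<le> ((1 + m)\<^sup>2 / c + 1) * G\<^sup>2" using 2 by (simp add: algebra_simps)
    then have r: "r\<^sup>2 \<le> k * G\<^sup>2" using c unfolding k_def by (simp add: field_simps)
    have "z\<^sup>2 \<le> (F + m * r)\<^sup>2" using z pos by (intro power_mono) auto
    also have "\<dots> \<le> 2 * F\<^sup>2 + 2 * (m * r)\<^sup>2"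
      using sum_squares_bound[of F "m * r"] by (simp add: power2_sum)
    also have "\<dots> \<le> 2 * G\<^sup>2 + 2 * (m\<^sup>2 * (k * G\<^sup>2))"
      unfolding power_mult_distrib
      by (intro add_mono mult_left_mono power_mono r) (use F H in \<open>auto simp: G_def\<close>)
    finally have z2: "z\<^sup>2 \<le> 2 * G\<^sup>2 + 2 * (m\<^sup>2 * (k * G\<^sup>2))" .
    have "x\<^sup>2 \<le> r\<^sup>2" using pos unfolding r_def x_def y_def by (intro power_mono) auto
    then have "x\<^sup>2 + z\<^sup>2 \<le> (k + 2 + 2 * m\<^sup>2 * k) * G\<^sup>2" using r z2 by (simp add: algebra_simps)
    also have "\<dots> \<le> (k + 2 + 2 * m\<^sup>2 * k) * (2 * (F\<^sup>2 + H\<^sup>2))"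
      using sum_squares_bound[of F H] k by (intro mult_left_mono) (auto simp: G_def power2_sum)
    finally show ?thesis unfolding x_def z_def \<kappa>_def by (simp add: algebra_simps)
  qed
  with \<kappa> show ?thesis using that by blast
qed

lemma solves_zero:
  assumes "solves l u f h" "\<And>v. v \<in> Y \<Longrightarrow> f v = 0" "\<And>w. w \<in> X \<Longrightarrow> h w = 0"
  shows "N l = 0" "NX u = 0"
proof -
  have "(N l)\<^sup>2 + (NX u)\<^sup>2 \<le> 0"
  proof (rule solves_estimate)
    fix \<kappa> :: real
    assume \<kappa>: "\<And>l u f h F H. solves l u f h \<Longrightarrow> 0 \<le> F \<Longrightarrow> 0 \<le> H \<Longrightarrow>
      (\<And>v. v \<in> Y \<Longrightarrow> \<bar>f v\<bar> \<le> F * N v) \<Longrightarrow>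
      (\<And>w. w \<in> X \<Longrightarrow> \<bar>h w\<bar> \<le> H * NX w) \<Longrightarrow> (N l)\<^sup>2 + (NX u)\<^sup>2 \<le> \<kappa> * (F\<^sup>2 + H\<^sup>2)"
    have "(N l)\<^sup>2 + (NX u)\<^sup>2 \<le> \<kappa> * (0\<^sup>2 + 0\<^sup>2)"
      by (rule \<kappa>[OF assms(1)]) (simp_all add: assms(2,3))
    then show ?thesis by simp
  qed
  then have "(N l)\<^sup>2 + (NX u)\<^sup>2 = 0" by (intro antisym) auto
  then show "N l = 0" "NX u = 0" by (auto simp: add_nonneg_eq_0_iff)
qed

lemma solve_sym:
  assumes f: "linear_form_on Y f" and fb: "\<And>v. v \<in> Y \<Longrightarrow> \<bar>f v\<bar> \<le> K * N v"
  shows "\<exists>l\<in>Y. \<forall>v\<in>Y. sym l v = f v"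
  by (rule riesz_on[OF N complete_Y bilinear_sym sym_commute c sym_coercive sym_bound f fb])

theorem solves_exists:
  assumes f: "linear_form_on Y f" and fb: "\<And>v. v \<in> Y \<Longrightarrow> \<bar>f v\<bar> \<le> F * N v"
    and h: "linear_form_on X h" and hb: "\<And>w. w \<in> X \<Longrightarrow> \<bar>h w\<bar> \<le> H * NX w"
  shows "\<exists>l u. solves l u f h"
proof -
  define m where "m = M + 1"
  have m: "1 \<le> m" "0 < m" using M by (auto simp: m_def)
  have "\<exists>l\<in>Y. \<forall>v\<in>Y. sym l v = cross u v" if "u \<in> X" for u
    by (rule solve_sym[OF bilinear_form_onD(1)[OF bilinear_cross that] cross_bound[OF that]])
  then obtain L where L: "\<And>u. u \<in> X \<Longrightarrow> L u \<in> Y" "\<And>u v. u \<in> X \<Longrightarrow> v \<in> Y \<Longrightarrow> sym (L u) v = cross u v"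
    by metis
  obtain p where p: "p \<in> Y" "\<And>v. v \<in> Y \<Longrightarrow> sym p v = f v" using solve_sym[OF f fb] by blast
  \<comment> \<open>With \<open>L\<close> for A_s^-1 C, this is the form of the Schur
    complement.\<close>
  define b where "b u w = cross w (L u) + (sym u w + \<tau> u w)" for u w
  \<comment> \<open>Both sides equal \<open>sym (L w) (L u)\<close>, so the elimination keeps the
    form symmetric.\<close>
  have LL: "cross w (L u) = cross u (L w)" if "u \<in> X" "w \<in> X" for u w
    using L that sym_commute by metis
  have b_sym: "b u w = b w u" if "u \<in> X" "w \<in> X" for u w
    unfolding b_def using LL[OF that] sym_commute[of u w] \<tau>_sym[of u w] by simp
  have b_lin: "linear_form_on X (b u)" if u: "u \<in> X" for u
    unfolding b_def
    by (intro linear_combine bilinear_form_onD(2)[OF bilinear_cross L(1)[OF u]]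
        linear_subset[OF bilinear_form_onD(1)[OF bilinear_sym XY[OF u]]] bilinear_form_onD(1)[OF \<tau> u])
  have b_bil: "bilinear_form_on X X b"
    unfolding bilinear_form_on_def
  proof (intro conjI ballI b_lin)
    fix w assume w: "w \<in> X"
    then show "linear_form_on X (\<lambda>u. b u w)"
      using b_lin[OF w] b_sym[OF _ w] X_subspace
      by (simp add: linear_form_on_def subspace_add subspace_scale)
  qed
  have NL: "N (L u) \<le> m / c * NX u" if u: "u \<in> X" for u
  proof -
    have "c * (N (L u))\<^sup>2 \<le> cross u (L u)" using sym_coercive[OF L(1)[OF u]] L[OF u] by simp
    also have "\<dots> \<le> m * NX u * N (L u)" using cross_bound[OF u L(1)[OF u]] by (simp add: m_def)
    finally have "N (L u) * (c * N (L u)) \<le> N (L u) * (m * NX u)" by (simp add: power2_eq_square mult_ac)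
    then have "c * N (L u) \<le> m * NX u"
      using N_nonneg[OF L(1)[OF u]] NX_nonneg[OF u] m by (cases "N (L u) = 0") auto
    then show ?thesis using c by (simp add: field_simps)
  qed
  have b_bound: "\<bar>b u w\<bar> \<le> (m * (m / c) + (M + R)) * NX u * NX w" if u: "u \<in> X" and w: "w \<in> X" for u w
  proof -
    have "\<bar>cross w (L u)\<bar> \<le> m * NX w * N (L u)" using cross_bound[OF w L(1)[OF u]] by (simp add: m_def)
    also have "\<dots> \<le> m * NX w * (m / c * NX u)" by (intro mult_left_mono NL u) (use m NX_nonneg[OF w] in auto)
    finally have 1: "\<bar>cross w (L u)\<bar> \<le> m * (m / c) * NX u * NX w" by (simp add: mult_ac)
    have "\<bar>sym u w\<bar> \<le> M * N u * N w" by (intro sym_bound XY u w)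
    also have "\<dots> \<le> M * NX u * NX w"
      using M N_nonneg[OF XY[OF w]] N_nonneg[OF XY[OF u]] NX_nonneg[OF u] by (intro mult_mono N_le u w mult_nonneg_nonneg) auto
    finally have 2: "\<bar>sym u w\<bar> \<le> M * NX u * NX w" .
    have "\<bar>b u w\<bar> \<le> m * (m / c) * NX u * NX w + (M * NX u * NX w + R * NX u * NX w)"
      unfolding b_def using 1 2 \<tau>_bound[OF u w] by linarith
    then show ?thesis by (simp add: distrib_right)
  qed
  \<comment> \<open>On Y, \<open>cross u\<close> is \<open>sym (L u)\<close>, so its dual norm is at
    most \<open>M * N (L u)\<close>, and the part \<open>sym (L u) (L u)\<close> of
    \<open>b u u\<close> pays for it. The divisor \<open>2 * m\<^sup>2\<close> arises from squaring
    the sum of the two seminorms.\<close>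
  have b_coercive: "c / (2 * m\<^sup>2) * (NX u)\<^sup>2 \<le> b u u" if u: "u \<in> X" for u
  proof -
    have "NX u \<le> N u + (M * N (L u) + M * N u)"
    proof (rule d_recover[OF u])
      show "0 \<le> M * N (L u)" using M N_nonneg[OF L(1)[OF u]] by simp
      show "\<bar>cross u v\<bar> \<le> M * N (L u) * N v" if "v \<in> Y" for v
        using sym_bound[OF L(1)[OF u] that] L(2)[OF u that] by simp
    qed
    also have "\<dots> \<le> m * (N u + N (L u))"
      using N_nonneg[OF L(1)[OF u]] by (simp add: m_def algebra_simps)
    finally have "(NX u)\<^sup>2 \<le> (m * (N u + N (L u)))\<^sup>2" by (rule power_mono[OF _ NX_nonneg[OF u]])
    also have "\<dots> = m\<^sup>2 * (N u + N (L u))\<^sup>2" by (rule power_mult_distrib)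
    also have "\<dots> \<le> m\<^sup>2 * (2 * ((N u)\<^sup>2 + (N (L u))\<^sup>2))"
      using sum_squares_bound[of "N u" "N (L u)"] by (intro mult_left_mono) (auto simp: power2_sum)
    finally have "c / (2 * m\<^sup>2) * (NX u)\<^sup>2 \<le> c / (2 * m\<^sup>2) * (m\<^sup>2 * (2 * ((N u)\<^sup>2 + (N (L u))\<^sup>2)))"
      using c by (intro mult_left_mono) auto
    also have "\<dots> = c * (N u)\<^sup>2 + c * (N (L u))\<^sup>2" using m by (simp add: field_simps)
    also have "\<dots> \<le> sym u u + sym (L u) (L u)"
      by (intro add_mono sym_coercive XY u L)
    also have "\<dots> \<le> b u u" using L(2)[OF u L(1)[OF u]] \<tau>_pos[of u] by (simp add: b_def)
    finally show ?thesis .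
  qed
  \<comment> \<open>This is the second equation after substituting
    \<open>l = p - L u\<close>.\<close>
  have "\<exists>u\<in>X. \<forall>w\<in>X. b u w = cross w p - h w"
  proof (rule riesz_on[OF NX complete_X b_bil b_sym _ b_coercive b_bound])
    show "0 < c / (2 * m\<^sup>2)" using c m by simp
    show "linear_form_on X (\<lambda>w. cross w p - h w)"
      by (intro linear_combine h bilinear_form_onD(2)[OF bilinear_cross p(1)])
    show "\<bar>cross w p - h w\<bar> \<le> ((M + 1) * N p + H) * NX w" if "w \<in> X" for w
      using cross_bound[OF that p(1)] hb[OF that] by (simp add: algebra_simps)
  qed
  then obtain u where u: "u \<in> X" "\<And>w. w \<in> X \<Longrightarrow> b u w = cross w p - h w" by blast
  have "solves (p - L u) u f h"
    unfolding solves_def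
  proof (intro conjI ballI u(1) subspace_diff[OF Y_sub] p(1) L(1))
    fix v assume v: "v \<in> Y"
    have "sym (p - L u) v = sym p v - sym (L u) v"
      by (rule linear_form_on_diff[OF bilinear_form_onD(2)[OF bilinear_sym v] Y_sub p(1) L(1)[OF u(1)]])
    then show "sym (p - L u) v + cross u v = f v" using p(2)[OF v] L(2)[OF u(1) v] by simp
  next
    fix w assume w: "w \<in> X"
    have "cross w (p - L u) = cross w p - cross w (L u)"
      by (rule linear_form_on_diff[OF bilinear_form_onD(1)[OF bilinear_cross w] Y_sub p(1) L(1)[OF u(1)]])
    then show "cross w (p - L u) - (sym u w + \<tau> u w) = h w" using u(2)[OF w] by (simp add: b_def)
  qed
  then show ?thesis by blast
qed

end

section \<open>The parabolic problem\<close>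

lemma scaleR_fun_apply: "(k *\<^sub>R f) x = k *\<^sub>R f x"
  by (simp add: scaleR_fun_def)

lemma dual_space_bounded: "f \<in> dual_space S N \<Longrightarrow> \<exists>K. \<forall>x\<in>S. \<bar>f x\<bar> \<le> K * N x"
  by (simp add: dual_space_def)

lemma dual_spaceI:
  assumes "\<And>x. x \<notin> S \<Longrightarrow> f x = 0" "linear_form_on S f" "\<And>x. x \<in> S \<Longrightarrow> \<bar>f x\<bar> \<le> K * N x"
  shows "f \<in> dual_space S N"
  using assms unfolding dual_space_def linear_form_on_def by blast

lemma linear_form_on_if:
  assumes "linear_form_on S f" "subspace S"
  shows "linear_form_on S (\<lambda>x. if x \<in> S then f x else 0)"
  using assms by (simp add: linear_form_on_def subspace_add subspace_scale)

lemma dual_space_add: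
  assumes "seminorm_on S N" "f \<in> dual_space S N" "g \<in> dual_space S N"
  shows "f + g \<in> dual_space S N"
proof -
  obtain K L where "\<And>x. x \<in> S \<Longrightarrow> \<bar>f x\<bar> \<le> K * N x" "\<And>x. x \<in> S \<Longrightarrow> \<bar>g x\<bar> \<le> L * N x"
    using dual_space_bounded[OF assms(2)] dual_space_bounded[OF assms(3)] by blast
  then have "\<bar>f x + g x\<bar> \<le> (K + L) * N x" if "x \<in> S" for x
    using that by (simp add: distrib_right order_trans[OF abs_triangle_ineq add_mono])
  then show ?thesis
    using assms(2,3) unfolding dual_space_def by (auto simp: plus_fun_def distrib_left)
qed

lemma dual_space_scale:
  assumes "f \<in> dual_space S N"
  shows "c *\<^sub>R f \<in> dual_space S N"
proof -
  obtain K where "\<And>x. x \<in> S \<Longrightarrow> \<bar>f x\<bar> \<le> K * N x"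
    using dual_space_bounded[OF assms] by blast
  then have "\<bar>c * f x\<bar> \<le> (\<bar>c\<bar> * K) * N x" if "x \<in> S" for x
    using mult_left_mono[of "\<bar>f x\<bar>" "K * N x" "\<bar>c\<bar>"] that by (simp add: abs_mult mult.assoc)
  then show ?thesis
    using assms unfolding dual_space_def by (auto simp: scaleR_fun_def distrib_left)
qed

section \<open>Measurability of the time-dependent form\<close>

text \<open>Completeness of Lebesgue measure: a change on a null set keeps measurability.\<close>

lemma time_measurable_AE:
  fixes f g :: "real \<Rightarrow> real"
  assumes "f \<in> borel_measurable (time_measure T)" "AE t in time_measure T. f t = g t"
  shows "g \<in> borel_measurable (time_measure T)"
proof -
  have "(\<lambda>t. indicator {0<..<T} t *\<^sub>R f t) \<in> borel_measurable lebesgue"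
    using assms(1) by (subst (asm) borel_measurable_restrict_space_iff) auto
  moreover have "AE t in lebesgue. indicator {0<..<T} t *\<^sub>R f t = indicator {0<..<T} t *\<^sub>R g t"
    using assms(2) by (subst (asm) AE_restrict_space_iff) (auto elim!: eventually_mono simp: indicator_def)
  ultimately have "(\<lambda>t. indicator {0<..<T} t *\<^sub>R g t) \<in> borel_measurable lebesgue"
    by (rule borel_measurable_AE)
  then show ?thesis by (subst borel_measurable_restrict_space_iff) auto
qed

lemma measurable_simple_function_param:
  assumes F: "simple_function M F" and f: "\<And>x. f x \<in> borel_measurable M"
  shows "(\<lambda>t. f (F t) t) \<in> borel_measurable M"
proof (rule measurable_compose_countable'[where I = "F ` space M"])
  show "F \<in> M \<rightarrow>\<^sub>M count_space (F ` space M)"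
    using F by (subst measurable_count_space_eq2) (auto simp: simple_function_def)
  show "countable (F ` space M)" using F by (simp add: simple_function_def countable_finite)
qed (rule f)

text \<open>Measurability is given for fixed vectors only. Simple functions take finitely many
  values, so each piece has fixed arguments; continuity of \<open>a t\<close> for almost every t
  then gives the limit, which agrees with the target only almost everywhere.\<close>

lemma measurable_bilinear_param:
  fixes u :: "real \<Rightarrow> 'a::{real_normed_vector,second_countable_topology}"
    and v :: "real \<Rightarrow> 'b::{real_normed_vector,second_countable_topology}"
    and a :: "real \<Rightarrow> 'a \<Rightarrow> 'b \<Rightarrow> real"
  assumes u: "u \<in> borel_measurable (time_measure T)" and v: "v \<in> borel_measurable (time_measure T)"
    and meas: "\<And>\<eta> \<zeta>. (\<lambda>t. a t \<eta> \<zeta>) \<in> borel_measurable (time_measure T)"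
    and bil: "AE t in time_measure T. bounded_bilinear (a t)"
  shows "(\<lambda>t. a t (u t) (v t)) \<in> borel_measurable (time_measure T)"
proof -
  let ?M = "time_measure T"
  obtain F where F: "\<And>i. simple_function ?M (F i)" "\<And>t. t \<in> space ?M \<Longrightarrow> (\<lambda>i. F i t) \<longlonglongrightarrow> u t"
    using borel_measurable_implies_sequence_metric[OF u, of 0] by blast
  obtain G where G: "\<And>i. simple_function ?M (G i)" "\<And>t. t \<in> space ?M \<Longrightarrow> (\<lambda>i. G i t) \<longlonglongrightarrow> v t"
    using borel_measurable_implies_sequence_metric[OF v, of 0] by blast
  have 1: "(\<lambda>t. a t (F i t) z) \<in> borel_measurable ?M" for i z
    using measurable_simple_function_param[of ?M "F i" "\<lambda>x t. a t x z", OF F(1) meas] .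
  have 2: "(\<lambda>t. a t (F i t) (G i t)) \<in> borel_measurable ?M" for i
    using measurable_simple_function_param[of ?M "G i" "\<lambda>x t. a t (F i t) x", OF G(1) 1] .
  have ae: "AE t in ?M. lim (\<lambda>i. a t (F i t) (G i t)) = a t (u t) (v t)"
    using bil AE_space
  proof eventually_elim
    case (elim t)
    show ?case
      by (rule limI, rule bounded_bilinear.tendsto[OF elim(1) F(2) G(2)]) (rule elim(2))+
  qed
  have "(\<lambda>t. lim (\<lambda>i. a t (F i t) (G i t))) \<in> borel_measurable ?M"
    using 2 by (rule borel_measurable_lim_metric)
  from time_measurable_AE[OF this ae] show ?thesis .
qed

locale parabolic = gelfand T j
  for T :: real
    and j :: "'v::{real_inner,banach,second_countable_topology} \<Rightarrow> 'h::{real_inner,banach,second_countable_topology}" +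
  fixes a :: "real \<Rightarrow> 'v \<Rightarrow> 'v \<Rightarrow> real" and M c :: real
  assumes a_bilinear: "AE t in time_measure T. bilinear (a t)"
    and a_measurable: "\<And>\<eta> \<zeta>. (\<lambda>t. a t \<eta> \<zeta>) \<in> borel_measurable (time_measure T)"
    and M: "0 \<le> M"
    and a_bounded: "AE t in time_measure T. \<forall>\<eta> \<zeta>. \<bar>a t \<eta> \<zeta>\<bar> \<le> M * norm \<eta> * norm \<zeta>"
    and c: "0 < c"
    and a_coercive: "AE t in time_measure T. \<forall>\<eta>. c * (norm \<eta>)\<^sup>2 \<le> a t \<eta> \<eta>"
begin

definition form :: "(real \<Rightarrow> 'v) \<Rightarrow> (real \<Rightarrow> 'v) \<Rightarrow> real"
  where "form u v = (\<integral>t. a t (u t) (v t) \<partial>time_measure T)"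

lemma a_bounded_bilinear: "AE t in time_measure T. bounded_bilinear (a t)"
  using a_bilinear a_bounded
proof eventually_elim
  case (elim t)
  show ?case
  proof
    show "\<exists>K. \<forall>x y. norm (a t x y) \<le> norm x * norm y * K"
      using elim(2) by (auto intro!: exI[of _ M] simp: mult_ac)
    have l: "linear (a t x)" "linear (\<lambda>x. a t x y)" for x y using elim(1) by (auto simp: bilinear_def)
    show "a t (x + x') y = a t x y + a t x' y" "a t (r *\<^sub>R x) y = r *\<^sub>R a t x y" for x x' y r
      using linear_add[OF l(2)] linear_scale[OF l(2)] by blast+
    show "a t x (y + y') = a t x y + a t x y'" "a t x (r *\<^sub>R y) = r *\<^sub>R a t x y" for x y y' r
      using linear_add[OF l(1)] linear_scale[OF l(1)] by blast+
  qed
qed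

lemma form_integrable:
  assumes u: "u \<in> Y" and v: "v \<in> Y"
  shows "integrable (time_measure T) (\<lambda>t. a t (u t) (v t))" "\<bar>form u v\<bar> \<le> M * NY u * NY v"
proof -
  have m: "(\<lambda>t. a t (u t) (v t)) \<in> borel_measurable (time_measure T)"
    by (rule measurable_bilinear_param[OF L2_spaceD(1)[OF u] L2_spaceD(1)[OF v] a_measurable a_bounded_bilinear])
  have b: "AE t in time_measure T. \<bar>a t (u t) (v t)\<bar> \<le> M * norm (u t) * norm (v t)"
    using a_bounded by eventually_elim blast
  show "integrable (time_measure T) (\<lambda>t. a t (u t) (v t))" by (rule L2_bounded_form(1)[OF u v m b])
  show "\<bar>form u v\<bar> \<le> M * NY u * NY v"
    unfolding form_def using L2_bounded_form(2)[OF u v m b] M by simp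
qed

lemma bilinear_form: "bilinear_form_on Y Y form"
proof -
  have add: "form (u + u') v = form u v + form u' v" "form v (u + u') = form v u + form v u'"
    if "u \<in> Y" "u' \<in> Y" "v \<in> Y" for u u' v
  proof -
    note i = form_integrable(1)[OF L2_space_add[OF that(1,2)] that(3)] form_integrable(1)[OF that(1,3)]
      form_integrable(1)[OF that(2,3)] form_integrable(1)[OF that(3) L2_space_add[OF that(1,2)]]
      form_integrable(1)[OF that(3,1)] form_integrable(1)[OF that(3,2)]
    have "form (u + u') v = (\<integral>t. a t (u t) (v t) + a t (u' t) (v t) \<partial>time_measure T)"
      unfolding form_def
    proof (rule integral_cong_AE)
      show "AE t in time_measure T. a t ((u + u') t) (v t) = a t (u t) (v t) + a t (u' t) (v t)"
        using a_bounded_bilinear by eventually_elim (simp add: plus_fun_def bounded_bilinear.add_left)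
    qed (use i in auto)
    then show "form (u + u') v = form u v + form u' v" using i by (simp add: form_def)
    have "form v (u + u') = (\<integral>t. a t (v t) (u t) + a t (v t) (u' t) \<partial>time_measure T)"
      unfolding form_def
    proof (rule integral_cong_AE)
      show "AE t in time_measure T. a t (v t) ((u + u') t) = a t (v t) (u t) + a t (v t) (u' t)"
        using a_bounded_bilinear by eventually_elim (simp add: plus_fun_def bounded_bilinear.add_right)
    qed (use i in auto)
    then show "form v (u + u') = form v u + form v u'" using i by (simp add: form_def)
  qed
  have scale: "form (k *\<^sub>R u) v = k * form u v" "form v (k *\<^sub>R u) = k * form v u"
    if "u \<in> Y" "v \<in> Y" for u v k
  proof -
    note i = form_integrable(1)[OF L2_space_scale[OF that(1)] that(2), of k] form_integrable(1)[OF that]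
      form_integrable(1)[OF that(2) L2_space_scale[OF that(1)], of k] form_integrable(1)[OF that(2,1)]
    have "form (k *\<^sub>R u) v = (\<integral>t. k * a t (u t) (v t) \<partial>time_measure T)"
      unfolding form_def
    proof (rule integral_cong_AE)
      show "AE t in time_measure T. a t ((k *\<^sub>R u) t) (v t) = k * a t (u t) (v t)"
        using a_bounded_bilinear by eventually_elim (simp add: scaleR_fun_def bounded_bilinear.scaleR_left)
    qed (use i in auto)
    then show "form (k *\<^sub>R u) v = k * form u v" by (simp add: form_def)
    have "form v (k *\<^sub>R u) = (\<integral>t. k * a t (v t) (u t) \<partial>time_measure T)"
      unfolding form_def
    proof (rule integral_cong_AE)
      show "AE t in time_measure T. a t (v t) ((k *\<^sub>R u) t) = k * a t (v t) (u t)"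
        using a_bounded_bilinear by eventually_elim (simp add: scaleR_fun_def bounded_bilinear.scaleR_right)
    qed (use i in auto)
    then show "form v (k *\<^sub>R u) = k * form v u" by (simp add: form_def)
  qed
  show ?thesis using add scale by (simp add: bilinear_form_on_def linear_form_on_def)
qed

lemma form_coercive:
  assumes u: "u \<in> Y"
  shows "c * (NY u)\<^sup>2 \<le> form u u"
proof -
  have "(\<integral>t. c * (norm (u t))\<^sup>2 \<partial>time_measure T) \<le> form u u"
    unfolding form_def
    by (rule integral_mono_AE)
       (use form_integrable(1)[OF u u] L2_spaceD(2)[OF u] a_coercive in \<open>auto elim!: eventually_mono\<close>)
  then show ?thesis by (simp add: L2_norm_square)
qed

sublocale sp: saddle "L2_space T" "X_space T j" "L2_norm T" "X_norm T j" form
  "\<lambda>u v. L2_ip T (dt u) v" "\<lambda>u v. time_trace T j T u \<bullet> time_trace T j T v" M c "Cj\<^sup>2 / T + 2"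
proof
  show "seminorm_on Y NY" by (rule seminorm_L2)
  show "seminorm_on X NX" by (rule seminorm_X)
  show "complete_on Y NY" by (rule complete_L2[OF T])
  show "complete_on X NX" by (rule complete_X)
  show "X \<subseteq> Y" using X_Y by blast
  show "bilinear_form_on Y Y form" by (rule bilinear_form)
  show "bilinear_form_on X Y (\<lambda>u v. ip (dt u) v)" by (rule bilinear_dt)
  have T': "T \<in> {0..T}" using T by simp
  show "bilinear_form_on X X (\<lambda>u v. tr T u \<bullet> tr T v)"
    by (simp add: bilinear_form_on_def linear_form_on_def trace_add[OF _ _ T'] trace_scale[OF _ T'] inner_simps)
  fix u v
  show "\<bar>form u v\<bar> \<le> M * NY u * NY v" if "u \<in> Y" "v \<in> Y" by (rule form_integrable(2)[OF that])
  show "c * (NY u)\<^sup>2 \<le> form u u" if "u \<in> Y" by (rule form_coercive[OF that])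
  show "\<bar>ip (dt u) v\<bar> \<le> NX u * NY v" if "u \<in> X" "v \<in> Y"
    by (rule order_trans[OF L2_ip_bound[OF dt_L2[OF that(1)] that(2)] mult_right_mono[OF NY_dt_le_NX]]) simp
  show "NX u \<le> NY u + K" if u: "u \<in> X" and K: "0 \<le> K" "\<And>v. v \<in> Y \<Longrightarrow> \<bar>ip (dt u) v\<bar> \<le> K * NY v" for K
  proof -
    \<comment> \<open>Carried over to V, the derivative is itself an admissible test function and
      attains its dual norm.\<close>
    have "(NY (dt u))\<^sup>2 \<le> K * NY (dt u)" using K(2)[OF dt_L2[OF u]] by (simp add: L2_ip_self)
    then have "NY (dt u) \<le> K"
      using K(1) by (cases "NY (dt u) = 0") (auto simp: power2_eq_square less_le)
    moreover have "NX u \<le> NY u + NY (dt u)"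
      unfolding NX_eq by (rule sqrt_sum_squares_le_sum) auto
    ultimately show ?thesis by simp
  qed
  show "\<bar>tr T u \<bullet> tr T v\<bar> \<le> (Cj\<^sup>2 / T + 2) * NX u * NX v" if u: "u \<in> X" and v: "v \<in> X"
  proof -
    have "\<bar>tr T u \<bullet> tr T v\<bar> \<le> norm (tr T u) * norm (tr T v)" by (rule Cauchy_Schwarz_ineq2)
    also have "\<dots> \<le> (sqrt (Cj\<^sup>2 / T + 2) * NX u) * (sqrt (Cj\<^sup>2 / T + 2) * NX v)"
      using seminorm_onD(2)[OF seminorm_X u] T
      by (intro mult_mono trace_norm_bound u v T' mult_nonneg_nonneg) auto
    also have "\<dots> = (sqrt (Cj\<^sup>2 / T + 2))\<^sup>2 * NX u * NX v" by (simp add: power2_eq_square mult_ac)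
    also have "(sqrt (Cj\<^sup>2 / T + 2))\<^sup>2 = Cj\<^sup>2 / T + 2"
      using T by (intro real_sqrt_pow2) simp
    finally show ?thesis .
  qed
qed (use M c T NY_le_NX in \<open>auto simp: inner_commute\<close>)

section \<open>The block operator in terms of bilinear forms\<close>

abbreviation "op \<equiv> block_operator T j a"
abbreviation "Yd \<equiv> dual_space Y NY"
abbreviation "Xd \<equiv> dual_space X NX"
abbreviation "\<tau> u w \<equiv> tr T u \<bullet> tr T w"
abbreviation "norm_dom \<equiv> prod_norm NY NX"
abbreviation "norm_ran \<equiv> prod_norm (dual_norm Y NY) (dual_norm X NX)"

lemma op_A_eq: "op_A T a u v = (if v \<in> Y then form u v else 0)"
  by (simp add: op_A_def zero_outside_def form_def)

lemma op_As_eq: "u \<in> Y \<Longrightarrow> op_As T a u v = (if v \<in> Y then sp.sym u v else 0)"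
  by (simp add: op_As_def scaleR_fun_def plus_fun_def op_A_eq dual_operator_def zero_outside_def sp.sym_def)

lemma op_B_eq:
  assumes u: "u \<in> X"
  shows "op_B T j a u v = (if v \<in> Y then ip (dt u) v + form u v else 0)"
proof (cases "v \<in> Y")
  case True
  have "(\<integral>t. blinfun_apply (time_deriv T j u t) (v t) + a t (u t) (v t) \<partial>time_measure T) =
      (\<integral>t. dt u t \<bullet> v t + a t (u t) (v t) \<partial>time_measure T)"
    by (simp add: dt_def riesz_rep_inner)
  also have "\<dots> = ip (dt u) v + form u v"
    using L2_inner(1)[OF dt_L2[OF u] True] form_integrable(1)[OF X_Y[OF u] True]
    by (simp add: L2_ip_def form_def)
  finally show ?thesis using True by (simp add: op_B_def zero_outside_def)
qed (simp add: op_B_def zero_outside_def)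

lemma op_C_eq: "u \<in> X \<Longrightarrow> op_C T j a u v = (if v \<in> Y then sp.cross u v else 0)"
  by (simp add: op_C_def fun_diff_def op_B_eq op_As_eq X_Y sp.cross_def)

lemma op_eq:
  assumes l: "l \<in> Y" and u: "u \<in> X"
  shows "op (l, u) = (\<lambda>v. if v \<in> Y then sp.sym l v + sp.cross u v else 0,
    \<lambda>w. if w \<in> X then sp.cross w l - (sp.sym u w + \<tau> u w) else 0)"
  using l u X_Y
  by (auto simp: block_operator_def fun_eq_iff plus_fun_def fun_diff_def op_As_eq op_C_eq
      dual_operator_def zero_outside_def trace_dual_def)

text \<open>Elements of the duals vanish off their carriers, and so do both components of the block
  operator; equality of functions therefore amounts to equality when tested on the carriers.\<close>

lemma op_eq_iff_solves:
  assumes "l \<in> Y" "u \<in> X" "f \<in> Yd" "h \<in> Xd"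
  shows "op (l, u) = (f, h) \<longleftrightarrow> sp.solves l u f h"
  using assms dual_space_linear(2)[OF assms(3)] dual_space_linear(2)[OF assms(4)]
  by (auto simp: op_eq sp.solves_def fun_eq_iff)

lemma op_self_adjoint: "self_adjoint Y X op"
proof -
  have "pair_functional (op (m, w)) (l, u) = pair_functional (op (l, u)) (m, w)"
    if "l \<in> Y" "m \<in> Y" "u \<in> X" "w \<in> X" for l m u w
    using that sp.sym_commute[of l m] sp.sym_commute[of u w]
    by (simp add: pair_functional_def op_eq inner_commute)
  then show ?thesis by (auto simp: self_adjoint_def dual_operator_def zero_outside_def)
qed

lemma op_first_bound:
  assumes "l \<in> Y" "u \<in> X" "v \<in> Y"
  shows "\<bar>sp.sym l v + sp.cross u v\<bar> \<le> (M * NY l + (M + 1) * NX u) * NY v"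
  using sp.sym_bound[OF assms(1,3)] sp.cross_bound[OF assms(2,3)] by (simp add: distrib_right)

lemma op_range:
  assumes l: "l \<in> Y" and u: "u \<in> X"
  shows "op (l, u) \<in> Yd \<times> Xd"
proof -
  note lin = bilinear_form_onD(1)[OF sp.bilinear_sym l] bilinear_form_onD(1)[OF sp.bilinear_cross u]
    bilinear_form_onD(2)[OF sp.bilinear_cross l] bilinear_form_onD(1)[OF sp.bilinear_sym X_Y[OF u]]
    bilinear_form_onD(1)[OF sp.\<tau> u]
  have 1: "linear_form_on Y (\<lambda>v. sp.sym l v + sp.cross u v)"
    by (intro sp.linear_combine lin)
  have 2: "linear_form_on X (\<lambda>w. sp.cross w l - (sp.sym u w + \<tau> u w))"
    by (intro sp.linear_combine sp.linear_subset lin)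
  show ?thesis unfolding op_eq[OF l u]
  proof (rule SigmaI)
    show "(\<lambda>v. if v \<in> Y then sp.sym l v + sp.cross u v else 0) \<in> Yd"
      by (rule dual_spaceI[where K="M * NY l + (M + 1) * NX u", OF _ linear_form_on_if[OF 1 subspace_L2_space]])
         (simp_all add: op_first_bound[OF l u])
    show "(\<lambda>w. if w \<in> X then sp.cross w l - (sp.sym u w + \<tau> u w) else 0) \<in> Xd"
      by (rule dual_spaceI[where K="(M + 1) * NY l + (M + (Cj\<^sup>2 / T + 2)) * NX u", OF _ linear_form_on_if[OF 2 subspace_X]])
         (simp_all add: sp.second_bound[OF l u])
  qed
qed

lemma op_add:
  assumes l: "l \<in> Y" "l' \<in> Y" and u: "u \<in> X" "u' \<in> X"
  shows "op (l + l', u + u') = op (l, u) + op (l', u')"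
proof -
  note lin = linear_form_onD(1)[OF bilinear_form_onD(2)[OF sp.bilinear_sym]]
    linear_form_onD(1)[OF bilinear_form_onD(2)[OF sp.bilinear_cross]]
    linear_form_onD(1)[OF bilinear_form_onD(1)[OF sp.bilinear_cross]]
    linear_form_onD(1)[OF bilinear_form_onD(2)[OF sp.\<tau>]]
  show ?thesis
    unfolding op_eq[OF l(1) u(1)] op_eq[OF l(2) u(2)]
      op_eq[OF L2_space_add[OF l] subspace_add[OF subspace_X u]]
    using l u X_Y by (auto simp: fun_eq_iff lin)
qed

lemma op_scale:
  assumes l: "l \<in> Y" and u: "u \<in> X"
  shows "op (k *\<^sub>R l, k *\<^sub>R u) = k *\<^sub>R op (l, u)"
proof -
  note lin = linear_form_onD(2)[OF bilinear_form_onD(2)[OF sp.bilinear_sym]]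
    linear_form_onD(2)[OF bilinear_form_onD(2)[OF sp.bilinear_cross]]
    linear_form_onD(2)[OF bilinear_form_onD(1)[OF sp.bilinear_cross]]
    linear_form_onD(2)[OF bilinear_form_onD(2)[OF sp.\<tau>]]
  show ?thesis
    unfolding op_eq[OF l u] op_eq[OF L2_space_scale[OF l] subspace_scale[OF subspace_X u]]
    using l u X_Y by (auto simp: fun_eq_iff scaleR_fun_apply lin algebra_simps)
qed

lemma norm_ran_zero: "norm_ran 0 = 0"
  by (simp add: prod_norm_def zero_prod_def dual_norm_zero[OF seminorm_L2] dual_norm_zero[OF seminorm_X])

lemma op_bounded: "bounded_operator (Y \<times> X) norm_dom (Yd \<times> Xd) norm_ran op"
  unfolding bounded_operator_def
proof (intro conjI ballI allI)
  fix p assume "p \<in> Y \<times> X"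
  then obtain l u where p: "p = (l, u)" "l \<in> Y" "u \<in> X" by auto
  show "op p \<in> Yd \<times> Xd" using op_range p by simp
  show "norm_ran (op (k *\<^sub>R p) - k *\<^sub>R op p) = 0" for k
    using op_scale[OF p(2,3)] p norm_ran_zero by simp
  fix q assume "q \<in> Y \<times> X"
  then obtain l' u' where q: "q = (l', u')" "l' \<in> Y" "u' \<in> X" by auto
  show "norm_ran (op (p + q) - (op p + op q)) = 0"
    using op_add[OF p(2) q(2) p(3) q(3)] p q norm_ran_zero by simp
next
  define R where "R = Cj\<^sup>2 / T + 2"
  \<comment> \<open>Dominates all four coefficients of the two rows. The later factor 2 is the root
    of 4: one 2 for the two rows, one for the square of x + y.\<close>
  define B where "B = M + 1 + R"
  have B: "0 \<le> B" "0 \<le> R" using M T by (auto simp: B_def R_def)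
  have "norm_ran (op p) \<le> 2 * B * norm_dom p" if pin: "p \<in> Y \<times> X" for p
  proof -
    obtain l u where p: "p = (l, u)" and l: "l \<in> Y" and u: "u \<in> X" using pin by auto
    define x y where "x = NY l" and "y = NX u"
    have xy: "0 \<le> x" "0 \<le> y" using seminorm_onD(2)[OF seminorm_X u] by (auto simp: x_def y_def)
    have *: "M * x + (M + 1) * y \<le> B * (x + y)" "(M + 1) * x + (M + R) * y \<le> B * (x + y)"
      using xy B M mult_nonneg_nonneg[of R x] mult_nonneg_nonneg[of R y]
      by (simp_all add: B_def algebra_simps)
    obtain f h where fh: "op p = (f, h)" by (cases "op p")
    have f: "f = (\<lambda>v. if v \<in> Y then sp.sym l v + sp.cross u v else 0)"
      and h: "h = (\<lambda>w. if w \<in> X then sp.cross w l - (sp.sym u w + \<tau> u w) else 0)"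
      using fh op_eq[OF l u] p by auto
    have "dual_norm Y NY f \<le> M * x + (M + 1) * y"
      by (rule dual_norm_le[OF seminorm_L2])
         (use op_first_bound[OF l u] xy M in \<open>auto simp: f x_def y_def\<close>)
    moreover have "dual_norm X NX h \<le> (M + 1) * x + (M + R) * y"
      by (rule dual_norm_le[OF seminorm_X])
         (use sp.second_bound[OF l u] xy M B in \<open>auto simp: h x_def y_def R_def\<close>)
    ultimately have le: "dual_norm Y NY f \<le> B * (x + y)" "dual_norm X NX h \<le> B * (x + y)"
      using * by linarith+
    have mem: "f \<in> Yd" "h \<in> Xd" using op_range[OF l u] fh p by auto
    have "(dual_norm Y NY f)\<^sup>2 + (dual_norm X NX h)\<^sup>2 \<le> (B * (x + y))\<^sup>2 + (B * (x + y))\<^sup>2"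
      by (intro add_mono power_mono le dual_norm_bound(2)[OF seminorm_L2 mem(1)]
          dual_norm_bound(2)[OF seminorm_X mem(2)])
    also have "\<dots> = 2 * B\<^sup>2 * (x + y)\<^sup>2" by (simp add: power_mult_distrib)
    also have "\<dots> \<le> 2 * B\<^sup>2 * (2 * (x\<^sup>2 + y\<^sup>2))"
      using sum_squares_bound[of x y] by (intro mult_left_mono) (auto simp: power2_sum)
    also have "\<dots> = (2 * B)\<^sup>2 * (x\<^sup>2 + y\<^sup>2)" by (simp add: power2_eq_square)
    finally have "sqrt ((dual_norm Y NY f)\<^sup>2 + (dual_norm X NX h)\<^sup>2) \<le> sqrt ((2 * B)\<^sup>2 * (x\<^sup>2 + y\<^sup>2))"
      by (rule real_sqrt_le_mono)
    also have "\<dots> = 2 * B * sqrt (x\<^sup>2 + y\<^sup>2)"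
      using B by (simp add: real_sqrt_mult real_sqrt_abs)
    finally show ?thesis unfolding fh by (simp add: p prod_norm_def x_def y_def)
  qed
  then show "\<exists>K. \<forall>p\<in>Y \<times> X. norm_ran (op p) \<le> K * norm_dom p" by blast
qed

lemma op_surjective:
  assumes f: "f \<in> Yd" and h: "h \<in> Xd"
  shows "\<exists>l\<in>Y. \<exists>u\<in>X. op (l, u) = (f, h)"
proof -
  have "\<exists>l u. sp.solves l u f h"
    by (rule sp.solves_exists[OF dual_space_linear(1)[OF f] dual_norm_bound(1)[OF seminorm_L2 f]
          dual_space_linear(1)[OF h] dual_norm_bound(1)[OF seminorm_X h]])
  then obtain l u where s: "sp.solves l u f h" by blast
  then have "l \<in> Y" "u \<in> X" by (auto simp: sp.solves_def)
  with s show ?thesis using op_eq_iff_solves[OF _ _ f h] by blast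
qed

lemma op_injective:
  assumes "l \<in> Y" "u \<in> X" "l' \<in> Y" "u' \<in> X" "op (l, u) = op (l', u')"
  shows "NY (l - l') = 0" "NX (u - u') = 0"
proof -
  obtain f h where fh: "op (l, u) = (f, h)" by (cases "op (l, u)")
  then have d: "f \<in> Yd" "h \<in> Xd" using op_range[OF assms(1,2)] by auto
  have "sp.solves l u f h" "sp.solves l' u' f h"
    using op_eq_iff_solves[OF assms(1,2) d] op_eq_iff_solves[OF assms(3,4) d] fh assms(5) by auto
  from sp.solves_diff[OF this] have s: "sp.solves (l - l') (u - u') (\<lambda>v. 0) (\<lambda>w. 0)" by simp
  from sp.solves_zero[OF s] show "NY (l - l') = 0" "NX (u - u') = 0" by auto
qed

text \<open>Preimages are unique only up to seminorm zero, so \<open>G\<close> is a choice and its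
  linearity holds up to seminorm zero: as \<open>op\<close> is exactly linear, both sides of each
  linearity law have the same image, and \<open>inj\<close> makes their distance vanish.\<close>

lemma op_invertible: "boundedly_invertible (Y \<times> X) norm_dom (Yd \<times> Xd) norm_ran op"
proof -
  define G where "G q = (SOME p. p \<in> Y \<times> X \<and> op p = q)" for q
  have G: "G q \<in> Y \<times> X" "op (G q) = q" if "q \<in> Yd \<times> Xd" for q
  proof -
    have "\<exists>p. p \<in> Y \<times> X \<and> op p = q" using op_surjective that by force
    from someI_ex[OF this] show "G q \<in> Y \<times> X" "op (G q) = q" unfolding G_def by auto
  qed
  have inj: "norm_dom (p - q) = 0" if "p \<in> Y \<times> X" "q \<in> Y \<times> X" "op p = op q" for p q
  proof -
    obtain l u l' u' where "p = (l, u)" "q = (l', u')" by (metis prod.exhaust)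
    then show ?thesis using op_injective[of l u l' u'] that by (simp add: prod_norm_def)
  qed
  have add: "p + q \<in> Y \<times> X" if "p \<in> Y \<times> X" "q \<in> Y \<times> X" for p q
    using that L2_space_add subspace_add[OF subspace_X] by auto
  have scale: "k *\<^sub>R p \<in> Y \<times> X" if "p \<in> Y \<times> X" for p k
    using that L2_space_scale subspace_scale[OF subspace_X] by auto
  have addd: "p + q \<in> Yd \<times> Xd" if "p \<in> Yd \<times> Xd" "q \<in> Yd \<times> Xd" for p q
    using that dual_space_add[OF seminorm_L2] dual_space_add[OF seminorm_X] by auto
  have scaled: "k *\<^sub>R p \<in> Yd \<times> Xd" if "p \<in> Yd \<times> Xd" for p k
    using that dual_space_scale by auto
  have opa: "op (p + q) = op p + op q" if "p \<in> Y \<times> X" "q \<in> Y \<times> X" for p q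
    using that op_add by auto
  have ops: "op (k *\<^sub>R p) = k *\<^sub>R op p" if "p \<in> Y \<times> X" for p k
    using that op_scale by auto
  have "bounded_operator (Yd \<times> Xd) norm_ran (Y \<times> X) norm_dom G"
    unfolding bounded_operator_def
  proof (intro conjI ballI allI G(1))
    fix p q assume p: "p \<in> Yd \<times> Xd" and q: "q \<in> Yd \<times> Xd"
    show "norm_dom (G (p + q) - (G p + G q)) = 0"
      by (rule inj[OF G(1)[OF addd[OF p q]] add[OF G(1)[OF p] G(1)[OF q]]])
         (simp only: G(2)[OF addd[OF p q]] opa[OF G(1)[OF p] G(1)[OF q]] G(2)[OF p] G(2)[OF q])
  next
    fix k p assume p: "p \<in> Yd \<times> Xd"
    show "norm_dom (G (k *\<^sub>R p) - k *\<^sub>R G p) = 0"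
      by (rule inj[OF G(1)[OF scaled[OF p]] scale[OF G(1)[OF p]]])
         (simp only: G(2)[OF scaled[OF p]] ops[OF G(1)[OF p]] G(2)[OF p])
  next
    show "\<exists>K. \<forall>q\<in>Yd \<times> Xd. norm_dom (G q) \<le> K * norm_ran q"
    proof (rule sp.solves_estimate)
      fix \<kappa> :: real
      assume \<kappa>0: "0 \<le> \<kappa>" and \<kappa>: "\<And>l u f h F H. sp.solves l u f h \<Longrightarrow> 0 \<le> F \<Longrightarrow> 0 \<le> H \<Longrightarrow>
        (\<And>v. v \<in> Y \<Longrightarrow> \<bar>f v\<bar> \<le> F * NY v) \<Longrightarrow>
        (\<And>w. w \<in> X \<Longrightarrow> \<bar>h w\<bar> \<le> H * NX w) \<Longrightarrow> (NY l)\<^sup>2 + (NX u)\<^sup>2 \<le> \<kappa> * (F\<^sup>2 + H\<^sup>2)"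
      have "norm_dom (G q) \<le> sqrt \<kappa> * norm_ran q" if q: "q \<in> Yd \<times> Xd" for q
      proof -
        obtain f h where fh: "q = (f, h)" "f \<in> Yd" "h \<in> Xd" using q by auto
        obtain l u where lu: "G q = (l, u)" "l \<in> Y" "u \<in> X" using G(1)[OF q] by auto
        have "sp.solves l u f h"
          using G(2)[OF q] lu fh op_eq_iff_solves[OF lu(2,3) fh(2,3)] by simp
        then have "(NY l)\<^sup>2 + (NX u)\<^sup>2 \<le> \<kappa> * ((dual_norm Y NY f)\<^sup>2 + (dual_norm X NX h)\<^sup>2)"
          by (rule \<kappa>[OF _ dual_norm_bound(2)[OF seminorm_L2 fh(2)] dual_norm_bound(2)[OF seminorm_X fh(3)]
                dual_norm_bound(1)[OF seminorm_L2 fh(2)] dual_norm_bound(1)[OF seminorm_X fh(3)]])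
        moreover have "G (f, h) = (l, u)" using lu(1) fh(1) by simp
        ultimately show ?thesis
          unfolding fh(1) prod_norm_def by (simp add: real_sqrt_le_mono flip: real_sqrt_mult)
      qed
      then show ?thesis by blast
    qed
  qed
  moreover have "norm_dom (G (op p) - p) = 0" if "p \<in> Y \<times> X" for p
  proof -
    have "op p \<in> Yd \<times> Xd" using that op_range by auto
    from inj[OF G(1)[OF this] that G(2)[OF this]] show ?thesis .
  qed
  moreover have "norm_ran (op (G q) - q) = 0" if "q \<in> Yd \<times> Xd" for q
    using G(2)[OF that] norm_ran_zero by simp
  ultimately show ?thesis unfolding boundedly_invertible_def by blast
qed

lemma NY_zero_AE:
  assumes "u \<in> Y" "v \<in> Y" "NY (u - v) = 0"
  shows "AE t in time_measure T. u t = v t"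
proof -
  have "AE t in time_measure T. (u - v) t = 0"
    using L2_norm_zero_iff[OF subspace_diff[OF subspace_L2_space assms(1,2)]] assms(3) by simp
  then show ?thesis by eventually_elim (simp add: fun_diff_def)
qed

section \<open>Solutions of the parabolic problem\<close>

definition data :: "((real \<Rightarrow> 'v) \<Rightarrow> real) \<Rightarrow> 'h \<Rightarrow> (real \<Rightarrow> 'v) \<Rightarrow> real"
  where "data g u0 = - (zero_outside X g + trace_dual T j 0 u0)"

lemma data_eq: "data g u0 w = (if w \<in> X then - (g w + u0 \<bullet> tr 0 w) else 0)"
  by (simp add: data_def zero_outside_def trace_dual_def)

lemma data_dual:
  assumes g: "g \<in> Yd"
  shows "data g u0 \<in> Xd"
proof -
  have 0: "0 \<in> {0..T}" using T by simp
  note gl = linear_form_onD[OF dual_space_linear(1)[OF g]]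
  have "\<bar>g w + u0 \<bullet> tr 0 w\<bar> \<le> (dual_norm Y NY g + norm u0 * sqrt (Cj\<^sup>2 / T + 2)) * NX w"
    if w: "w \<in> X" for w
  proof -
    have "\<bar>g w\<bar> \<le> dual_norm Y NY g * NY w" by (rule dual_norm_bound(1)[OF seminorm_L2 g X_Y[OF w]])
    also have "\<dots> \<le> dual_norm Y NY g * NX w"
      by (intro mult_left_mono NY_le_NX dual_norm_bound(2)[OF seminorm_L2 g])
    finally have 1: "\<bar>g w\<bar> \<le> dual_norm Y NY g * NX w" .
    have "\<bar>u0 \<bullet> tr 0 w\<bar> \<le> norm u0 * norm (tr 0 w)" by (rule Cauchy_Schwarz_ineq2)
    also have "\<dots> \<le> norm u0 * (sqrt (Cj\<^sup>2 / T + 2) * NX w)"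
      by (intro mult_left_mono trace_norm_bound w 0) simp
    finally show ?thesis using 1 by (simp add: distrib_right)
  qed
  moreover have "linear_form_on X (data g u0)"
    unfolding linear_form_on_def
    by (simp add: data_eq X_Y gl trace_add[OF _ _ 0] trace_scale[OF _ 0] subspace_add[OF subspace_X]
        subspace_scale[OF subspace_X] inner_add_right right_diff_distrib)
  moreover have "data g u0 w = 0" if "w \<notin> X" for w using that by (simp add: data_eq)
  ultimately show ?thesis by (intro dual_spaceI[of X]) (auto simp: data_eq simp del: minus_add_distrib)
qed

text \<open>On X this reads C' = gamma_T' gamma_T - gamma_0' gamma_0 - C. Integration by parts
  treats the derivative, and the skew part of the form changes sign when its arguments are
  exchanged. It explains the terminal term in the block operator.\<close>

lemma cross_swap:
  assumes u: "u \<in> X" and w: "w \<in> X"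
  shows "sp.cross w u = \<tau> u w - tr 0 u \<bullet> tr 0 w - sp.cross u w"
  using integration_by_parts[OF u w] sp.sym_commute[of u w]
  unfolding sp.cross_def by (simp add: sp.sym_def field_simps)

text \<open>For equal components the first row is B u = g, because A_s + C = B; by
  \<open>cross_swap\<close> the second row is then minus the first, minus the initial trace
  term.\<close>

lemma parabolic_solves:
  assumes g: "g \<in> Yd" and u: "u \<in> X" and B: "op_B T j a u = g" and u0: "tr 0 u = u0"
  shows "op (u, u) = (g, data g u0)"
proof -
  have g_eq: "sp.sym u v + sp.cross u v = g v" if "v \<in> Y" for v
    using B[symmetric] op_B_eq[OF u] that by (simp add: sp.cross_def)
  have "sp.solves u u g (data g u0)"
    unfolding sp.solves_def
  proof (intro conjI ballI)
    show "u \<in> Y" "u \<in> X" by (rule X_Y[OF u], rule u)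
    show "sp.sym u v + sp.cross u v = g v" if "v \<in> Y" for v by (rule g_eq[OF that])
    fix w assume w: "w \<in> X"
    show "sp.cross w u - (sp.sym u w + \<tau> u w) = data g u0 w"
      using g_eq[OF X_Y[OF w]] w by (simp add: data_eq cross_swap[OF u w] u0)
  qed
  then show ?thesis using op_eq_iff_solves[OF X_Y[OF u] u g data_dual[OF g]] by simp
qed

text \<open>The difference \<open>e = l - u\<close> satisfies the homogeneous adjoint problem \<open>- e' + A' e = 0\<close>,
  \<open>e T = 0\<close>.\<close>

lemma solution_parabolic:
  assumes g: "g \<in> Yd" and l: "l \<in> Y" and u: "u \<in> X" and sol: "op (l, u) = (g, data g u0)"
  shows "AE t in time_measure T. l t = u t" and "op_B T j a u = g" and "tr 0 u = u0"
proof -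
  have "sp.solves l u g (data g u0)" using sol op_eq_iff_solves[OF l u g data_dual[OF g]] by simp
  then have s1: "\<And>v. v \<in> Y \<Longrightarrow> sp.sym l v + sp.cross u v = g v"
    and s2: "\<And>w. w \<in> X \<Longrightarrow> sp.cross w l - (sp.sym u w + \<tau> u w) = - (g w + u0 \<bullet> tr 0 w)"
    by (auto simp: sp.solves_def data_eq)
  have 0: "0 \<in> {0..T}" "T \<in> {0..T}" using T by auto
  define e where "e = l - u"
  have e: "e \<in> Y" unfolding e_def by (rule subspace_diff[OF subspace_L2_space l X_Y[OF u]])
  have sym_e: "sp.sym e v = sp.sym l v - sp.sym u v" if "v \<in> Y" for v
    unfolding e_def
    by (rule linear_form_on_diff[OF bilinear_form_onD(2)[OF sp.bilinear_sym that] subspace_L2_space l X_Y[OF u]])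
  \<comment> \<open>Combine the second row, \<open>cross_swap\<close> and the first row tested with
    \<open>w\<close>: the terms with \<open>\<tau>\<close> and g cancel.\<close>
  have adj: "ip (dt w) e + form w e = (tr 0 u - u0) \<bullet> tr 0 w" if w: "w \<in> X" for w
  proof -
    have "sp.cross w e = sp.cross w l - sp.cross w u"
      unfolding e_def
      by (rule linear_form_on_diff[OF bilinear_form_onD(1)[OF sp.bilinear_cross w] subspace_L2_space l X_Y[OF u]])
    then have "sp.cross w e + sp.sym e w = (tr 0 u - u0) \<bullet> tr 0 w"
      using s2[OF w] s1[OF X_Y[OF w]] sym_e[OF X_Y[OF w]] cross_swap[OF u w]
      by (simp add: inner_diff_left)
    then show ?thesis using sp.sym_commute[of e w] by (simp add: sp.cross_def)
  qed
  \<comment> \<open>The Riesz representative of A' e; testing \<open>adj\<close> with compactly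
    supported functions shows that it is the derivative of e, and hence that e lies in X.\<close>
  obtain E where E: "E \<in> Y" "\<And>v. v \<in> Y \<Longrightarrow> ip E v = form v e"
  proof -
    have "\<exists>E\<in>Y. \<forall>v\<in>Y. ip E v = form v e"
    proof (rule riesz_on[where c=1 and M=1 and K="M * NY e", OF seminorm_L2 complete_L2[OF T] bilinear_L2_ip])
      show "ip x y = ip y x" for x y by (simp add: L2_ip_def inner_commute)
      show "linear_form_on Y (\<lambda>v. form v e)" by (rule bilinear_form_onD(2)[OF bilinear_form e])
      show "\<bar>form v e\<bar> \<le> M * NY e * NY v" if "v \<in> Y" for v
        using form_integrable(2)[OF that e] by (simp add: mult_ac)
    qed (use L2_ip_bound in \<open>auto simp: L2_ip_self\<close>)
    then show ?thesis using that by blast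
  qed
  have wde: "wd e E"
    unfolding wd_def
  proof (intro conjI allI impI E(1))
    fix \<phi> and z :: 'v assume \<phi>: "test_function T \<phi>"
    let ?w = "\<lambda>t. \<phi> t *\<^sub>R z"
    note sep = separated_function[OF test_function_smooth[OF \<phi>], where z = z]
    have "ip (dt ?w) e = ip (\<lambda>t. deriv \<phi> t *\<^sub>R K z) e"
      by (rule L2_ip_cong[OF dt_L2[OF sep(1)] test_L2(2)[OF \<phi>] e e sep(2)]) simp
    also have "\<dots> = ip e (\<lambda>t. deriv \<phi> t *\<^sub>R K z)" by (simp add: L2_ip_def inner_commute)
    finally have "ip e (\<lambda>t. deriv \<phi> t *\<^sub>R K z) + ip E ?w = 0"
      using adj[OF sep(1)] E(2)[OF X_Y[OF sep(1)]] sep(3)[OF 0(1)] test_function_endpoints[OF \<phi>] by simp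
    then show "ip e (\<lambda>t. deriv \<phi> t *\<^sub>R K z) = - ip E ?w" by simp
  qed
  have eX: "e \<in> X" by (rule XI[OF e wde])
  have dte: "ip (dt e) v = form v e" if "v \<in> Y" for v
  proof -
    have "ip (dt e) v = ip E v"
      by (rule L2_ip_cong[OF dt_L2[OF eX] E(1) that that dt_unique[OF e wde]]) simp
    then show ?thesis using E(2)[OF that] by simp
  qed
  have bdry: "tr T e \<bullet> tr T w - tr 0 e \<bullet> tr 0 w = (tr 0 u - u0) \<bullet> tr 0 w" if w: "w \<in> X" for w
    using adj[OF w] integration_by_parts[OF eX w] dte[OF X_Y[OF w]] by simp
  \<comment> \<open>The function t z vanishes at 0 and has the trace \<open>T *\<^sub>R j z\<close>
    at T, so it isolates the terminal value.\<close>
  have eT: "tr T e = 0"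
  proof (rule dense_inner_zero)
    fix z :: 'v
    have "smooth (\<lambda>t. t)" by (rule smooth_antiderivative(1)[OF smooth_const[of 1]]) (rule DERIV_ident)
    note sep = separated_function[OF this, where z = z]
    show "tr T e \<bullet> j z = 0" using bdry[OF sep(1)] sep(3)[OF 0(1)] sep(3)[OF 0(2)] T by simp
  qed
  \<comment> \<open>The terminal value is known to vanish, so constant functions isolate the initial
    one.\<close>
  have e0: "tr 0 e + (tr 0 u - u0) = 0"
  proof (rule dense_inner_zero)
    fix z :: 'v
    note sep = separated_function[OF smooth_const[of 1], where z = z]
    show "(tr 0 e + (tr 0 u - u0)) \<bullet> j z = 0"
      using bdry[OF sep(1)] sep(3)[OF 0(1)] eT by (simp add: inner_simps)
  qed
  \<comment> \<open>The energy identity equates a nonpositive number with the nonnegative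
    \<open>2 * form e e\<close>, so both vanish.\<close>
  have "- (norm (tr 0 e))\<^sup>2 = 2 * form e e" using trace_energy[OF eX] dte[OF e] eT by simp
  moreover have "c * (NY e)\<^sup>2 \<le> form e e" by (rule form_coercive[OF e])
  moreover have "0 \<le> c * (NY e)\<^sup>2" using c by simp
  ultimately have z: "c * (NY e)\<^sup>2 = 0" "(norm (tr 0 e))\<^sup>2 = 0"
    using zero_le_power2[of "norm (tr 0 e)"] by linarith+
  then have NYe: "NY e = 0" and "tr 0 e = 0" using c by auto
  then show "tr 0 u = u0" using e0 by simp
  show "AE t in time_measure T. l t = u t"
    by (rule NY_zero_AE[OF l X_Y[OF u]]) (use NYe in \<open>simp add: e_def\<close>)
  show "op_B T j a u = g"
  proof
    fix v
    show "op_B T j a u v = g v"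
    proof (cases "v \<in> Y")
      case True
      have "sp.sym e v = 0" using sp.sym_bound[OF e True] NYe by simp
      then show ?thesis using s1[OF True] sym_e[OF True] True by (simp add: op_B_eq[OF u] sp.cross_def)
    next
      case False
      then show ?thesis using dual_space_linear(2)[OF g] by (simp add: op_B_eq[OF u])
    qed
  qed
qed

theorem well_posed:
  assumes g: "g \<in> Yd"
  shows "\<exists>l\<in>Y. \<exists>u\<in>X.
    op (l, u) = (g, data g u0) \<and>
    (\<forall>l2\<in>Y. \<forall>u2\<in>X. op (l2, u2) = (g, data g u0) \<longrightarrow>
      (AE t in time_measure T. l2 t = l t) \<and> (AE t in time_measure T. u2 t = u t)) \<and>
    (AE t in time_measure T. l t = u t) \<and>
    op_B T j a u = g \<and> time_trace T j 0 u = u0 \<and>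
    (\<forall>w\<in>X. op_B T j a w = g \<and> time_trace T j 0 w = u0 \<longrightarrow> (AE t in time_measure T. w t = u t))"
proof -
  obtain l u where l: "l \<in> Y" and u: "u \<in> X" and sol: "op (l, u) = (g, data g u0)"
    using op_surjective[OF g data_dual[OF g]] by blast
  have uniq: "(AE t in time_measure T. l2 t = l t) \<and> (AE t in time_measure T. u2 t = u t)"
    if "l2 \<in> Y" "u2 \<in> X" "op (l2, u2) = (g, data g u0)" for l2 u2
  proof -
    note i = op_injective[OF that(1,2) l u that(3)[folded sol]]
    have "NY (u2 - u) = 0" using i(2) NY_le_NX[of "u2 - u"] by (simp add: antisym)
    then show ?thesis using i(1) NY_zero_AE that l u X_Y by blast
  qed
  have "AE t in time_measure T. w t = u t"
    if "w \<in> X" "op_B T j a w = g" "time_trace T j 0 w = u0" for w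
    using uniq[OF X_Y[OF that(1)] that(1) parabolic_solves[OF g that]] by blast
  then show ?thesis
    using l u sol uniq solution_parabolic[OF g l u sol] by blast
qed

end

theorem mainTheorem2:
  fixes T :: real
    and j :: "'v::{real_inner,banach,second_countable_topology} \<Rightarrow> 'h::{real_inner,banach,second_countable_topology}"
    and a :: "real \<Rightarrow> 'v \<Rightarrow> 'v \<Rightarrow> real"
    and Y X :: "(real \<Rightarrow> 'v) set"
    and Y' X' :: "((real \<Rightarrow> 'v) \<Rightarrow> real) set"
  assumes T_pos: "0 < T"
    and embedding: "bounded_linear j" "inj j"
    and dense: "closure (range j) = UNIV"
    and compact_embedding: "\<And>S. bounded S \<Longrightarrow> compact (closure (j ` S))"
    and a_bilinear: "AE t in time_measure T. bilinear (a t)"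
    and a_measurable: "\<And>\<eta> \<zeta>. (\<lambda>t. a t \<eta> \<zeta>) \<in> borel_measurable (time_measure T)"
    and a_bounded: "\<exists>M. AE t in time_measure T. \<forall>\<eta> \<zeta>. \<bar>a t \<eta> \<zeta>\<bar> \<le> M * norm \<eta> * norm \<zeta>"
    and a_coercive: "\<exists>\<alpha>>0. AE t in time_measure T. \<forall>\<eta>. \<alpha> * (norm \<eta>)\<^sup>2 \<le> a t \<eta> \<eta>"
  defines "Y \<equiv> L2_space T"
    and "X \<equiv> X_space T j"
    and "Y' \<equiv> dual_space (L2_space T) (L2_norm T)"
    and "X' \<equiv> dual_space (X_space T j) (X_norm T j)"
  shows
    "self_adjoint Y X (block_operator T j a) \<and>
     bounded_operator
       (Y \<times> X) (prod_norm (L2_norm T) (X_norm T j))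
       (Y' \<times> X') (prod_norm (dual_norm Y (L2_norm T)) (dual_norm X (X_norm T j)))
       (block_operator T j a) \<and>
     boundedly_invertible
       (Y \<times> X) (prod_norm (L2_norm T) (X_norm T j))
       (Y' \<times> X') (prod_norm (dual_norm Y (L2_norm T)) (dual_norm X (X_norm T j)))
       (block_operator T j a) \<and>
     (\<forall>g\<in>Y'. \<forall>u0.
       \<exists>l\<in>Y. \<exists>u\<in>X.
         block_operator T j a (l, u) = (g, - (zero_outside X g + trace_dual T j 0 u0)) \<and>
         (\<forall>l2\<in>Y. \<forall>u2\<in>X.
            block_operator T j a (l2, u2) = (g, - (zero_outside X g + trace_dual T j 0 u0)) \<longrightarrow>
            (AE t in time_measure T. l2 t = l t) \<and> (AE t in time_measure T. u2 t = u t)) \<and>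
         (AE t in time_measure T. l t = u t) \<and>
         op_B T j a u = g \<and> time_trace T j 0 u = u0 \<and>
         (\<forall>w\<in>X. op_B T j a w = g \<and> time_trace T j 0 w = u0 \<longrightarrow>
            (AE t in time_measure T. w t = u t)))"
proof -
  obtain M where M: "AE t in time_measure T. \<forall>\<eta> \<zeta>. \<bar>a t \<eta> \<zeta>\<bar> \<le> M * norm \<eta> * norm \<zeta>"
    using a_bounded by blast
  obtain c where c: "0 < c" "AE t in time_measure T. \<forall>\<eta>. c * (norm \<eta>)\<^sup>2 \<le> a t \<eta> \<eta>"
    using a_coercive by blast
  \<comment> \<open>The given bound may have either sign, while the locale \<open>parabolic\<close>
    asks for a nonnegative constant.\<close>
  have M': "AE t in time_measure T. \<forall>\<eta> \<zeta>. \<bar>a t \<eta> \<zeta>\<bar> \<le> \<bar>M\<bar> * norm \<eta> * norm \<zeta>"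
    using M
  proof eventually_elim
    case (elim t)
    have "M * norm \<eta> * norm \<zeta> \<le> \<bar>M\<bar> * norm \<eta> * norm \<zeta>" for \<eta> \<zeta> :: 'v
      by (intro mult_right_mono) auto
    with elim show ?case by (meson order_trans)
  qed
  interpret parabolic T j a "\<bar>M\<bar>" c
    by (rule parabolic.intro[OF gelfand.intro parabolic_axioms.intro])
       (rule T_pos embedding dense a_bilinear a_measurable abs_ge_zero M' c)+
  show ?thesis
    unfolding Y_def X_def Y'_def X'_def
    by (intro conjI ballI allI op_self_adjoint op_bounded op_invertible well_posed[unfolded data_def])
qed

end
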